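(* Let $F\xrightarrow{i}X\xrightarrow{p}Y$ be a pointed fiber sequence of bisimplicial sets. For $m\ge0$, $n\ge0$, there is an induced exact sequence of pointed sets $$\pi^{\mathrm A}_{m+1,n+1}(F)\xrightarrow{i_*}\pi^{\mathrm A}_{m+1,n+1}(X)\xrightarrow{p_*}\pi^{\mathrm A}_{m+1,n+1}(Y)\xrightarrow{\partial\overline\partial}\pi^{\mathrm{BC}}_{m,n}(F)\xrightarrow{i_*}\pi^{\mathrm{BC}}_{m,n}(X)\xrightarrow{p_*}\pi^{\mathrm{BC}}_{m,n}(Y).$$
   Context: **Notation.** A bisimplicial set $X$ has face and degeneracy maps $d_i,s_i$ in the first index and $\overline d_j,\overline s_j$ in the second. For simplicial sets $A,B$, $(A\boxtimes B)_{m,n}=A_m\times B_n$. $\Delta^{m,n}=\Delta^m\boxtimes\Delta^n$; elements of $X_{m,n}$ are identified with maps $\Delta^{m,n}\to X$, so faces of such maps make sense. $d_i\Delta^m$ is the $i$-th face of $\Delta^m$ and $\Lambda^m_k=\bigcup_{i\ne k}d_i\Delta^m$. Subobjects of $\Delta^{m,n}$: $\delta\Delta^{m,n}=\partial\Delta^m\boxtimes\Delta^n\cup\Delta^m\boxtimes\partial\Delta^n$; $\Lambda^{m,n}=\Lambda^m_m\boxtimes\Delta^n\cup\Delta^m\boxtimes\Lambda^n_n$; $\delta_{\mathrm A}\Delta^{m,n}=\Lambda^{m,n}\cup\partial\Delta^m\boxtimes\partial\Delta^n$. **Fibrations.** Anodyne extensions are the monomorphisms in the saturated class generated by $\Lambda^m_k\boxtimes\Delta^n\cup\Delta^m\boxtimes\Lambda^n_l\to\Delta^m\boxtimes\Delta^n$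 ($m,n\ge1$, $0\le k\le m$, $0\le l\le n$). Fibrations are the maps with the right lifting property against all anodyne extensions; $X$ is fibrant if $X\to\Delta^{0,0}$ is a fibration. A pointed bisimplicial set has a chosen vertex $*$; constant maps to it are also written $*$. A (pointed) fiber sequence $F\xrightarrow{i}X\xrightarrow{p}Y$ consists of a basepoint-preserving fibration $p:(X,* )\to(Y,* )$ with $Y$ fibrant, and its fiber $F=*\times_YX$ over the base point, with inclusion $i$ and base point that of $X$. **Homotopy.** For $h:K\times\Delta^{1,1}\to X$, operators in the $\Delta^{1,1}$-direction carry a hat. $h$ is a homotopy from $\alpha$ to $\beta$ if $\hat d_0h=\hat{\overline s}_0\alpha$, $\hat{\overline d}_0h=\hat s_0\alpha$ (i.e. $\alpha$ composed with the projection to $K$) and $\hat d_1\hat{\overline d}_1h=\beta$. A map $K\to X$ rel $L\subset K$ is one that is $*$ on $L$; a homotopy rel $L$ is one with $h|_{L\times\Delta^{1,1}}=*$. For fibrant $X$ this is an equivalence relation. $\pi^{\mathrm{BC}}_{m,n}(X)$ (resp. $\pi^{\mathrm A}_{m,n}(X)$) is the set of relative homotopy classes of maps $\Delta^{m,n}\to X$ rel $\delta\Delta^{m,n}$ (resp. rel $\delta_{\mathrm A}\Delta^{m,n}$), pointed by the class $[*]$ of the constant map. Pointed maps induce maps on these sets by composition. **The connecting map $\partial\overline\partial$.** Given $\alpha:\Delta^{m+1,n+1}\to Y$ rel $\delta_{\mathrm A}\Delta^{m+1,n+1}$, choose a lift $\widetilde\alpha:\Delta^{m+1,n+1}\to X$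 with $p\widetilde\alpha=\alpha$ and $\widetilde\alpha|_{\Lambda^{m+1,n+1}}=*$. Then $d_{m+1}\overline d_{n+1}\widetilde\alpha$ is a map $\Delta^{m,n}\to F$ rel $\delta\Delta^{m,n}$, and $\partial\overline\partial[\alpha]:=[d_{m+1}\overline d_{n+1}\widetilde\alpha]$ (well defined). **Exactness** means that the preimage of $[*]$ under each map equals the image of the preceding map. *)

theory Defs
  imports Main "HOL-Library.FuncSet"
begin

section \<open>Simplicial and bisimplicial sets\<close>

text \<open>A monotone map from \<open>[k] = {0, ..., k}\<close> to \<open>[m]\<close> is encoded as the sorted list of its
  values, so that distinct monotone maps are distinct lists and composition is list lookup.\<close>

definition opmaps :: "nat \<Rightarrow> nat \<Rightarrow> nat list set" where
  "opmaps k m = {f. length f = Suc k \<and> sorted f \<and> set f \<subseteq> {..m}}"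

definition opcomp :: "nat list \<Rightarrow> nat list \<Rightarrow> nat list" where
  "opcomp f g = map (\<lambda>i. f ! i) g"

definition opid :: "nat \<Rightarrow> nat list" where
  "opid m = [0..<Suc m]"

text \<open>The coface map from \<open>[m - 1]\<close> to \<open>[m]\<close> that omits \<open>i\<close>.\<close>

definition coface :: "nat \<Rightarrow> nat \<Rightarrow> nat list" where
  "coface m i = filter (\<lambda>j. j \<noteq> i) [0..<Suc m]"

text \<open>(Bi)simplicial sets are presheaves: \<open>sact A m f\<close> is the operator from dimension \<open>m\<close> to
  dimension \<open>k\<close> induced by a monotone map \<open>f\<close> from \<open>[k]\<close> to \<open>[m]\<close>, and \<open>act X m n f g\<close> is the
  operator defined on bidegree \<open>(m, n)\<close>. The source dimension has to be an argument, as the same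
  value may be a cell in several dimensions. Nothing is required outside the carriers.\<close>

record 'a sset =
  scells :: "nat \<Rightarrow> 'a set"
  sact :: "nat \<Rightarrow> nat list \<Rightarrow> 'a \<Rightarrow> 'a"

definition simplicial_set :: "'a sset \<Rightarrow> bool" where
  "simplicial_set A \<longleftrightarrow>
     (\<forall>m k f x. x \<in> scells A m \<and> f \<in> opmaps k m \<longrightarrow> sact A m f x \<in> scells A k) \<and>
     (\<forall>m x. x \<in> scells A m \<longrightarrow> sact A m (opid m) x = x) \<and>
     (\<forall>m k l f g x. x \<in> scells A m \<and> f \<in> opmaps k m \<and> g \<in> opmaps l k
        \<longrightarrow> sact A k g (sact A m f x) = sact A m (opcomp f g) x)"

record 'a biset =
  cells :: "nat \<Rightarrow> nat \<Rightarrow> 'a set"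
  act :: "nat \<Rightarrow> nat \<Rightarrow> nat list \<Rightarrow> nat list \<Rightarrow> 'a \<Rightarrow> 'a"

definition bisimplicial_set :: "'a biset \<Rightarrow> bool" where
  "bisimplicial_set X \<longleftrightarrow>
     (\<forall>m n k l f g x. x \<in> cells X m n \<and> f \<in> opmaps k m \<and> g \<in> opmaps l n
        \<longrightarrow> act X m n f g x \<in> cells X k l) \<and>
     (\<forall>m n x. x \<in> cells X m n \<longrightarrow> act X m n (opid m) (opid n) x = x) \<and>
     (\<forall>m n k l k' l' f g f' g' x.
        x \<in> cells X m n \<and> f \<in> opmaps k m \<and> g \<in> opmaps l n \<and> f' \<in> opmaps k' k \<and> g' \<in> opmaps l' l
        \<longrightarrow> act X k l f' g' (act X m n f g x) = act X m n (opcomp f f') (opcomp g g') x)"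

text \<open>Maps are families of functions, of which only the values on cells matter; accordingly they are
  compared by \<open>beq\<close>.\<close>

type_synonym ('a, 'b) bfun = "nat \<Rightarrow> nat \<Rightarrow> 'a \<Rightarrow> 'b"

definition bimap :: "'a biset \<Rightarrow> 'b biset \<Rightarrow> ('a, 'b) bfun \<Rightarrow> bool" where
  "bimap X Y f \<longleftrightarrow> bisimplicial_set X \<and> bisimplicial_set Y \<and>
     (\<forall>m n. \<forall>x \<in> cells X m n. f m n x \<in> cells Y m n) \<and>
     (\<forall>m n k l g h. \<forall>x \<in> cells X m n. g \<in> opmaps k m \<longrightarrow> h \<in> opmaps l n \<longrightarrow>
        f k l (act X m n g h x) = act Y m n g h (f m n x))"

definition beq :: "'a biset \<Rightarrow> ('a, 'b) bfun \<Rightarrow> ('a, 'b) bfun \<Rightarrow> bool" where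
  "beq X f g \<longleftrightarrow> (\<forall>m n. \<forall>x \<in> cells X m n. f m n x = g m n x)"

definition bid :: "('a, 'a) bfun" where
  "bid = (\<lambda>m n x. x)"

definition bcomp :: "('b, 'c) bfun \<Rightarrow> ('a, 'b) bfun \<Rightarrow> ('a, 'c) bfun"  (infixl "\<circ>\<^sub>b" 55) where
  "g \<circ>\<^sub>b f = (\<lambda>m n x. g m n (f m n x))"

definition bmono :: "'a biset \<Rightarrow> 'b biset \<Rightarrow> ('a, 'b) bfun \<Rightarrow> bool" where
  "bmono X Y f \<longleftrightarrow> bimap X Y f \<and> (\<forall>m n. inj_on (f m n) (cells X m n))"

definition biso :: "'a biset \<Rightarrow> 'b biset \<Rightarrow> ('a, 'b) bfun \<Rightarrow> bool" where
  "biso X Y f \<longleftrightarrow> bimap X Y f \<and> (\<forall>m n. bij_betw (f m n) (cells X m n) (cells Y m n))"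

definition box :: "'a sset \<Rightarrow> 'b sset \<Rightarrow> ('a \<times> 'b) biset"  (infixr "\<boxtimes>" 75) where
  "A \<boxtimes> B = \<lparr>cells = (\<lambda>m n. scells A m \<times> scells B n),
     act = (\<lambda>m n f g (x, y). (sact A m f x, sact B n g y))\<rparr>"

definition bprod :: "'a biset \<Rightarrow> 'b biset \<Rightarrow> ('a \<times> 'b) biset"  (infixr "\<times>\<^sub>b" 70) where
  "K \<times>\<^sub>b L = \<lparr>cells = (\<lambda>m n. cells K m n \<times> cells L m n),
     act = (\<lambda>m n f g (x, y). (act K m n f g x, act L m n f g y))\<rparr>"

text \<open>Union of two subobjects of a common bisimplicial set.\<close>

definition bcup :: "'a biset \<Rightarrow> 'a biset \<Rightarrow> 'a biset"  (infixl "\<union>\<^sub>b" 65) where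
  "K \<union>\<^sub>b L = K\<lparr>cells := (\<lambda>m n. cells K m n \<union> cells L m n)\<rparr>"

definition simplex :: "nat \<Rightarrow> nat list sset"  ("\<Delta>") where
  "\<Delta> m = \<lparr>scells = (\<lambda>k. opmaps k m), sact = (\<lambda>k f x. opcomp x f)\<rparr>"

definition face :: "nat \<Rightarrow> nat \<Rightarrow> nat list sset" where
  "face m i = (\<Delta> m)\<lparr>scells := (\<lambda>k. {x \<in> opmaps k m. i \<notin> set x})\<rparr>"

definition bdry :: "nat \<Rightarrow> nat list sset"  ("\<partial>\<Delta>") where
  "\<partial>\<Delta> m = (\<Delta> m)\<lparr>scells := (\<lambda>k. \<Union>i \<in> {..m}. scells (face m i) k)\<rparr>"

definition horn :: "nat \<Rightarrow> nat \<Rightarrow> nat list sset"  ("\<Lambda>") where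
  "\<Lambda> m k = (\<Delta> m)\<lparr>scells := (\<lambda>j. \<Union>i \<in> {..m} - {k}. scells (face m i) j)\<rparr>"

type_synonym bisimp = "nat list \<times> nat list"

definition bsimplex :: "nat \<Rightarrow> nat \<Rightarrow> bisimp biset" where
  "bsimplex m n = \<Delta> m \<boxtimes> \<Delta> n"

definition bbdry :: "nat \<Rightarrow> nat \<Rightarrow> bisimp biset" where
  "bbdry m n = \<partial>\<Delta> m \<boxtimes> \<Delta> n \<union>\<^sub>b \<Delta> m \<boxtimes> \<partial>\<Delta> n"

definition bhorn :: "nat \<Rightarrow> nat \<Rightarrow> bisimp biset" where
  "bhorn m n = \<Lambda> m m \<boxtimes> \<Delta> n \<union>\<^sub>b \<Delta> m \<boxtimes> \<Lambda> n n"

definition bbdryA :: "nat \<Rightarrow> nat \<Rightarrow> bisimp biset" where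
  "bbdryA m n = bhorn m n \<union>\<^sub>b \<partial>\<Delta> m \<boxtimes> \<partial>\<Delta> n"


section \<open>Anodyne extensions and fibrations\<close>

text \<open>Levelwise, the square is a pushout of sets: \<open>D\<close> is the quotient of the disjoint union of \<open>B\<close>
  and \<open>C\<close> by the equivalence relation generated by \<open>i a \<sim> u a\<close>.\<close>

definition pushout ::
  "'a biset \<Rightarrow> 'b biset \<Rightarrow> 'c biset \<Rightarrow> 'd biset \<Rightarrow>
   ('a, 'b) bfun \<Rightarrow> ('a, 'c) bfun \<Rightarrow> ('b, 'd) bfun \<Rightarrow> ('c, 'd) bfun \<Rightarrow> bool" where
  "pushout A B C D i u v j \<longleftrightarrow>
     bimap A B i \<and> bimap A C u \<and> bimap B D v \<and> bimap C D j \<and>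
     (\<forall>m n. let T = cells B m n <+> cells C m n;
                q = case_sum (v m n) (j m n);
                R = {(Inl (i m n a), Inr (u m n a)) |a. a \<in> cells A m n}
            in q ` T = cells D m n \<and>
               (\<forall>s \<in> T. \<forall>t \<in> T. q s = q t \<longleftrightarrow> (s, t) \<in> (R \<union> R\<inverse>)\<^sup>*))"

definition retract_of ::
  "'a biset \<Rightarrow> 'b biset \<Rightarrow> ('a, 'b) bfun \<Rightarrow> 'c biset \<Rightarrow> 'd biset \<Rightarrow> ('c, 'd) bfun \<Rightarrow> bool" where
  "retract_of A B f C D g \<longleftrightarrow> bimap A B f \<and> bimap C D g \<and>
     (\<exists>s r s' r'. bimap A C s \<and> bimap C A r \<and> bimap B D s' \<and> bimap D B r' \<and>
        beq A (r \<circ>\<^sub>b s) bid \<and> beq B (r' \<circ>\<^sub>b s') bid \<and>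
        beq A (g \<circ>\<^sub>b s) (s' \<circ>\<^sub>b f) \<and> beq C (f \<circ>\<^sub>b r) (r' \<circ>\<^sub>b g))"

definition is_coproduct ::
  "'i set \<Rightarrow> ('i \<Rightarrow> 'a biset) \<Rightarrow> ('i \<Rightarrow> ('a, 'b) bfun) \<Rightarrow> 'b biset \<Rightarrow> bool" where
  "is_coproduct I A a B \<longleftrightarrow> bisimplicial_set B \<and> (\<forall>i \<in> I. bimap (A i) B (a i)) \<and>
     (\<forall>m n. bij_betw (\<lambda>(i, x). a i m n x) (SIGMA i : I. cells (A i) m n) (cells B m n))"

definition coproduct_map ::
  "'i set \<Rightarrow> ('i \<Rightarrow> 'a biset) \<Rightarrow> ('i \<Rightarrow> 'b biset) \<Rightarrow> ('i \<Rightarrow> ('a, 'b) bfun) \<Rightarrow>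
   'c biset \<Rightarrow> 'd biset \<Rightarrow> ('c, 'd) bfun \<Rightarrow> bool" where
  "coproduct_map I A B f C D g \<longleftrightarrow> bimap C D g \<and> (\<forall>i \<in> I. bimap (A i) (B i) (f i)) \<and>
     (\<exists>a b. is_coproduct I A a C \<and> is_coproduct I B b D \<and>
        (\<forall>i \<in> I. beq (A i) (g \<circ>\<^sub>b a i) (b i \<circ>\<^sub>b f i)))"

primrec tele :: "(nat \<Rightarrow> ('a, 'a) bfun) \<Rightarrow> nat \<Rightarrow> nat \<Rightarrow> ('a, 'a) bfun" where
  "tele f k 0 = bid"
| "tele f k (Suc r) = f (k + r) \<circ>\<^sub>b tele f k r"

text \<open>\<open>D\<close> with the maps \<open>c k\<close> is the colimit of the sequence \<open>A 0 \<rightarrow> A 1 \<rightarrow> \<dots>\<close> with transition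
  maps \<open>f k\<close>; it is formed levelwise.\<close>

definition seq_colimit ::
  "(nat \<Rightarrow> 'a biset) \<Rightarrow> (nat \<Rightarrow> ('a, 'a) bfun) \<Rightarrow> 'b biset \<Rightarrow> (nat \<Rightarrow> ('a, 'b) bfun) \<Rightarrow> bool" where
  "seq_colimit A f D c \<longleftrightarrow>
     (\<forall>k. bimap (A k) (A (Suc k)) (f k)) \<and> (\<forall>k. bimap (A k) D (c k)) \<and>
     (\<forall>k. beq (A k) (c (Suc k) \<circ>\<^sub>b f k) (c k)) \<and>
     (\<forall>m n. cells D m n = (\<Union>k. c k m n ` cells (A k) m n)) \<and>
     (\<forall>k m n. \<forall>x \<in> cells (A k) m n. \<forall>y \<in> cells (A k) m n.
        c k m n x = c k m n y \<longrightarrow> (\<exists>r. tele f k r m n x = tele f k r m n y))"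

type_synonym 'u arrow = "'u biset \<times> ('u, 'u) bfun \<times> 'u biset"

text \<open>Saturation in the sense of Gabriel and Zisman, for classes of maps between bisimplicial sets
  with cells in \<open>'u\<close>. Indexing coproducts by subsets of \<open>'u\<close> loses nothing: the nonempty summands of
  a bisimplicial set have disjoint nonempty sets of cells of bidegree \<open>(0, 0)\<close>.\<close>

definition saturated :: "'u arrow set \<Rightarrow> bool" where
  "saturated S \<longleftrightarrow>
     (\<forall>A f B. (A, f, B) \<in> S \<longrightarrow> bimap A B f) \<and>
     (\<forall>A f B. biso A B f \<longrightarrow> (A, f, B) \<in> S) \<and>
     (\<forall>A B C D i u v j. (A, i, B) \<in> S \<and> pushout A B C D i u v j \<longrightarrow> (C, j, D) \<in> S) \<and>
     (\<forall>A B f C D g. (C, g, D) \<in> S \<and> retract_of A B f C D g \<longrightarrow> (A, f, B) \<in> S) \<and>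
     (\<forall>(I :: 'u set) A B f C D g. (\<forall>i \<in> I. (A i, f i, B i) \<in> S) \<and> coproduct_map I A B f C D g
        \<longrightarrow> (C, g, D) \<in> S) \<and>
     (\<forall>A f D c. (\<forall>k. (A k, f k, A (Suc k)) \<in> S) \<and> seq_colimit A f D c \<longrightarrow> (A 0, c 0, D) \<in> S)"

definition horn_incl :: "nat \<Rightarrow> nat \<Rightarrow> nat \<Rightarrow> nat \<Rightarrow> bisimp arrow" where
  "horn_incl m n k l = (\<Lambda> m k \<boxtimes> \<Delta> n \<union>\<^sub>b \<Delta> m \<boxtimes> \<Lambda> n l, bid, \<Delta> m \<boxtimes> \<Delta> n)"

definition iso_arrow :: "'u arrow \<Rightarrow> 'v arrow \<Rightarrow> bool" where
  "iso_arrow = (\<lambda>(A, f, B) (C, g, D). bimap A B f \<and> bimap C D g \<and>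
     (\<exists>a b. biso A C a \<and> biso B D b \<and> beq A (b \<circ>\<^sub>b f) (g \<circ>\<^sub>b a)))"

text \<open>The copies in \<open>'u\<close> of the generating inclusions.\<close>

definition generators :: "'u arrow set" where
  "generators = {e. \<exists>m n k l. 1 \<le> m \<and> 1 \<le> n \<and> k \<le> m \<and> l \<le> n \<and> iso_arrow e (horn_incl m n k l)}"

definition anodyne :: "'u biset \<Rightarrow> 'u biset \<Rightarrow> ('u, 'u) bfun \<Rightarrow> bool" where
  "anodyne A B i \<longleftrightarrow> bmono A B i \<and> (\<forall>S. saturated S \<and> generators \<subseteq> S \<longrightarrow> (A, i, B) \<in> S)"

definition has_rlp ::
  "'x biset \<Rightarrow> 'y biset \<Rightarrow> ('x, 'y) bfun \<Rightarrow> 'a biset \<Rightarrow> 'b biset \<Rightarrow> ('a, 'b) bfun \<Rightarrow> bool" where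
  "has_rlp X Y p A B i \<longleftrightarrow>
     (\<forall>u v. bimap A X u \<and> bimap B Y v \<and> beq A (p \<circ>\<^sub>b u) (v \<circ>\<^sub>b i) \<longrightarrow>
        (\<exists>h. bimap B X h \<and> beq A (h \<circ>\<^sub>b i) u \<and> beq B (p \<circ>\<^sub>b h) v))"

text \<open>A definition cannot quantify over types, so the lifting property is demanded against the anodyne
  extensions between bisimplicial sets with cells in the type \<open>bisimp\<close>, which contains the generating
  inclusions. It then holds against the anodyne extensions in every type; see
  \<open>fibration_rlp_anodyne\<close> below.\<close>

definition fibration :: "'x biset \<Rightarrow> 'y biset \<Rightarrow> ('x, 'y) bfun \<Rightarrow> bool" where
  "fibration X Y p \<longleftrightarrow> bimap X Y p \<and>
     (\<forall>(A :: bisimp biset) B i. anodyne A B i \<longrightarrow> has_rlp X Y p A B i)"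

definition fibrant :: "'x biset \<Rightarrow> bool" where
  "fibrant X \<longleftrightarrow> fibration X (bsimplex 0 0) (\<lambda>m n _. (replicate (Suc m) 0, replicate (Suc n) 0))"


subsection \<open>Fibrations lift against anodyne extensions in every type\<close>

lemma opid_opmaps: "opid m \<in> opmaps m m"
  by (auto simp: opid_def opmaps_def simp del: upt_Suc)

lemma opcomp_opmaps:
  assumes "f \<in> opmaps k m" "g \<in> opmaps l k"
  shows "opcomp f g \<in> opmaps l m"
proof -
  have f: "length f = Suc k" "sorted f" "set f \<subseteq> {..m}"
    and g: "length g = Suc l" "sorted g" "set g \<subseteq> {..k}"
    using assms by (auto simp: opmaps_def)
  have "sorted (map ((!) f) g)"
    unfolding sorted_iff_nth_mono
  proof (intro allI impI)
    fix i j assume ij: "i \<le> j" "j < length (map ((!) f) g)"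
    have "g ! i \<le> g ! j" using ij g(2) by (simp add: sorted_iff_nth_mono)
    moreover have "g ! j < length f"
      using ij g f(1) by (metis atMost_iff le_imp_less_Suc length_map nth_mem subsetD)
    ultimately show "map ((!) f) g ! i \<le> map ((!) f) g ! j"
      using ij f(2) by (simp add: sorted_nth_mono)
  qed
  moreover have "set (map ((!) f) g) \<subseteq> set f"
    using f(1) g(3) by (auto intro!: nth_mem)
  ultimately show ?thesis using f g by (auto simp: opmaps_def opcomp_def)
qed

lemma opcomp_id_right: "x \<in> opmaps k m \<Longrightarrow> opcomp x (opid k) = x"
  by (auto simp: opmaps_def opcomp_def opid_def intro!: nth_equalityI simp del: upt_Suc)

lemma opcomp_assoc:
  assumes "f \<in> opmaps k m" "g \<in> opmaps l k"
  shows "opcomp (opcomp x f) g = opcomp x (opcomp f g)"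
proof -
  have "i < length f" if "i \<in> set g" for i
    using assms that by (auto simp: opmaps_def)
  then show ?thesis by (auto simp: opcomp_def)
qed

lemma set_opcomp: "x \<in> opmaps k m \<Longrightarrow> g \<in> opmaps l k \<Longrightarrow> set (opcomp x g) \<subseteq> set x"
  by (auto simp: opcomp_def opmaps_def intro!: nth_mem)

lemma simplicial_set_subsimplex:
  assumes "\<And>k. C k \<subseteq> opmaps k m"
    and "\<And>k l x f. x \<in> C k \<Longrightarrow> f \<in> opmaps l k \<Longrightarrow> opcomp x f \<in> C l"
  shows "simplicial_set ((\<Delta> m)\<lparr>scells := C\<rparr>)"
  unfolding simplicial_set_def simplex_def
  using assms opcomp_id_right opcomp_assoc by (auto; blast)

lemma simplicial_set_simplex: "simplicial_set (\<Delta> m)"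
  using simplicial_set_subsimplex[of "\<lambda>k. opmaps k m" m]
  by (simp add: opcomp_opmaps) (simp add: simplex_def)

lemma simplicial_set_horn: "simplicial_set (\<Lambda> m k)"
  unfolding horn_def
proof (rule simplicial_set_subsimplex)
  fix j l x f assume x: "x \<in> (\<Union>i \<in> {..m} - {k}. scells (face m i) j)" and f: "f \<in> opmaps l j"
  then obtain i where "i \<in> {..m} - {k}" "x \<in> opmaps j m" "i \<notin> set x"
    by (auto simp: face_def)
  then show "opcomp x f \<in> (\<Union>i \<in> {..m} - {k}. scells (face m i) l)"
    using opcomp_opmaps[OF _ f] set_opcomp[OF _ f] by (fastforce simp: face_def)
qed (auto simp: face_def)

lemma bisimplicial_set_box:
  assumes "simplicial_set A" "simplicial_set B"
  shows "bisimplicial_set (A \<boxtimes> B)"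
  using assms unfolding bisimplicial_set_def box_def simplicial_set_def by auto

lemma bisimplicial_set_bcup:
  assumes "bisimplicial_set K" "bisimplicial_set L" "act K = act L"
  shows "bisimplicial_set (K \<union>\<^sub>b L)"
  using assms unfolding bisimplicial_set_def bcup_def by auto

lemma act_box_horn:
  "act (\<Lambda> m k \<boxtimes> \<Delta> n) = act (\<Delta> m \<boxtimes> \<Delta> n)" "act (\<Delta> m \<boxtimes> \<Lambda> n l) = act (\<Delta> m \<boxtimes> \<Delta> n)"
  by (auto simp: box_def horn_def simplex_def fun_eq_iff)

lemma scells_horn: "scells (\<Lambda> m k) j \<subseteq> scells (\<Delta> m) j"
  by (auto simp: horn_def simplex_def face_def)

lemma bmono_horn_incl:
  "bmono (\<Lambda> m k \<boxtimes> \<Delta> n \<union>\<^sub>b \<Delta> m \<boxtimes> \<Lambda> n l) (\<Delta> m \<boxtimes> \<Delta> n) bid"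
proof -
  have 1: "bisimplicial_set (\<Lambda> m k \<boxtimes> \<Delta> n \<union>\<^sub>b \<Delta> m \<boxtimes> \<Lambda> n l)"
    by (intro bisimplicial_set_bcup bisimplicial_set_box simplicial_set_horn simplicial_set_simplex)
       (simp add: act_box_horn)
  have 2: "cells (\<Lambda> m k \<boxtimes> \<Delta> n \<union>\<^sub>b \<Delta> m \<boxtimes> \<Lambda> n l) a b \<subseteq> cells (\<Delta> m \<boxtimes> \<Delta> n) a b" for a b
    using scells_horn[of m k a] scells_horn[of n l b] by (auto simp: bcup_def box_def)
  have 3: "act (\<Lambda> m k \<boxtimes> \<Delta> n \<union>\<^sub>b \<Delta> m \<boxtimes> \<Lambda> n l) = act (\<Delta> m \<boxtimes> \<Delta> n)"
    by (simp add: bcup_def act_box_horn)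
  show ?thesis
    unfolding bmono_def bimap_def bid_def
    using 1 2 by (auto simp: 3 bisimplicial_set_box simplicial_set_simplex)
qed

lemma biso_bid: "bisimplicial_set A \<Longrightarrow> biso A A bid"
  by (simp add: biso_def bimap_def bid_def bij_betw_def)

lemma anodyne_horn_incl:
  assumes "1 \<le> m" "1 \<le> n" "k \<le> m" "l \<le> n"
  shows "anodyne (\<Lambda> m k \<boxtimes> \<Delta> n \<union>\<^sub>b \<Delta> m \<boxtimes> \<Lambda> n l) (\<Delta> m \<boxtimes> \<Delta> n) bid"
proof -
  note mono = bmono_horn_incl[of m k n l]
  have "iso_arrow (horn_incl m n k l) (horn_incl m n k l)"
    using mono unfolding iso_arrow_def horn_incl_def bmono_def
    by (auto intro!: exI[of _ bid] biso_bid simp: bimap_def beq_def bcomp_def)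
  then have "horn_incl m n k l \<in> generators"
    using assms by (auto simp: generators_def)
  then show ?thesis
    using mono unfolding anodyne_def horn_incl_def by blast
qed

lemma bimap_comp: "bimap A B f \<Longrightarrow> bimap B C g \<Longrightarrow> bimap A C (g \<circ>\<^sub>b f)"
  unfolding bimap_def bcomp_def by metis

lemma bimap_cells: "bimap A B f \<Longrightarrow> x \<in> cells A m n \<Longrightarrow> f m n x \<in> cells B m n"
  by (simp add: bimap_def)

lemma bimap_act:
  "bimap A B f \<Longrightarrow> x \<in> cells A m n \<Longrightarrow> g \<in> opmaps k m \<Longrightarrow> h \<in> opmaps l n \<Longrightarrow>
   f k l (act A m n g h x) = act B m n g h (f m n x)"
  by (simp add: bimap_def)

lemma act_cells:
  "bisimplicial_set A \<Longrightarrow> x \<in> cells A m n \<Longrightarrow> g \<in> opmaps k m \<Longrightarrow> h \<in> opmaps l n \<Longrightarrow>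
   act A m n g h x \<in> cells A k l"
  by (simp add: bisimplicial_set_def)

lemma biso_inverse:
  assumes "biso A B f"
  shows "bimap B A (\<lambda>m n. inv_into (cells A m n) (f m n))"
proof -
  have f: "bimap A B f" and b: "\<And>m n. bij_betw (f m n) (cells A m n) (cells B m n)"
    using assms by (auto simp: biso_def)
  have A: "bisimplicial_set A" and B: "bisimplicial_set B" using f by (auto simp: bimap_def)
  let ?g = "\<lambda>m n. inv_into (cells A m n) (f m n)"
  have cl: "?g m n y \<in> cells A m n" if "y \<in> cells B m n" for m n y
    using b[of m n] that by (metis bij_betw_imp_surj_on inv_into_into)
  have fg: "f m n (?g m n y) = y" if "y \<in> cells B m n" for m n y
    using b[of m n] that by (metis bij_betw_imp_surj_on f_inv_into_f)
  have gf: "?g m n (f m n x) = x" if "x \<in> cells A m n" for m n x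
    using b[of m n] that by (metis bij_betw_imp_inj_on inv_into_f_f)
  have "?g k l (act B m n g h y) = act A m n g h (?g m n y)"
    if "y \<in> cells B m n" "g \<in> opmaps k m" "h \<in> opmaps l n" for m n k l g h y
  proof -
    have "act B m n g h y = f k l (act A m n g h (?g m n y))"
      using bimap_act[OF f cl[OF that(1)] that(2,3)] fg[OF that(1)] by simp
    then show ?thesis using gf act_cells[OF A cl[OF that(1)] that(2,3)] by simp
  qed
  then show ?thesis using A B cl by (simp add: bimap_def)
qed

lemma has_rlpD:
  assumes "has_rlp X Y p A B i" "bimap A X u" "bimap B Y v"
    and "\<And>m n a. a \<in> cells A m n \<Longrightarrow> p m n (u m n a) = v m n (i m n a)"
  obtains h where "bimap B X h" "\<And>m n a. a \<in> cells A m n \<Longrightarrow> h m n (i m n a) = u m n a"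
    "\<And>m n b. b \<in> cells B m n \<Longrightarrow> p m n (h m n b) = v m n b"
  using assms unfolding has_rlp_def beq_def bcomp_def by metis

lemma has_rlp_iso_arrow:
  assumes iso: "iso_arrow (A, f, B) (C, g, D)" and rlp: "has_rlp X Y p C D g" and p: "bimap X Y p"
  shows "has_rlp X Y p A B f"
proof -
  obtain a b where f: "bimap A B f" and a: "biso A C a" and b: "biso B D b" and g: "bimap C D g"
    and eq: "\<And>m n x. x \<in> cells A m n \<Longrightarrow> b m n (f m n x) = g m n (a m n x)"
    using iso unfolding iso_arrow_def beq_def bcomp_def by auto
  define a' where "a' = (\<lambda>m n. inv_into (cells A m n) (a m n))"
  define b' where "b' = (\<lambda>m n. inv_into (cells B m n) (b m n))"
  have a': "bimap C A a'" and b': "bimap D B b'"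
    using a b biso_inverse unfolding a'_def b'_def by blast+
  have a1: "a m n (a' m n c) = c" if "c \<in> cells C m n" for m n c
    using a that unfolding biso_def a'_def by (metis bij_betw_imp_surj_on f_inv_into_f)
  have a2: "a' m n (a m n c) = c" if "c \<in> cells A m n" for m n c
    using a that unfolding biso_def a'_def by (metis bij_betw_imp_inj_on inv_into_f_f)
  have b2: "b' m n (b m n c) = c" if "c \<in> cells B m n" for m n c
    using b that unfolding biso_def b'_def by (metis bij_betw_imp_inj_on inv_into_f_f)
  have am: "bimap A C a" and bm: "bimap B D b" using a b by (auto simp: biso_def)
  show ?thesis
    unfolding has_rlp_def
  proof (intro allI impI, elim conjE)
    fix u v assume u: "bimap A X u" and v: "bimap B Y v" and e: "beq A (p \<circ>\<^sub>b u) (v \<circ>\<^sub>b f)"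
    have e': "p m n ((u \<circ>\<^sub>b a') m n c) = (v \<circ>\<^sub>b b') m n (g m n c)" if "c \<in> cells C m n" for m n c
    proof -
      have c: "a' m n c \<in> cells A m n" using a' that by (rule bimap_cells)
      have "b' m n (g m n c) = b' m n (b m n (f m n (a' m n c)))"
        using eq[OF c] a1[OF that] by simp
      also have "\<dots> = f m n (a' m n c)" using b2 bimap_cells[OF f c] by simp
      finally show ?thesis using e c by (simp add: beq_def bcomp_def)
    qed
    from has_rlpD[OF rlp bimap_comp[OF a' u] bimap_comp[OF b' v] e']
    obtain h where h: "bimap D X h"
      and h1: "\<And>m n c. c \<in> cells C m n \<Longrightarrow> h m n (g m n c) = (u \<circ>\<^sub>b a') m n c"
      and h2: "\<And>m n d. d \<in> cells D m n \<Longrightarrow> p m n (h m n d) = (v \<circ>\<^sub>b b') m n d"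
      by blast
    have "beq A ((h \<circ>\<^sub>b b) \<circ>\<^sub>b f) u"
      using eq h1 bimap_cells[OF am] a2 by (simp add: beq_def bcomp_def)
    moreover have "beq B (p \<circ>\<^sub>b (h \<circ>\<^sub>b b)) v"
      using h2 bimap_cells[OF bm] b2 by (simp add: beq_def bcomp_def)
    ultimately show "\<exists>h. bimap B X h \<and> beq A (h \<circ>\<^sub>b f) u \<and> beq B (p \<circ>\<^sub>b h) v"
      using bimap_comp[OF bm h] by blast
  qed
qed

lemma has_rlp_biso:
  fixes A B :: "'u biset"
  assumes f: "biso A B f" and p: "bimap X Y p"
  shows "has_rlp X Y p A B f"
proof (rule has_rlp_iso_arrow[OF _ _ p])
  have A: "bisimplicial_set A" and B: "bisimplicial_set B" and fm: "bimap A B f"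
    using f by (auto simp: biso_def bimap_def)
  show "iso_arrow (A, f, B) (B, bid, B)"
    unfolding iso_arrow_def case_prod_conv
  proof (intro conjI exI)
    show "beq A (bid \<circ>\<^sub>b f) (bid \<circ>\<^sub>b f)" by (simp add: beq_def)
  qed (use f fm biso_bid[OF B] in \<open>auto simp: biso_def\<close>)
  show "has_rlp X Y p B B bid"
    unfolding has_rlp_def beq_def bcomp_def bid_def by blast
qed

lemma has_rlp_pushout:
  fixes B :: "'b biset" and C :: "'c biset"
  assumes po: "pushout A B C D i u v j" and rlp: "has_rlp X Y p A B i" and p: "bimap X Y p"
  shows "has_rlp X Y p C D j"
  unfolding has_rlp_def
proof (intro allI impI, elim conjE)
  fix a b assume a: "bimap C X a" and b: "bimap D Y b" and e: "beq C (p \<circ>\<^sub>b a) (b \<circ>\<^sub>b j)"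
  have i: "bimap A B i" and u: "bimap A C u" and v: "bimap B D v" and j: "bimap C D j"
    using po by (auto simp: pushout_def)
  define R :: "nat \<Rightarrow> nat \<Rightarrow> (('b + 'c) \<times> ('b + 'c)) set"
    where "R m n = {(Inl (i m n x), Inr (u m n x)) |x. x \<in> cells A m n}" for m n
  define T where "T m n = cells B m n <+> cells C m n" for m n
  define q where "q m n = case_sum (v m n) (j m n)" for m n
  have q1: "q m n ` T m n = cells D m n" for m n
    using po by (simp add: pushout_def Let_def T_def q_def)
  have q2: "q m n s = q m n t \<longleftrightarrow> (s, t) \<in> (R m n \<union> (R m n)\<inverse>)\<^sup>*"
    if "s \<in> T m n" "t \<in> T m n" for m n s t
    using po that by (simp add: pushout_def Let_def T_def q_def R_def)
  have sq: "v m n (i m n x) = j m n (u m n x)" if "x \<in> cells A m n" for m n x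
  proof -
    have "(Inl (i m n x), Inr (u m n x)) \<in> (R m n \<union> (R m n)\<inverse>)\<^sup>*"
      using that by (auto simp: R_def)
    then show ?thesis
      using q2[of "Inl (i m n x)" m n "Inr (u m n x)"] bimap_cells[OF i that] bimap_cells[OF u that]
      by (auto simp: T_def q_def)
  qed
  have e1: "p m n ((a \<circ>\<^sub>b u) m n x) = (b \<circ>\<^sub>b v) m n (i m n x)" if "x \<in> cells A m n" for m n x
    using e bimap_cells[OF u that] sq[OF that] by (simp add: beq_def bcomp_def)
  from has_rlpD[OF rlp bimap_comp[OF u a] bimap_comp[OF v b] e1]
  obtain h where h: "bimap B X h"
    and h1: "\<And>m n x. x \<in> cells A m n \<Longrightarrow> h m n (i m n x) = (a \<circ>\<^sub>b u) m n x"
    and h2: "\<And>m n x. x \<in> cells B m n \<Longrightarrow> p m n (h m n x) = (b \<circ>\<^sub>b v) m n x"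
    by blast
  define g where "g m n = case_sum (h m n) (a m n)" for m n
  have gR: "g m n s = g m n t" if "(s, t) \<in> (R m n \<union> (R m n)\<inverse>)\<^sup>*" for m n s t
    using that
  proof (induction rule: rtrancl_induct)
    case (step y z)
    then show ?case using h1 by (auto simp: g_def R_def bcomp_def)
  qed simp
  define H where "H m n d = g m n (SOME s. s \<in> T m n \<and> q m n s = d)" for m n d
  have H: "H m n (q m n s) = g m n s" if "s \<in> T m n" for m n s
  proof -
    let ?s = "SOME t. t \<in> T m n \<and> q m n t = q m n s"
    have "?s \<in> T m n \<and> q m n ?s = q m n s" by (rule someI[of _ s]) (use that in simp)
    then show ?thesis using q2 gR that unfolding H_def by blast
  qed
  have Hv: "H m n (v m n x) = h m n x" if "x \<in> cells B m n" for m n x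
    using H[of "Inl x" m n] that by (auto simp: T_def q_def g_def)
  have Hj: "H m n (j m n x) = a m n x" if "x \<in> cells C m n" for m n x
    using H[of "Inr x" m n] that by (auto simp: T_def q_def g_def)
  have D: "(\<exists>x \<in> cells B m n. d = v m n x) \<or> (\<exists>x \<in> cells C m n. d = j m n x)"
    if "d \<in> cells D m n" for m n d
    using that unfolding q1[symmetric] by (auto simp: T_def q_def)
  have Hc: "H m n d \<in> cells X m n" if "d \<in> cells D m n" for m n d
    using D[OF that] Hv Hj bimap_cells[OF h] bimap_cells[OF a] by auto
  have Ha: "H k l (act D m n f g d) = act X m n f g (H m n d)"
    if "d \<in> cells D m n" "f \<in> opmaps k m" "g \<in> opmaps l n" for m n k l f g d
    using D[OF that(1)]
  proof (elim disjE bexE)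
    fix x assume x: "x \<in> cells B m n" "d = v m n x"
    have "bisimplicial_set B" using h by (simp add: bimap_def)
    from act_cells[OF this x(1) that(2,3)] show ?thesis
      by (simp add: x(2) Hv x(1) bimap_act[OF v x(1) that(2,3), symmetric]
          bimap_act[OF h x(1) that(2,3)])
  next
    fix x assume x: "x \<in> cells C m n" "d = j m n x"
    have "bisimplicial_set C" using a by (simp add: bimap_def)
    from act_cells[OF this x(1) that(2,3)] show ?thesis
      by (simp add: x(2) Hj x(1) bimap_act[OF j x(1) that(2,3), symmetric]
          bimap_act[OF a x(1) that(2,3)])
  qed
  have "bimap D X H"
    using Hc Ha b a by (simp add: bimap_def)
  moreover have "beq C (H \<circ>\<^sub>b j) a" using Hj by (simp add: beq_def bcomp_def)
  moreover have "p m n (H m n d) = b m n d" if "d \<in> cells D m n" for m n d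
    using D[OF that] Hv Hj h2 e by (auto simp: beq_def bcomp_def)
  ultimately show "\<exists>h. bimap D X h \<and> beq C (h \<circ>\<^sub>b j) a \<and> beq D (p \<circ>\<^sub>b h) b"
    by (auto simp: beq_def bcomp_def)
qed

lemma has_rlp_retract:
  assumes r: "retract_of A B f C D g" and rlp: "has_rlp X Y p C D g" and p: "bimap X Y p"
  shows "has_rlp X Y p A B f"
  unfolding has_rlp_def
proof (intro allI impI, elim conjE)
  fix u v assume u: "bimap A X u" and v: "bimap B Y v" and e: "beq A (p \<circ>\<^sub>b u) (v \<circ>\<^sub>b f)"
  obtain s t s' t' where f: "bimap A B f" and s: "bimap A C s" and t: "bimap C A t"
    and s': "bimap B D s'" and t': "bimap D B t'"
    and ts_eq: "beq A (t \<circ>\<^sub>b s) bid" and ts'_eq: "beq B (t' \<circ>\<^sub>b s') bid"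
    and gs_eq: "beq A (g \<circ>\<^sub>b s) (s' \<circ>\<^sub>b f)" and ft_eq: "beq C (f \<circ>\<^sub>b t) (t' \<circ>\<^sub>b g)"
    using r unfolding retract_of_def by blast
  have ts: "\<And>m n x. x \<in> cells A m n \<Longrightarrow> t m n (s m n x) = x"
    and ts': "\<And>m n x. x \<in> cells B m n \<Longrightarrow> t' m n (s' m n x) = x"
    and gs: "\<And>m n x. x \<in> cells A m n \<Longrightarrow> g m n (s m n x) = s' m n (f m n x)"
    and ft: "\<And>m n x. x \<in> cells C m n \<Longrightarrow> f m n (t m n x) = t' m n (g m n x)"
    using ts_eq ts'_eq gs_eq ft_eq by (auto simp: beq_def bcomp_def bid_def)
  have e1: "p m n ((u \<circ>\<^sub>b t) m n c) = (v \<circ>\<^sub>b t') m n (g m n c)" if "c \<in> cells C m n" for m n c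
    using e ft[OF that] bimap_cells[OF t that] by (simp add: beq_def bcomp_def)
  from has_rlpD[OF rlp bimap_comp[OF t u] bimap_comp[OF t' v] e1]
  obtain h where h: "bimap D X h"
    and h1: "\<And>m n c. c \<in> cells C m n \<Longrightarrow> h m n (g m n c) = (u \<circ>\<^sub>b t) m n c"
    and h2: "\<And>m n d. d \<in> cells D m n \<Longrightarrow> p m n (h m n d) = (v \<circ>\<^sub>b t') m n d"
    by blast
  have "h m n (s' m n (f m n x)) = u m n x" if "x \<in> cells A m n" for m n x
    using gs[OF that] h1[OF bimap_cells[OF s that]] ts[OF that] by (simp add: bcomp_def)
  moreover have "p m n (h m n (s' m n x)) = v m n x" if "x \<in> cells B m n" for m n x
    using h2[OF bimap_cells[OF s' that]] ts'[OF that] by (simp add: bcomp_def)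
  ultimately show "\<exists>h. bimap B X h \<and> beq A (h \<circ>\<^sub>b f) u \<and> beq B (p \<circ>\<^sub>b h) v"
    using bimap_comp[OF s' h] by (auto intro!: exI[of _ "h \<circ>\<^sub>b s'"] simp: beq_def bcomp_def)
qed

lemma has_rlp_coproduct:
  assumes co: "coproduct_map I A B f C D g" and rlp: "\<And>i. i \<in> I \<Longrightarrow> has_rlp X Y p (A i) (B i) (f i)"
    and p: "bimap X Y p"
  shows "has_rlp X Y p C D g"
  unfolding has_rlp_def
proof (intro allI impI, elim conjE)
  fix u v assume u: "bimap C X u" and v: "bimap D Y v" and e: "beq C (p \<circ>\<^sub>b u) (v \<circ>\<^sub>b g)"
  obtain a b where ca: "is_coproduct I A a C" and cb: "is_coproduct I B b D"
    and ga: "\<And>i m n x. i \<in> I \<Longrightarrow> x \<in> cells (A i) m n \<Longrightarrow> g m n (a i m n x) = b i m n (f i m n x)"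
    using co unfolding coproduct_map_def beq_def bcomp_def by blast
  have a: "\<And>i. i \<in> I \<Longrightarrow> bimap (A i) C (a i)" and b: "\<And>i. i \<in> I \<Longrightarrow> bimap (B i) D (b i)"
    using ca cb by (auto simp: is_coproduct_def)
  have f: "\<And>i. i \<in> I \<Longrightarrow> bimap (A i) (B i) (f i)" using co by (simp add: coproduct_map_def)
  have "\<exists>h. bimap (B i) X h \<and> (\<forall>m n. \<forall>x \<in> cells (A i) m n. h m n (f i m n x) = u m n (a i m n x)) \<and>
      (\<forall>m n. \<forall>x \<in> cells (B i) m n. p m n (h m n x) = v m n (b i m n x))" if i: "i \<in> I" for i
  proof -
    have "p m n ((u \<circ>\<^sub>b a i) m n x) = (v \<circ>\<^sub>b b i) m n (f i m n x)" if "x \<in> cells (A i) m n" for m n x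
      using e ga[OF i that] bimap_cells[OF a[OF i] that] by (simp add: beq_def bcomp_def)
    from has_rlpD[OF rlp[OF i] bimap_comp[OF a[OF i] u] bimap_comp[OF b[OF i] v] this]
    obtain h where "bimap (B i) X h"
      "\<And>m n x. x \<in> cells (A i) m n \<Longrightarrow> h m n (f i m n x) = (u \<circ>\<^sub>b a i) m n x"
      "\<And>m n x. x \<in> cells (B i) m n \<Longrightarrow> p m n (h m n x) = (v \<circ>\<^sub>b b i) m n x"
      by blast
    then show ?thesis by (auto simp: bcomp_def)
  qed
  then obtain h where h: "\<And>i. i \<in> I \<Longrightarrow> bimap (B i) X (h i)"
    and h1: "\<And>i m n x. i \<in> I \<Longrightarrow> x \<in> cells (A i) m n \<Longrightarrow> h i m n (f i m n x) = u m n (a i m n x)"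
    and h2: "\<And>i m n x. i \<in> I \<Longrightarrow> x \<in> cells (B i) m n \<Longrightarrow> p m n (h i m n x) = v m n (b i m n x)"
    by metis
  define S where "S m n = (SIGMA i : I. cells (B i) m n)" for m n
  define bb where "bb m n = (\<lambda>(i, x). b i m n x)" for m n
  have bij: "bij_betw (bb m n) (S m n) (cells D m n)" for m n
    using cb by (simp add: is_coproduct_def S_def bb_def)
  define H where "H m n d = (\<lambda>(i, x). h i m n x) (inv_into (S m n) (bb m n) d)" for m n d
  have H: "H m n (b i m n x) = h i m n x" if "i \<in> I" "x \<in> cells (B i) m n" for i m n x
  proof -
    have "inv_into (S m n) (bb m n) (bb m n (i, x)) = (i, x)"
      by (rule inv_into_f_f) (use bij[of m n] that in \<open>auto simp: bij_betw_def S_def\<close>)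
    then show ?thesis by (simp add: H_def bb_def)
  qed
  have D: "\<exists>i \<in> I. \<exists>x \<in> cells (B i) m n. d = b i m n x" if "d \<in> cells D m n" for m n d
  proof -
    have "d \<in> bb m n ` S m n" using bij[of m n] that by (simp add: bij_betw_def)
    then show ?thesis by (auto simp: bb_def S_def)
  qed
  have Hc: "H m n d \<in> cells X m n" if "d \<in> cells D m n" for m n d
    using D[OF that] H bimap_cells[OF h] by auto
  have Ha: "H k l (act D m n \<phi> \<psi> d) = act X m n \<phi> \<psi> (H m n d)"
    if "d \<in> cells D m n" "\<phi> \<in> opmaps k m" "\<psi> \<in> opmaps l n" for m n k l \<phi> \<psi> d
  proof -
    from D[OF that(1)] obtain i x where i: "i \<in> I" and x: "x \<in> cells (B i) m n" "d = b i m n x"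
      by blast
    have "bisimplicial_set (B i)" using h[OF i] by (simp add: bimap_def)
    from act_cells[OF this x(1) that(2,3)] show ?thesis
      by (simp add: x(2) H i x(1) bimap_act[OF b[OF i] x(1) that(2,3), symmetric]
          bimap_act[OF h[OF i] x(1) that(2,3)])
  qed
  have "bimap D X H"
    using Hc Ha v u by (simp add: bimap_def)
  moreover have "H m n (g m n c) = u m n c" if c: "c \<in> cells C m n" for m n c
  proof -
    have "c \<in> (\<lambda>(i, x). a i m n x) ` (SIGMA i : I. cells (A i) m n)"
      using ca c by (auto simp: is_coproduct_def bij_betw_def)
    then obtain i x where i: "i \<in> I" and x: "x \<in> cells (A i) m n" "c = a i m n x" by auto
    then show ?thesis using ga H bimap_cells[OF f] h1 by simp
  qed
  moreover have "p m n (H m n d) = v m n d" if "d \<in> cells D m n" for m n d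
    using D[OF that] H h2 by auto
  ultimately show "\<exists>h. bimap D X h \<and> beq C (h \<circ>\<^sub>b g) u \<and> beq D (p \<circ>\<^sub>b h) v"
    by (auto simp: beq_def bcomp_def)
qed

lemma has_rlp_seq_colimit:
  fixes A :: "nat \<Rightarrow> 'a biset" and X :: "'x biset"
  assumes co: "seq_colimit A f D c" and rlp: "\<And>k. has_rlp X Y p (A k) (A (Suc k)) (f k)"
    and p: "bimap X Y p"
  shows "has_rlp X Y p (A 0) D (c 0)"
  unfolding has_rlp_def
proof (intro allI impI, elim conjE)
  fix u v assume u: "bimap (A 0) X u" and v: "bimap D Y v" and e: "beq (A 0) (p \<circ>\<^sub>b u) (v \<circ>\<^sub>b c 0)"
  have f: "bimap (A k) (A (Suc k)) (f k)" and c: "bimap (A k) D (c k)" for k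
    using co by (auto simp: seq_colimit_def)
  have cf: "c (Suc k) m n (f k m n x) = c k m n x" if "x \<in> cells (A k) m n" for k m n x
    using co that by (simp add: seq_colimit_def beq_def bcomp_def)
  have D: "\<exists>k. \<exists>x \<in> cells (A k) m n. d = c k m n x" if "d \<in> cells D m n" for m n d
    using co that by (auto simp: seq_colimit_def)
  have inj: "\<exists>r. tele f k r m n x = tele f k r m n y"
    if "x \<in> cells (A k) m n" "y \<in> cells (A k) m n" "c k m n x = c k m n y" for k m n x y
    using co that unfolding seq_colimit_def by blast
  define P where "P k h \<longleftrightarrow> bimap (A k) X h \<and>
    (\<forall>m n. \<forall>x \<in> cells (A k) m n. p m n (h m n x) = v m n (c k m n x)) \<and> (k = 0 \<longrightarrow> h = u)" for k h
  define Q where "Q k h h' \<longleftrightarrow> (\<forall>m n. \<forall>x \<in> cells (A k) m n. h' m n (f k m n x) = h m n x)"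
    for k :: nat and h h' :: "('a, 'x) bfun"
  have "\<exists>H. \<forall>k. P k (H k) \<and> Q k (H k) (H (Suc k))"
  proof (rule dependent_nat_choice)
    show "\<exists>h. P 0 h" using u e by (auto simp: P_def beq_def bcomp_def)
  next
    fix h k assume h: "P k h"
    have "p m n (h m n x) = (v \<circ>\<^sub>b c (Suc k)) m n (f k m n x)" if "x \<in> cells (A k) m n" for m n x
      using h cf[OF that] that by (simp add: P_def bcomp_def)
    from has_rlpD[OF rlp[of k] conjunct1[OF h[unfolded P_def]] bimap_comp[OF c[of "Suc k"] v] this]
    obtain h' where "bimap (A (Suc k)) X h'"
      "\<And>m n x. x \<in> cells (A k) m n \<Longrightarrow> h' m n (f k m n x) = h m n x"
      "\<And>m n x. x \<in> cells (A (Suc k)) m n \<Longrightarrow> p m n (h' m n x) = (v \<circ>\<^sub>b c (Suc k)) m n x"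
      by blast
    then show "\<exists>h'. P (Suc k) h' \<and> Q k h h'"
      unfolding P_def Q_def by (auto simp: bcomp_def)
  qed
  then obtain h where "\<forall>k. P k (h k) \<and> Q k (h k) (h (Suc k))" by blast
  then have h: "\<And>k. bimap (A k) X (h k)"
    and h1: "\<And>k m n x. x \<in> cells (A k) m n \<Longrightarrow> p m n (h k m n x) = v m n (c k m n x)"
    and h0: "h 0 = u"
    and h2: "\<And>k m n x. x \<in> cells (A k) m n \<Longrightarrow> h (Suc k) m n (f k m n x) = h k m n x"
    unfolding P_def Q_def by auto
  have tele: "tele f k r m n x \<in> cells (A (k + r)) m n \<and>
      h (k + r) m n (tele f k r m n x) = h k m n x \<and>
      c (k + r) m n (tele f k r m n x) = c k m n x"
    if "x \<in> cells (A k) m n" for k r m n x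
    using that
    by (induction r) (use bimap_cells[OF f] h2 cf in \<open>auto simp: bid_def bcomp_def\<close>)
  have wd: "h k m n x = h l m n y"
    if "x \<in> cells (A k) m n" "y \<in> cells (A l) m n" "c k m n x = c l m n y" for k l m n x y
  proof -
    have x: "tele f k l m n x \<in> cells (A (k + l)) m n" "h (k + l) m n (tele f k l m n x) = h k m n x"
      "c (k + l) m n (tele f k l m n x) = c k m n x" using tele[OF that(1), of l] by auto
    have y: "tele f l k m n y \<in> cells (A (k + l)) m n" "h (k + l) m n (tele f l k m n y) = h l m n y"
      "c (k + l) m n (tele f l k m n y) = c l m n y" using tele[OF that(2), of k] by (auto simp: add.commute)
    have "c (k + l) m n (tele f k l m n x) = c (k + l) m n (tele f l k m n y)"
      using x(3) y(3) that(3) by simp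
    from inj[OF x(1) y(1) this] obtain r
      where "tele f (k + l) r m n (tele f k l m n x) = tele f (k + l) r m n (tele f l k m n y)"
      by blast
    then show ?thesis using tele[OF x(1), of r] tele[OF y(1), of r] x(2) y(2) by simp
  qed
  define Z where "Z m n d = (SOME (k, x). x \<in> cells (A k) m n \<and> c k m n x = d)" for m n d
  define H where "H m n d = (\<lambda>(k, x). h k m n x) (Z m n d)" for m n d
  have H: "H m n (c k m n x) = h k m n x" if "x \<in> cells (A k) m n" for k m n x
  proof -
    obtain l y where z: "Z m n (c k m n x) = (l, y)" by force
    have "case Z m n (c k m n x) of (l, y) \<Rightarrow> y \<in> cells (A l) m n \<and> c l m n y = c k m n x"
      unfolding Z_def by (rule someI[of _ "(k, x)"]) (use that in simp)
    then have y: "y \<in> cells (A l) m n" "c l m n y = c k m n x" by (simp_all add: z)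
    show ?thesis using wd[OF y(1) that y(2)] by (simp add: H_def z)
  qed
  have Hc: "H m n d \<in> cells X m n" if "d \<in> cells D m n" for m n d
    using D[OF that] H bimap_cells[OF h] by auto
  have Ha: "H k l (act D m n \<phi> \<psi> d) = act X m n \<phi> \<psi> (H m n d)"
    if "d \<in> cells D m n" "\<phi> \<in> opmaps k m" "\<psi> \<in> opmaps l n" for m n k l \<phi> \<psi> d
  proof -
    from D[OF that(1)] obtain i x where x: "x \<in> cells (A i) m n" "d = c i m n x" by blast
    have "bisimplicial_set (A i)" using h[of i] by (simp add: bimap_def)
    from act_cells[OF this x(1) that(2,3)] show ?thesis
      by (simp add: x(2) H x(1) bimap_act[OF c[of i] x(1) that(2,3), symmetric]
          bimap_act[OF h[of i] x(1) that(2,3)])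
  qed
  have "bimap D X H"
    using Hc Ha v u by (simp add: bimap_def)
  moreover have "H m n (c 0 m n x) = u m n x" if "x \<in> cells (A 0) m n" for m n x
    using H[OF that] h0 by simp
  moreover have "p m n (H m n d) = v m n d" if "d \<in> cells D m n" for m n d
    using D[OF that] H h1 by auto
  ultimately show "\<exists>h. bimap D X h \<and> beq (A 0) (h \<circ>\<^sub>b c 0) u \<and> beq D (p \<circ>\<^sub>b h) v"
    by (auto simp: beq_def bcomp_def)
qed

lemma saturated_has_rlp:
  assumes p: "bimap X Y p"
  shows "saturated {(A, f, B). bimap A B f \<and> has_rlp X Y p A B f}"
  unfolding saturated_def
proof (intro conjI allI impI)
  fix A B :: "'u biset" and f assume "biso A B f"
  then show "(A, f, B) \<in> {(A, f, B). bimap A B f \<and> has_rlp X Y p A B f}"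
    using has_rlp_biso[OF _ p] by (auto simp: biso_def)
next
  fix A B C D :: "'u biset" and i u v j
  assume "(A, i, B) \<in> {(A, f, B). bimap A B f \<and> has_rlp X Y p A B f} \<and> pushout A B C D i u v j"
  then have po: "pushout A B C D i u v j" and i: "has_rlp X Y p A B i" by auto
  have "bimap C D j" using po unfolding pushout_def by blast
  then show "(C, j, D) \<in> {(A, f, B). bimap A B f \<and> has_rlp X Y p A B f}"
    using has_rlp_pushout[OF po i p] by simp
next
  fix A B C D :: "'u biset" and f g
  assume "(C, g, D) \<in> {(A, f, B). bimap A B f \<and> has_rlp X Y p A B f} \<and> retract_of A B f C D g"
  then have re: "retract_of A B f C D g" and g: "has_rlp X Y p C D g" by auto
  have "bimap A B f" using re by (simp add: retract_of_def)
  then show "(A, f, B) \<in> {(A, f, B). bimap A B f \<and> has_rlp X Y p A B f}"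
    using has_rlp_retract[OF re g p] by simp
next
  fix I :: "'u set" and A B and C D :: "'u biset" and f g
  assume "(\<forall>i \<in> I. (A i, f i, B i) \<in> {(A, f, B). bimap A B f \<and> has_rlp X Y p A B f}) \<and>
    coproduct_map I A B f C D g"
  then show "(C, g, D) \<in> {(A, f, B). bimap A B f \<and> has_rlp X Y p A B f}"
    using has_rlp_coproduct[OF _ _ p, of I A B f C D g] by (auto simp: coproduct_map_def)
next
  fix A f and D :: "'u biset" and c
  assume "(\<forall>k. (A k, f k, A (Suc k)) \<in> {(A, f, B). bimap A B f \<and> has_rlp X Y p A B f}) \<and>
    seq_colimit A f D c"
  then show "(A 0, c 0, D) \<in> {(A, f, B). bimap A B f \<and> has_rlp X Y p A B f}"
    using has_rlp_seq_colimit[OF _ _ p, of A f D c] by (auto simp: seq_colimit_def)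
qed auto

theorem fibration_rlp_anodyne:
  fixes A B :: "'u biset"
  assumes fib: "fibration X Y p" and i: "anodyne A B i"
  shows "has_rlp X Y p A B i"
proof -
  have p: "bimap X Y p" using fib by (simp add: fibration_def)
  let ?S = "{(A :: 'u biset, f, B). bimap A B f \<and> has_rlp X Y p A B f}"
  have "generators \<subseteq> ?S"
  proof
    fix e :: "'u arrow" assume "e \<in> generators"
    then obtain m n k l where mn: "1 \<le> m" "1 \<le> n" "k \<le> m" "l \<le> n"
      and iso: "iso_arrow e (horn_incl m n k l)"
      by (auto simp: generators_def)
    obtain A f B where [simp]: "e = (A, f, B)" by (cases e)
    have "has_rlp X Y p (\<Lambda> m k \<boxtimes> \<Delta> n \<union>\<^sub>b \<Delta> m \<boxtimes> \<Lambda> n l) (\<Delta> m \<boxtimes> \<Delta> n) bid"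
      using fib anodyne_horn_incl[OF mn] by (simp add: fibration_def)
    then have "has_rlp X Y p A B f"
      using has_rlp_iso_arrow[OF _ _ p] iso by (simp add: horn_incl_def)
    moreover have "bimap A B f" using iso by (simp add: iso_arrow_def horn_incl_def)
    ultimately show "e \<in> ?S" by simp
  qed
  then show ?thesis
    using i saturated_has_rlp[OF p] unfolding anodyne_def by blast
qed


section \<open>Pointed bisimplicial sets, homotopy and fiber sequences\<close>

text \<open>The degeneracy in bidegree \<open>(m, n)\<close> of a vertex; as a map, the constant map.\<close>

definition basecell :: "'a biset \<Rightarrow> 'a \<Rightarrow> nat \<Rightarrow> nat \<Rightarrow> 'a" where
  "basecell X x m n = act X 0 0 (replicate (Suc m) 0) (replicate (Suc n) 0) x"

definition bconst :: "'a biset \<Rightarrow> 'a \<Rightarrow> ('k, 'a) bfun" where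
  "bconst X x = (\<lambda>m n _. basecell X x m n)"

definition fiber :: "'x biset \<Rightarrow> ('x, 'y) bfun \<Rightarrow> 'y biset \<Rightarrow> 'y \<Rightarrow> 'x biset" where
  "fiber X p Y y = X\<lparr>cells := (\<lambda>m n. {c \<in> cells X m n. p m n c = basecell Y y m n})\<rparr>"

definition fiber_sequence ::
  "'x biset \<Rightarrow> ('x, 'x) bfun \<Rightarrow> 'x biset \<Rightarrow> 'x \<Rightarrow> ('x, 'y) bfun \<Rightarrow> 'y biset \<Rightarrow> 'y \<Rightarrow> bool" where
  "fiber_sequence F i X x p Y y \<longleftrightarrow>
     x \<in> cells X 0 0 \<and> y \<in> cells Y 0 0 \<and> p 0 0 x = y \<and>
     fibration X Y p \<and> fibrant Y \<and> F = fiber X p Y y \<and> i = bid"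

text \<open>For a map \<open>f\<close> on \<open>\<Delta> m \<boxtimes> \<Delta> n\<close>, \<open>face1 m i f\<close> is \<open>d\<^sub>i f\<close> and \<open>face2 n j f\<close> is the \<open>j\<close>-th face in
  the second direction; \<open>hface1\<close> and \<open>hface2\<close> are the corresponding operators for maps on
  \<open>K \<times> (\<Delta> m \<boxtimes> \<Delta> n)\<close>.\<close>

definition face1 :: "nat \<Rightarrow> nat \<Rightarrow> (bisimp, 'a) bfun \<Rightarrow> (bisimp, 'a) bfun" where
  "face1 m i f = (\<lambda>a b (s, t). f a b (opcomp (coface m i) s, t))"

definition face2 :: "nat \<Rightarrow> nat \<Rightarrow> (bisimp, 'a) bfun \<Rightarrow> (bisimp, 'a) bfun" where
  "face2 n j f = (\<lambda>a b (s, t). f a b (s, opcomp (coface n j) t))"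

definition hface1 :: "nat \<Rightarrow> nat \<Rightarrow> ('k \<times> bisimp, 'a) bfun \<Rightarrow> ('k \<times> bisimp, 'a) bfun" where
  "hface1 m i h = (\<lambda>a b (z, s, t). h a b (z, opcomp (coface m i) s, t))"

definition hface2 :: "nat \<Rightarrow> nat \<Rightarrow> ('k \<times> bisimp, 'a) bfun \<Rightarrow> ('k \<times> bisimp, 'a) bfun" where
  "hface2 n j h = (\<lambda>a b (z, s, t). h a b (z, s, opcomp (coface n j) t))"

definition via_proj :: "('k, 'a) bfun \<Rightarrow> ('k \<times> bisimp, 'a) bfun" where
  "via_proj f = (\<lambda>a b (z, _). f a b z)"

text \<open>\<open>h\<close> is a homotopy from \<open>\<alpha>\<close> to \<open>\<beta>\<close>; in the last condition \<open>K \<times> bsimplex 0 0\<close> is identified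
  with \<open>K\<close>.\<close>

definition homotopy ::
  "'k biset \<Rightarrow> 'a biset \<Rightarrow> ('k, 'a) bfun \<Rightarrow> ('k, 'a) bfun \<Rightarrow> ('k \<times> bisimp, 'a) bfun \<Rightarrow> bool" where
  "homotopy K X \<alpha> \<beta> h \<longleftrightarrow> bimap (K \<times>\<^sub>b bsimplex 1 1) X h \<and>
     beq (K \<times>\<^sub>b bsimplex 0 1) (hface1 1 0 h) (via_proj \<alpha>) \<and>
     beq (K \<times>\<^sub>b bsimplex 1 0) (hface2 1 0 h) (via_proj \<alpha>) \<and>
     beq (K \<times>\<^sub>b bsimplex 0 0) (hface1 1 1 (hface2 1 1 h)) (via_proj \<beta>)"

definition rel_maps :: "'k biset \<Rightarrow> 'k biset \<Rightarrow> 'a biset \<Rightarrow> 'a \<Rightarrow> ('k, 'a) bfun set" where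
  "rel_maps K L X x = {f. bimap K X f \<and> beq L f (bconst X x)}"

definition hrel ::
  "'k biset \<Rightarrow> 'k biset \<Rightarrow> 'a biset \<Rightarrow> 'a \<Rightarrow> (('k, 'a) bfun \<times> ('k, 'a) bfun) set" where
  "hrel K L X x = {(\<alpha>, \<beta>). \<alpha> \<in> rel_maps K L X x \<and> \<beta> \<in> rel_maps K L X x \<and>
     (\<exists>h. homotopy K X \<alpha> \<beta> h \<and> beq (L \<times>\<^sub>b bsimplex 1 1) h (bconst X x))}"

text \<open>For fibrant \<open>X\<close>, \<open>hrel\<close> is an equivalence relation, which also identifies families that
  represent the same map.\<close>

definition hclass ::
  "'k biset \<Rightarrow> 'k biset \<Rightarrow> 'a biset \<Rightarrow> 'a \<Rightarrow> ('k, 'a) bfun \<Rightarrow> ('k, 'a) bfun set" where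
  "hclass K L X x f = hrel K L X x `` {f}"

definition hclasses :: "'k biset \<Rightarrow> 'k biset \<Rightarrow> 'a biset \<Rightarrow> 'a \<Rightarrow> ('k, 'a) bfun set set" where
  "hclasses K L X x = rel_maps K L X x // hrel K L X x"

abbreviation piBC :: "nat \<Rightarrow> nat \<Rightarrow> 'a biset \<Rightarrow> 'a \<Rightarrow> (bisimp, 'a) bfun set set" where
  "piBC m n \<equiv> hclasses (bsimplex m n) (bbdry m n)"

abbreviation piA :: "nat \<Rightarrow> nat \<Rightarrow> 'a biset \<Rightarrow> 'a \<Rightarrow> (bisimp, 'a) bfun set set" where
  "piA m n \<equiv> hclasses (bsimplex m n) (bbdryA m n)"

abbreviation ptBC :: "nat \<Rightarrow> nat \<Rightarrow> 'a biset \<Rightarrow> 'a \<Rightarrow> (bisimp, 'a) bfun set" where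
  "ptBC m n X x \<equiv> hclass (bsimplex m n) (bbdry m n) X x (bconst X x)"

abbreviation ptA :: "nat \<Rightarrow> nat \<Rightarrow> 'a biset \<Rightarrow> 'a \<Rightarrow> (bisimp, 'a) bfun set" where
  "ptA m n X x \<equiv> hclass (bsimplex m n) (bbdryA m n) X x (bconst X x)"

text \<open>The functions on classes below are unions over all choices of representatives (and of lifts).
  They are well defined exactly when this union is again a single class, that is, when they take
  values in the respective set \<open>hclasses\<close>; this is part of \<open>pointed_map\<close>.\<close>

definition induced ::
  "'k biset \<Rightarrow> 'k biset \<Rightarrow> 'b biset \<Rightarrow> 'b \<Rightarrow> ('a, 'b) bfun \<Rightarrow> ('k, 'a) bfun set \<Rightarrow> ('k, 'b) bfun set" where
  "induced K L Y y p c = (\<Union>\<alpha> \<in> c. hclass K L Y y (p \<circ>\<^sub>b \<alpha>))"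

abbreviation inducedBC ::
  "nat \<Rightarrow> nat \<Rightarrow> 'b biset \<Rightarrow> 'b \<Rightarrow> ('a, 'b) bfun \<Rightarrow> (bisimp, 'a) bfun set \<Rightarrow> (bisimp, 'b) bfun set" where
  "inducedBC m n \<equiv> induced (bsimplex m n) (bbdry m n)"

abbreviation inducedA ::
  "nat \<Rightarrow> nat \<Rightarrow> 'b biset \<Rightarrow> 'b \<Rightarrow> ('a, 'b) bfun \<Rightarrow> (bisimp, 'a) bfun set \<Rightarrow> (bisimp, 'b) bfun set" where
  "inducedA m n \<equiv> induced (bsimplex m n) (bbdryA m n)"

definition horn_lifts ::
  "nat \<Rightarrow> nat \<Rightarrow> 'x biset \<Rightarrow> 'x \<Rightarrow> ('x, 'y) bfun \<Rightarrow> (bisimp, 'y) bfun \<Rightarrow> (bisimp, 'x) bfun set" where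
  "horn_lifts m n X x p \<alpha> = {\<gamma>. bimap (bsimplex m n) X \<gamma> \<and> beq (bsimplex m n) (p \<circ>\<^sub>b \<gamma>) \<alpha> \<and>
     beq (bhorn m n) \<gamma> (bconst X x)}"

definition connecting ::
  "nat \<Rightarrow> nat \<Rightarrow> 'x biset \<Rightarrow> 'x biset \<Rightarrow> 'x \<Rightarrow> ('x, 'y) bfun \<Rightarrow>
   (bisimp, 'y) bfun set \<Rightarrow> (bisimp, 'x) bfun set" where
  "connecting m n F X x p c =
     (\<Union>\<alpha> \<in> c. \<Union>\<gamma> \<in> horn_lifts (Suc m) (Suc n) X x p \<alpha>.
        hclass (bsimplex m n) (bbdry m n) F x
          (face1 (Suc m) (Suc m) (face2 (Suc n) (Suc n) \<gamma>)))"

definition pointed_map :: "'a set \<Rightarrow> 'a \<Rightarrow> 'b set \<Rightarrow> 'b \<Rightarrow> ('a \<Rightarrow> 'b) \<Rightarrow> bool" where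
  "pointed_map A a B b f \<longleftrightarrow> a \<in> A \<and> b \<in> B \<and> f \<in> A \<rightarrow> B \<and> f a = b"

definition exact_at :: "'a set \<Rightarrow> ('a \<Rightarrow> 'b) \<Rightarrow> 'b set \<Rightarrow> ('b \<Rightarrow> 'c) \<Rightarrow> 'c \<Rightarrow> bool" where
  "exact_at A f B g c \<longleftrightarrow> {b \<in> B. g b = c} = f ` A"

end

theory Submission
  imports Defs
begin

text \<open>The proof is the classical one for Kan fibrations, with the interval replaced by
  \<open>\<Delta>\<^bsup>1,1\<^esup>\<close> and the end where homotopies start by \<open>\<Lambda>\<^bsup>1,1\<^esup>\<close>, the union of the two edges through
  the vertex \<open>(1, 1)\<close>; a homotopy starts on \<open>\<Lambda>\<^bsup>1,1\<^esup>\<close> and ends at the vertex \<open>(0, 0)\<close>.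

  Everything rests on the homotopy lifting extension property of a fibration \<open>p : X \<rightarrow> Y\<close>
  (\<open>homotopy_lifting\<close>): if \<open>K\<close> is a bisimplex, or a product of two, and \<open>L\<close> is a subcomplex,
  a homotopy \<open>K \<times> \<Delta>\<^bsup>1,1\<^esup> \<rightarrow> Y\<close> lifts to \<open>X\<close> with prescribed start \<open>K \<rightarrow> X\<close> and prescribed values on \<open>L \<times> \<Delta>\<^bsup>1,1\<^esup>\<close>. Attaching the
  nondegenerate cells of \<open>K\<close> one by one reduces this to the inclusion of \<open>L = \<delta>\<Delta>\<^bsup>a,b\<^esup>\<close> in
  \<open>K = \<Delta>\<^bsup>a,b\<^esup>\<close>. In that case the subcomplex to be extended from is
  \<open>P\<^sub>a \<boxtimes> (\<Delta>\<^sup>b \<times> \<Delta>\<^sup>1) \<union> (\<Delta>\<^sup>a \<times> \<Delta>\<^sup>1) \<boxtimes> P\<^sub>b\<close> with \<open>P\<^sub>a = \<partial>\<Delta>\<^sup>a \<times> \<Delta>\<^sup>1 \<union> \<Delta>\<^sup>a \<times> {1}\<close>. As \<open>\<Delta>\<^sup>a \<times> \<Delta>\<^sup>1\<close> arises from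
  \<open>P\<^sub>a\<close> by filling \<open>a + 1\<close> horns, lifting against \<open>\<Lambda> \<boxtimes> \<Delta> \<union> \<Delta> \<boxtimes> \<Lambda>\<close>, once in each variable, is
  enough (\<open>has_rlp_prism_prism\<close>).

  Applying the property with \<open>K \<times> \<Delta>\<^bsup>1,1\<^esup>\<close> in the place of \<open>K\<close> shows that two homotopies with the
  same start and the same image in \<open>Y\<close> have homotopic ends (\<open>homotopy_compare\<close>). Over the point this
  says that homotopy is an equivalence relation. It also makes the connecting map well defined: for
  \<open>m, n \<ge> 1\<close>, the contraction of \<open>\<Delta>\<^bsup>m,n\<^esup>\<close> to its last vertex starts in \<open>\<Lambda>\<^bsup>m,n\<^esup>\<close> and preserves
  \<open>\<Lambda>\<^bsup>m,n\<^esup>\<close>, since the faces forming it contain that vertex; so it turns every lift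
  \<open>\<gamma>\<close> of \<open>\<alpha>\<close> with \<open>\<gamma> = *\<close> on \<open>\<Lambda>\<^bsup>m,n\<^esup>\<close> into a homotopy from \<open>*\<close> to \<open>\<gamma>\<close>, and for two lifts of \<open>\<alpha>\<close> these homotopies have the same image
  (\<open>lifts_unique\<close>).

  Exactness at the homotopy sets of \<open>X\<close> is homotopy lifting relative to the boundary
  (\<open>exact_at_total\<close>). At the other two places, a homotopy on the last face \<open>\<Delta>\<^bsup>m,n\<^esup>\<close> of
  \<open>\<Delta>\<^bsup>m+1,n+1\<^esup>\<close>, constant \<open>*\<close> on the horn, is extended to the whole of \<open>\<Delta>\<^bsup>m+1,n+1\<^esup>\<close>
  (\<open>extend_face_homotopy\<close>); and the contraction, restricted to the last face of a lift, shows that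
  this face is null homotopic in \<open>X\<close>.\<close>

section \<open>Subcomplexes and lifting against inclusions\<close>

text \<open>Subcomplexes carry the operators of the ambient bisimplicial set, so that inclusions are \<open>bid\<close>
  and union is \<open>\<union>\<^sub>b\<close>.\<close>

definition subcomplex :: "'a biset \<Rightarrow> 'a biset \<Rightarrow> bool" where
  "subcomplex L K \<longleftrightarrow> bisimplicial_set L \<and> bisimplicial_set K \<and> act L = act K \<and>
     (\<forall>m n. cells L m n \<subseteq> cells K m n)"

lemma subcomplexD:
  assumes "subcomplex L K"
  shows "bisimplicial_set L" "bisimplicial_set K" "act L = act K"
    "z \<in> cells L m n \<Longrightarrow> z \<in> cells K m n"
  using assms by (auto simp: subcomplex_def)

lemma subcomplexI:
  assumes "bisimplicial_set K" "act L = act K" "\<And>m n z. z \<in> cells L m n \<Longrightarrow> z \<in> cells K m n"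
    and "\<And>m n k l f g z. z \<in> cells L m n \<Longrightarrow> f \<in> opmaps k m \<Longrightarrow> g \<in> opmaps l n \<Longrightarrow>
      act K m n f g z \<in> cells L k l"
  shows "subcomplex L K"
proof -
  have "bisimplicial_set L"
    unfolding bisimplicial_set_def assms(2)
    using assms(1,3,4) unfolding bisimplicial_set_def by auto
  then show ?thesis using assms(1-3) by (auto simp: subcomplex_def)
qed

lemma subcomplex_refl: "bisimplicial_set K \<Longrightarrow> subcomplex K K"
  by (simp add: subcomplex_def)

lemma cells_bcup [simp]: "cells (K \<union>\<^sub>b L) m n = cells K m n \<union> cells L m n"
  by (simp add: bcup_def)

lemma act_bcup [simp]: "act (K \<union>\<^sub>b L) = act K"
  by (simp add: bcup_def)

lemma cells_bprod [simp]: "cells (K \<times>\<^sub>b L) m n = cells K m n \<times> cells L m n"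
  by (simp add: bprod_def)

lemma act_bprod [simp]:
  "act (K \<times>\<^sub>b L) m n f g z = (act K m n f g (fst z), act L m n f g (snd z))"
  by (simp add: bprod_def case_prod_beta)

lemma cells_box [simp]: "cells (A \<boxtimes> B) m n = scells A m \<times> scells B n"
  by (simp add: box_def)

lemma act_box [simp]: "act (A \<boxtimes> B) m n f g z = (sact A m f (fst z), sact B n g (snd z))"
  by (simp add: box_def case_prod_beta)

lemma act_bprod_cong:
  assumes "act A = act A'" "act B = act B'"
  shows "act (A \<times>\<^sub>b B) = act (A' \<times>\<^sub>b B')"
  using assms by (simp add: bprod_def)

lemma subcomplex_bcup:
  assumes "subcomplex A K" "subcomplex B K"
  shows "subcomplex (A \<union>\<^sub>b B) K"
  using assms bisimplicial_set_bcup[of A B] by (auto simp: subcomplex_def)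

lemma bisimplicial_set_bprod:
  assumes "bisimplicial_set K" "bisimplicial_set L"
  shows "bisimplicial_set (K \<times>\<^sub>b L)"
  using assms unfolding bisimplicial_set_def bprod_def by auto

lemma subcomplex_bprod:
  assumes "subcomplex A K" "subcomplex B L"
  shows "subcomplex (A \<times>\<^sub>b B) (K \<times>\<^sub>b L)"
  using assms bisimplicial_set_bprod act_bprod_cong[of A K B L]
  by (auto simp: subcomplex_def) blast+

lemma bimap_subcomplex: "bimap K X f \<Longrightarrow> subcomplex L K \<Longrightarrow> bimap L X f"
  by (simp add: bimap_def subcomplex_def subset_iff)

lemma bimap_bcup:
  assumes "bimap A X f" "bimap B X f" "act A = act B"
  shows "bimap (A \<union>\<^sub>b B) X f"
  using assms bisimplicial_set_bcup[of A B] by (auto simp: bimap_def)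

lemma bimap_cong:
  assumes "bimap A X f" and "\<And>m n z. z \<in> cells A m n \<Longrightarrow> g m n z = f m n z"
  shows "bimap A X g"
  using assms by (auto simp: bimap_def act_cells)

lemma bimapI:
  assumes "bisimplicial_set A" "bisimplicial_set B"
    and "\<And>m n z. z \<in> cells A m n \<Longrightarrow> f m n z \<in> cells B m n"
    and "\<And>m n k l g h z. z \<in> cells A m n \<Longrightarrow> g \<in> opmaps k m \<Longrightarrow> h \<in> opmaps l n \<Longrightarrow>
      f k l (act A m n g h z) = act B m n g h (f m n z)"
  shows "bimap A B f"
  using assms by (simp add: bimap_def)

lemma has_rlp_inclI:
  assumes "\<And>u v. bimap A X u \<Longrightarrow> bimap B Y v \<Longrightarrow>
      (\<And>m n z. z \<in> cells A m n \<Longrightarrow> p m n (u m n z) = v m n z) \<Longrightarrow>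
      \<exists>h. bimap B X h \<and> (\<forall>m n. \<forall>z \<in> cells A m n. h m n z = u m n z) \<and>
        (\<forall>m n. \<forall>z \<in> cells B m n. p m n (h m n z) = v m n z)"
  shows "has_rlp X Y p A B bid"
  using assms unfolding has_rlp_def beq_def bcomp_def bid_def by simp

lemma has_rlp_inclE:
  assumes "has_rlp X Y p A B bid" "bimap A X u" "bimap B Y v"
    and "\<And>m n z. z \<in> cells A m n \<Longrightarrow> p m n (u m n z) = v m n z"
  obtains h where "bimap B X h" "\<And>m n z. z \<in> cells A m n \<Longrightarrow> h m n z = u m n z"
    "\<And>m n z. z \<in> cells B m n \<Longrightarrow> p m n (h m n z) = v m n z"
  using has_rlpD[OF assms(1-3)] assms(4) unfolding bid_def by metis

lemma has_rlp_inclD: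
  assumes "has_rlp X Y p A B bid" "bimap A X u" "bimap B Y v"
    and "\<forall>m n. \<forall>z \<in> cells A m n. p m n (u m n z) = v m n z"
  shows "\<exists>h. bimap B X h \<and> (\<forall>m n. \<forall>z \<in> cells A m n. h m n z = u m n z) \<and>
    (\<forall>m n. \<forall>z \<in> cells B m n. p m n (h m n z) = v m n z)"
  using assms unfolding has_rlp_def beq_def bcomp_def bid_def by simp

lemma has_rlp_incl_trans:
  assumes AB: "has_rlp X Y p A B bid" and BC: "has_rlp X Y p B C bid"
    and s: "subcomplex A B" "subcomplex B C"
  shows "has_rlp X Y p A C bid"
proof (rule has_rlp_inclI)
  fix u v assume u: "bimap A X u" and v: "bimap C Y v"
    and e: "\<And>m n z. z \<in> cells A m n \<Longrightarrow> p m n (u m n z) = v m n z"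
  from has_rlp_inclE[OF AB u bimap_subcomplex[OF v s(2)] e] obtain h where
    h: "bimap B X h" "\<And>m n z. z \<in> cells A m n \<Longrightarrow> h m n z = u m n z"
    "\<And>m n z. z \<in> cells B m n \<Longrightarrow> p m n (h m n z) = v m n z" by blast
  from has_rlp_inclE[OF BC h(1) v h(3)] obtain k where
    k: "bimap C X k" "\<And>m n z. z \<in> cells B m n \<Longrightarrow> k m n z = h m n z"
    "\<And>m n z. z \<in> cells C m n \<Longrightarrow> p m n (k m n z) = v m n z" by blast
  then show "\<exists>h. bimap C X h \<and> (\<forall>m n. \<forall>z \<in> cells A m n. h m n z = u m n z) \<and>
        (\<forall>m n. \<forall>z \<in> cells C m n. p m n (h m n z) = v m n z)"
    using h(2) subcomplexD(4)[OF s(1)] by (intro exI[of _ k]) auto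
qed

lemma has_rlp_same_cells:
  assumes "\<And>m n. cells A m n = cells B m n" "act A = act B"
  shows "has_rlp X Y p A B bid"
proof (rule has_rlp_inclI)
  fix u v assume u: "bimap A X u" and v: "bimap B Y v"
    and e: "\<And>m n z. z \<in> cells A m n \<Longrightarrow> p m n (u m n z) = v m n z"
  have "bimap B X u" using u v assms by (simp add: bimap_def)
  then show "\<exists>h. bimap B X h \<and> (\<forall>m n. \<forall>z \<in> cells A m n. h m n z = u m n z) \<and>
        (\<forall>m n. \<forall>z \<in> cells B m n. p m n (h m n z) = v m n z)"
    using e assms(1) by auto
qed

text \<open>The square formed by \<open>A \<subseteq> B\<close>, \<open>C \<subseteq> D\<close> and \<open>q\<close> is a pushout: \<open>q\<close> maps the complement of \<open>A\<close>
  bijectively to the complement of \<open>C\<close>.\<close>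

lemma has_rlp_attach:
  assumes sD: "subcomplex C D" and sB: "subcomplex A B" and q: "bimap B D q"
    and qA: "\<And>m n z. z \<in> cells B m n \<Longrightarrow> q m n z \<in> cells C m n \<longleftrightarrow> z \<in> cells A m n"
    and inj: "\<And>m n z z'. z \<in> cells B m n \<Longrightarrow> z' \<in> cells B m n \<Longrightarrow> z \<notin> cells A m n \<Longrightarrow>
      z' \<notin> cells A m n \<Longrightarrow> q m n z = q m n z' \<Longrightarrow> z = z'"
    and cov: "\<And>m n d. d \<in> cells D m n \<Longrightarrow> d \<in> cells C m n \<or> d \<in> q m n ` cells B m n"
    and rlp: "has_rlp X Y p A B bid"
  shows "has_rlp X Y p C D bid"
proof (rule has_rlp_inclI)
  fix u v assume u: "bimap C X u" and v: "bimap D Y v"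
    and e: "\<And>m n z. z \<in> cells C m n \<Longrightarrow> p m n (u m n z) = v m n z"
  have qAC: "bimap A C q"
    using bimap_subcomplex[OF q sB] sD qA subcomplexD(4)[OF sB]
    by (auto simp: bimap_def subcomplex_def)
  have "p m n ((u \<circ>\<^sub>b q) m n z) = (v \<circ>\<^sub>b q) m n z" if "z \<in> cells A m n" for m n z
    using e[OF bimap_cells[OF qAC that]] by (simp add: bcomp_def)
  from has_rlp_inclE[OF rlp bimap_comp[OF qAC u] bimap_comp[OF q v] this] obtain h where
    h: "bimap B X h" "\<And>m n z. z \<in> cells A m n \<Longrightarrow> h m n z = u m n (q m n z)"
    "\<And>m n z. z \<in> cells B m n \<Longrightarrow> p m n (h m n z) = v m n (q m n z)"
    unfolding bcomp_def by blast
  define H where "H m n d = (if d \<in> cells C m n then u m n d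
    else h m n (SOME z. z \<in> cells B m n \<and> q m n z = d))" for m n d
  have HC: "H m n d = u m n d" if "d \<in> cells C m n" for m n d using that by (simp add: H_def)
  have Hq: "H m n (q m n z) = h m n z" if z: "z \<in> cells B m n" for m n z
  proof (cases "z \<in> cells A m n")
    case True
    then show ?thesis using HC bimap_cells[OF qAC True] h(2) by simp
  next
    case False
    let ?z = "SOME t. t \<in> cells B m n \<and> q m n t = q m n z"
    have t: "?z \<in> cells B m n \<and> q m n ?z = q m n z" by (rule someI[of _ z]) (use z in simp)
    then have "?z \<notin> cells A m n" using qA z False by metis
    then have "?z = z" using inj t z False by blast
    then show ?thesis using qA[OF z] False by (simp add: H_def)
  qed
  have "bimap D X H"
  proof (rule bimapI)
    show "bisimplicial_set D" "bisimplicial_set X" using q u by (auto simp: bimap_def)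
  next
    fix m n d assume "d \<in> cells D m n"
    then show "H m n d \<in> cells X m n"
      using cov[of d m n] HC Hq bimap_cells[OF u] bimap_cells[OF h(1)] by auto
  next
    fix m n k l f g d assume d: "d \<in> cells D m n" and fg: "f \<in> opmaps k m" "g \<in> opmaps l n"
    show "H k l (act D m n f g d) = act X m n f g (H m n d)"
      using cov[OF d]
    proof
      assume c: "d \<in> cells C m n"
      have "act D m n f g d \<in> cells C k l"
        using act_cells[OF _ c fg] sD by (simp add: subcomplex_def)
      then show ?thesis using HC c bimap_act[OF u c fg] sD by (simp add: subcomplex_def)
    next
      assume "d \<in> q m n ` cells B m n"
      then obtain z where z: "z \<in> cells B m n" "d = q m n z" by blast
      have "act B m n f g z \<in> cells B k l"
        using act_cells[OF _ z(1) fg] sB by (simp add: subcomplex_def)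
      then show ?thesis
        using Hq z bimap_act[OF q z(1) fg] bimap_act[OF h(1) z(1) fg] by metis
    qed
  qed
  moreover have "p m n (H m n d) = v m n d" if "d \<in> cells D m n" for m n d
    using cov[OF that] HC Hq e h(3) by auto
  ultimately show "\<exists>h. bimap D X h \<and> (\<forall>m n. \<forall>z \<in> cells C m n. h m n z = u m n z) \<and>
        (\<forall>m n. \<forall>z \<in> cells D m n. p m n (h m n z) = v m n z)"
    using HC by auto
qed

section \<open>Pushout products of simplicial inclusions\<close>

text \<open>Simplicial subsets.\<close>

definition ssub :: "'a sset \<Rightarrow> 'a sset \<Rightarrow> bool" where
  "ssub A B \<longleftrightarrow> simplicial_set A \<and> simplicial_set B \<and> sact A = sact B \<and>
     (\<forall>k. scells A k \<subseteq> scells B k)"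

text \<open>The domain of the pushout product, with respect to \<open>\<boxtimes>\<close>, of the inclusions \<open>A \<subseteq> B\<close> and
  \<open>C \<subseteq> D\<close>; its codomain is \<open>B \<boxtimes> D\<close>.\<close>

definition boxbdry :: "'a sset \<Rightarrow> 'a sset \<Rightarrow> 'b sset \<Rightarrow> 'b sset \<Rightarrow> ('a \<times> 'b) biset" where
  "boxbdry A B C D = A \<boxtimes> D \<union>\<^sub>b B \<boxtimes> C"

lemma subcomplex_box:
  assumes "ssub A B" "ssub C D"
  shows "subcomplex (A \<boxtimes> C) (B \<boxtimes> D)"
proof -
  have "act (A \<boxtimes> C) = act (B \<boxtimes> D)" using assms by (simp add: box_def ssub_def)
  then show ?thesis using assms bisimplicial_set_box by (auto simp: subcomplex_def ssub_def)
qed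

lemma ssub_refl: "simplicial_set A \<Longrightarrow> ssub A A"
  by (simp add: ssub_def)

lemma subcomplex_boxbdry:
  assumes "ssub A B" "ssub C D"
  shows "subcomplex (boxbdry A B C D) (B \<boxtimes> D)"
  unfolding boxbdry_def using assms
  by (intro subcomplex_bcup subcomplex_box) (auto simp: ssub_def)

text \<open>\<open>D\<close> is obtained from \<open>C\<close> by attaching the relative cell \<open>A \<subseteq> B\<close> along \<open>q\<close>, in the sense of
  \<open>has_rlp_attach\<close>.\<close>

definition sattach ::
  "'b sset \<Rightarrow> 'b sset \<Rightarrow> 'a sset \<Rightarrow> 'a sset \<Rightarrow> (nat \<Rightarrow> 'a \<Rightarrow> 'b) \<Rightarrow> bool" where
  "sattach C D A B q \<longleftrightarrow> ssub C D \<and> ssub A B \<and>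
     (\<forall>k z. z \<in> scells B k \<longrightarrow> q k z \<in> scells D k) \<and>
     (\<forall>k l f z. z \<in> scells B k \<longrightarrow> f \<in> opmaps l k \<longrightarrow> q l (sact B k f z) = sact D k f (q k z)) \<and>
     (\<forall>k z. z \<in> scells B k \<longrightarrow> q k z \<in> scells C k \<longleftrightarrow> z \<in> scells A k) \<and>
     (\<forall>k z z'. z \<in> scells B k \<longrightarrow> z' \<in> scells B k \<longrightarrow> z \<notin> scells A k \<longrightarrow> z' \<notin> scells A k \<longrightarrow>
        q k z = q k z' \<longrightarrow> z = z') \<and>
     (\<forall>k d. d \<in> scells D k \<longrightarrow> d \<in> scells C k \<or> d \<in> q k ` scells B k)"

lemma has_rlp_sattach1:
  assumes at: "sattach C D A B q" and E: "ssub E G"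
    and rlp: "has_rlp X Y p (boxbdry A B E G) (B \<boxtimes> G) bid"
  shows "has_rlp X Y p (boxbdry C D E G) (D \<boxtimes> G) bid"
proof (rule has_rlp_attach[where q = "\<lambda>m n (z, w). (q m z, w)", OF _ _ _ _ _ _ rlp])
  have s: "ssub C D" "ssub A B" using at by (auto simp: sattach_def)
  show "subcomplex (boxbdry C D E G) (D \<boxtimes> G)" "subcomplex (boxbdry A B E G) (B \<boxtimes> G)"
    using s E by (auto intro: subcomplex_boxbdry)
  show "bimap (B \<boxtimes> G) (D \<boxtimes> G) (\<lambda>m n (z, w). (q m z, w))"
    by (rule bimapI) (use at s E in \<open>auto simp: sattach_def ssub_def bisimplicial_set_box\<close>)
  show "d \<in> cells (boxbdry C D E G) m n \<or> d \<in> (\<lambda>(z, w). (q m z, w)) ` cells (B \<boxtimes> G) m n"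
    if "d \<in> cells (D \<boxtimes> G) m n" for m n d
  proof (cases d)
    case (Pair a b)
    then have "a \<in> scells C m \<or> a \<in> q m ` scells B m" "b \<in> scells G n"
      using that at by (auto simp: sattach_def)
    then show ?thesis using Pair by (auto simp: boxbdry_def image_iff)
  qed
qed (use at E in \<open>auto simp: sattach_def boxbdry_def ssub_def\<close>)

lemma has_rlp_sattach2:
  assumes at: "sattach C D A B q" and E: "ssub E G"
    and rlp: "has_rlp X Y p (boxbdry E G A B) (G \<boxtimes> B) bid"
  shows "has_rlp X Y p (boxbdry E G C D) (G \<boxtimes> D) bid"
proof (rule has_rlp_attach[where q = "\<lambda>m n (w, z). (w, q n z)", OF _ _ _ _ _ _ rlp])
  have s: "ssub C D" "ssub A B" using at by (auto simp: sattach_def)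
  show "subcomplex (boxbdry E G C D) (G \<boxtimes> D)" "subcomplex (boxbdry E G A B) (G \<boxtimes> B)"
    using s E by (auto intro: subcomplex_boxbdry)
  show "bimap (G \<boxtimes> B) (G \<boxtimes> D) (\<lambda>m n (w, z). (w, q n z))"
    by (rule bimapI) (use at s E in \<open>auto simp: sattach_def ssub_def bisimplicial_set_box\<close>)
  show "z = z'"
    if "z \<in> cells (G \<boxtimes> B) m n" "z' \<in> cells (G \<boxtimes> B) m n" "z \<notin> cells (boxbdry E G A B) m n"
      "z' \<notin> cells (boxbdry E G A B) m n"
      "(case z of (w, z) \<Rightarrow> (w, q n z)) = (case z' of (w, z) \<Rightarrow> (w, q n z))" for m n z z'
  proof -
    have "snd z \<in> scells B n" "snd z' \<in> scells B n" "snd z \<notin> scells A n" "snd z' \<notin> scells A n"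
      "q n (snd z) = q n (snd z')" "fst z = fst z'"
      using that by (auto simp: boxbdry_def)
    then show ?thesis using at unfolding sattach_def by (metis prod_eqI)
  qed
  show "d \<in> cells (boxbdry E G C D) m n \<or> d \<in> (\<lambda>(w, z). (w, q n z)) ` cells (G \<boxtimes> B) m n"
    if "d \<in> cells (G \<boxtimes> D) m n" for m n d
  proof (cases d)
    case (Pair b a)
    then have "a \<in> scells C n \<or> a \<in> q n ` scells B n" "b \<in> scells G m"
      using that at by (auto simp: sattach_def)
    then show ?thesis using Pair by (auto simp: boxbdry_def image_iff)
  qed
qed (use at E in \<open>auto simp: sattach_def boxbdry_def ssub_def\<close>)

lemma has_rlp_boxbdry_trans1:
  assumes s: "ssub A B" "ssub B C" "ssub E G"
    and AB: "has_rlp X Y p (boxbdry A B E G) (B \<boxtimes> G) bid"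
    and BC: "has_rlp X Y p (boxbdry B C E G) (C \<boxtimes> G) bid"
  shows "has_rlp X Y p (boxbdry A C E G) (C \<boxtimes> G) bid"
proof (rule has_rlp_incl_trans[OF _ BC])
  have AC: "ssub A C" using s unfolding ssub_def by (metis subset_trans)
  have sub: "subcomplex (boxbdry B C E G) (C \<boxtimes> G)" "subcomplex (boxbdry A C E G) (C \<boxtimes> G)"
    "subcomplex (boxbdry A B E G) (B \<boxtimes> G)" "subcomplex (B \<boxtimes> G) (C \<boxtimes> G)"
    using s AC by (auto intro: subcomplex_boxbdry subcomplex_box ssub_refl simp: ssub_def)
  have cl: "scells A k \<subseteq> scells B k" "scells B k \<subseteq> scells C k" "scells E k \<subseteq> scells G k" for k
    using s by (auto simp: ssub_def)
  show *: "subcomplex (boxbdry A C E G) (boxbdry B C E G)"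
    using sub(1,2) cl by (auto simp: subcomplex_def boxbdry_def)
  show "has_rlp X Y p (boxbdry A C E G) (boxbdry B C E G) bid"
  proof (rule has_rlp_attach[where q = bid, OF * sub(3) _ _ _ _ AB])
    show "bimap (B \<boxtimes> G) (boxbdry B C E G) bid"
      using sub by (auto intro!: bimapI simp: subcomplex_def boxbdry_def bid_def act_cells)
  qed (use cl in \<open>auto simp: bid_def boxbdry_def\<close>)
qed (rule subcomplex_boxbdry[OF s(2,3)])

lemma has_rlp_boxbdry_trans2:
  assumes s: "ssub A B" "ssub B C" "ssub E G"
    and AB: "has_rlp X Y p (boxbdry E G A B) (G \<boxtimes> B) bid"
    and BC: "has_rlp X Y p (boxbdry E G B C) (G \<boxtimes> C) bid"
  shows "has_rlp X Y p (boxbdry E G A C) (G \<boxtimes> C) bid"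
proof (rule has_rlp_incl_trans[OF _ BC])
  have AC: "ssub A C" using s unfolding ssub_def by (metis subset_trans)
  have sub: "subcomplex (boxbdry E G B C) (G \<boxtimes> C)" "subcomplex (boxbdry E G A C) (G \<boxtimes> C)"
    "subcomplex (boxbdry E G A B) (G \<boxtimes> B)" "subcomplex (G \<boxtimes> B) (G \<boxtimes> C)"
    using s AC by (auto intro: subcomplex_boxbdry subcomplex_box ssub_refl simp: ssub_def)
  have cl: "scells A k \<subseteq> scells B k" "scells B k \<subseteq> scells C k" "scells E k \<subseteq> scells G k" for k
    using s by (auto simp: ssub_def)
  show *: "subcomplex (boxbdry E G A C) (boxbdry E G B C)"
    using sub(1,2) cl by (auto simp: subcomplex_def boxbdry_def)
  show "has_rlp X Y p (boxbdry E G A C) (boxbdry E G B C) bid"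
  proof (rule has_rlp_attach[where q = bid, OF * sub(3) _ _ _ _ AB])
    show "bimap (G \<boxtimes> B) (boxbdry E G B C) bid"
      using sub by (auto intro!: bimapI simp: subcomplex_def boxbdry_def bid_def act_cells)
  qed (use cl in \<open>auto simp: bid_def boxbdry_def\<close>)
qed (rule subcomplex_boxbdry[OF s(3,2)])

section \<open>Cells of the standard bisimplicial sets\<close>

lemma scells_simplex [simp]: "scells (\<Delta> m) k = opmaps k m"
  and sact_simplex [simp]: "sact (\<Delta> m) k f x = opcomp x f"
  by (simp_all add: simplex_def)

lemma scells_horn_iff [simp]: "x \<in> scells (\<Lambda> m j) k \<longleftrightarrow> x \<in> opmaps k m \<and> (\<exists>i\<le>m. i \<noteq> j \<and> i \<notin> set x)"
  by (auto simp: horn_def face_def)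

lemma scells_bdry_iff [simp]: "x \<in> scells (\<partial>\<Delta> m) k \<longleftrightarrow> x \<in> opmaps k m \<and> (\<exists>i\<le>m. i \<notin> set x)"
  by (auto simp: bdry_def face_def)

lemma sact_horn [simp]: "sact (\<Lambda> m j) = sact (\<Delta> m)" and sact_bdry [simp]: "sact (\<partial>\<Delta> m) = sact (\<Delta> m)"
  by (simp_all add: horn_def bdry_def)

lemma simplicial_set_bdry: "simplicial_set (\<partial>\<Delta> m)"
  unfolding bdry_def
proof (rule simplicial_set_subsimplex)
  fix j l x f assume x: "x \<in> (\<Union>i \<in> {..m}. scells (face m i) j)" and f: "f \<in> opmaps l j"
  then obtain i where "i \<in> {..m}" "x \<in> opmaps j m" "i \<notin> set x"
    by (auto simp: face_def)
  then show "opcomp x f \<in> (\<Union>i \<in> {..m}. scells (face m i) l)"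
    using opcomp_opmaps[OF _ f] set_opcomp[OF _ f] by (fastforce simp: face_def)
qed (auto simp: face_def)

lemma ssub_horn: "ssub (\<Lambda> m j) (\<Delta> m)" and ssub_bdry: "ssub (\<partial>\<Delta> m) (\<Delta> m)"
  by (auto simp: ssub_def simplicial_set_horn simplicial_set_bdry simplicial_set_simplex)

lemma cells_bsimplex [simp]: "cells (bsimplex m n) a b = opmaps a m \<times> opmaps b n"
  by (simp add: bsimplex_def)

lemma act_bsimplex [simp]: "act (bsimplex m n) a b f g z = (opcomp (fst z) f, opcomp (snd z) g)"
  by (simp add: bsimplex_def)

lemma cells_bbdry_iff [simp]:
  "z \<in> cells (bbdry m n) a b \<longleftrightarrow> z \<in> cells (bsimplex m n) a b \<and>
     ((\<exists>i\<le>m. i \<notin> set (fst z)) \<or> (\<exists>j\<le>n. j \<notin> set (snd z)))"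
  by (cases z) (auto simp: bbdry_def)

lemma cells_bhorn_iff [simp]:
  "z \<in> cells (bhorn m n) a b \<longleftrightarrow> z \<in> cells (bsimplex m n) a b \<and>
     ((\<exists>i<m. i \<notin> set (fst z)) \<or> (\<exists>j<n. j \<notin> set (snd z)))"
  by (cases z) (auto simp: bhorn_def less_le)

lemma cells_bbdryA_iff [simp]:
  "z \<in> cells (bbdryA m n) a b \<longleftrightarrow> z \<in> cells (bhorn m n) a b \<or>
     z \<in> cells (bsimplex m n) a b \<and> (\<exists>i\<le>m. i \<notin> set (fst z)) \<and> (\<exists>j\<le>n. j \<notin> set (snd z))"
  by (cases z) (auto simp: bbdryA_def simp del: cells_bhorn_iff)

lemma bisimplicial_set_bsimplex: "bisimplicial_set (bsimplex m n)"
  unfolding bsimplex_def by (intro bisimplicial_set_box simplicial_set_simplex)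

lemma subcomplex_bbdry: "subcomplex (bbdry m n) (bsimplex m n)"
  unfolding bbdry_def bsimplex_def
  by (intro subcomplex_bcup subcomplex_box ssub_bdry ssub_refl simplicial_set_simplex)

lemma subcomplex_bhorn: "subcomplex (bhorn m n) (bsimplex m n)"
  unfolding bhorn_def bsimplex_def
  by (intro subcomplex_bcup subcomplex_box ssub_horn ssub_refl simplicial_set_simplex)

lemma subcomplex_bbdryA: "subcomplex (bbdryA m n) (bsimplex m n)"
  using subcomplex_bhorn unfolding bbdryA_def bsimplex_def
  by (intro subcomplex_bcup subcomplex_box ssub_bdry)

lemma opmaps_map:
  assumes "f \<in> opmaps k m" "\<And>v w. v \<le> w \<Longrightarrow> w \<le> m \<Longrightarrow> g v \<le> g w" "\<And>v. v \<le> m \<Longrightarrow> g v \<le> m'"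
  shows "map g f \<in> opmaps k m'"
proof -
  have f: "length f = Suc k" "sorted f" "set f \<subseteq> {..m}" using assms by (auto simp: opmaps_def)
  have "sorted (map g f)"
    unfolding sorted_iff_nth_mono
  proof (intro allI impI)
    fix i j assume ij: "i \<le> j" "j < length (map g f)"
    then have "f ! j \<le> m" using f by (metis atMost_iff length_map nth_mem subsetD)
    then show "map g f ! i \<le> map g f ! j"
      using ij f(2) assms(2) by (auto simp: sorted_nth_mono)
  qed
  then show ?thesis using f assms(3) by (auto simp: opmaps_def)
qed

lemma map_opcomp: "s \<in> opmaps k m \<Longrightarrow> f \<in> opmaps l k \<Longrightarrow> opcomp (map g s) f = map g (opcomp s f)"
  by (auto simp: opmaps_def opcomp_def)

lemma opmaps_nth:
  "s \<in> opmaps k m \<Longrightarrow> i \<le> k \<Longrightarrow> s ! i \<le> m"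
  "s \<in> opmaps k m \<Longrightarrow> i \<le> j \<Longrightarrow> j \<le> k \<Longrightarrow> s ! i \<le> s ! j"
  by (auto simp: opmaps_def sorted_nth_mono) (metis atMost_iff le_imp_less_Suc nth_mem subsetD)

lemma opmapsI:
  "length s = Suc k \<Longrightarrow> (\<And>i j. i \<le> j \<Longrightarrow> j \<le> k \<Longrightarrow> s ! i \<le> s ! j) \<Longrightarrow> (\<And>i. i \<le> k \<Longrightarrow> s ! i \<le> m) \<Longrightarrow>
   s \<in> opmaps k m"
  by (auto simp: opmaps_def sorted_iff_nth_mono in_set_conv_nth less_Suc_eq_le)

lemma opcomp_nth [simp]: "i < length f \<Longrightarrow> opcomp s f ! i = s ! (f ! i)"
  by (simp add: opcomp_def)

lemma length_opcomp [simp]: "length (opcomp s f) = length f"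
  by (simp add: opcomp_def)

lemma opmaps_length: "s \<in> opmaps k m \<Longrightarrow> length s = Suc k"
  by (simp add: opmaps_def)

lemma in_set_opmaps: "s \<in> opmaps k m \<Longrightarrow> v \<in> set s \<longleftrightarrow> (\<exists>i\<le>k. s ! i = v)"
  by (auto simp: opmaps_def in_set_conv_nth less_Suc_eq_le)

section \<open>Filling the prism by horns\<close>

text \<open>The stage \<open>r\<close> of a filtration of \<open>\<Delta>\<^sup>a \<times> \<Delta>\<^sup>1\<close>: a simplex \<open>(s, t)\<close> belongs to it if \<open>s\<close> lies in the
  boundary or if all its vertices over \<open>0\<close> have first coordinate less than \<open>r\<close>. It starts at \<open>r = 0\<close>
  with \<open>\<partial>\<Delta>\<^sup>a \<times> \<Delta>\<^sup>1 \<union> \<Delta>\<^sup>a \<times> {1}\<close> and ends at \<open>r = a + 1\<close> with the whole prism.\<close>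

definition prism :: "nat \<Rightarrow> nat \<Rightarrow> (nat list \<times> nat list) sset" where
  "prism a r = \<lparr>scells = (\<lambda>k. {(s, t). s \<in> opmaps k a \<and> t \<in> opmaps k 1 \<and>
       ((\<exists>i\<le>a. i \<notin> set s) \<or> (\<forall>i\<le>k. t ! i = 0 \<longrightarrow> s ! i < r))}),
     sact = (\<lambda>k f (s, t). (opcomp s f, opcomp t f))\<rparr>"

lemma scells_prism [simp]:
  "(s, t) \<in> scells (prism a r) k \<longleftrightarrow> s \<in> opmaps k a \<and> t \<in> opmaps k 1 \<and>
       ((\<exists>i\<le>a. i \<notin> set s) \<or> (\<forall>i\<le>k. t ! i = 0 \<longrightarrow> s ! i < r))"
  by (simp add: prism_def)

lemma sact_prism: "sact (prism a r) = (\<lambda>k f (s, t). (opcomp s f, opcomp t f))"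
  by (simp add: prism_def)

lemma simplicial_set_prism: "simplicial_set (prism a r)"
  unfolding simplicial_set_def
proof (intro conjI allI impI)
  fix m k f x assume *: "x \<in> scells (prism a r) m \<and> f \<in> opmaps k m"
  then obtain s t where x: "x = (s, t)" "s \<in> opmaps m a" "t \<in> opmaps m 1"
    "(\<exists>i\<le>a. i \<notin> set s) \<or> (\<forall>i\<le>m. t ! i = 0 \<longrightarrow> s ! i < r)" and f: "f \<in> opmaps k m"
    by (cases x) auto
  have "(\<exists>i\<le>a. i \<notin> set (opcomp s f)) \<or> (\<forall>i\<le>k. opcomp t f ! i = 0 \<longrightarrow> opcomp s f ! i < r)"
    using x(4) set_opcomp[OF x(2) f] opmaps_nth(1)[OF f] opmaps_length[OF f]
    by (auto simp: less_Suc_eq_le)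
  then show "sact (prism a r) m f x \<in> scells (prism a r) k"
    using x opcomp_opmaps[OF _ f] by (auto simp: sact_prism)
qed (auto simp: sact_prism opcomp_id_right opcomp_assoc)

lemma ssub_prism: "r \<le> r' \<Longrightarrow> ssub (prism a r) (prism a r')"
  by (auto simp: ssub_def simplicial_set_prism sact_prism) fastforce

text \<open>The simplex attached in step \<open>r\<close> is the shuffle \<open>(0,0), \<dots>, (r,0), (r,1), \<dots>, (a,1)\<close>. Its face
  opposite to \<open>(r,0)\<close> belongs to stage \<open>r\<close> by the definition of that stage, the face opposite to
  \<open>(r,1)\<close> is new, and all others lie over the boundary of \<open>\<Delta>\<^sup>a\<close>.\<close>

lemma sattach_prism:
  assumes "r \<le> a"
  shows "sattach (prism a r) (prism a (Suc r)) (\<Lambda> (Suc a) (Suc r)) (\<Delta> (Suc a))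
    (\<lambda>k f. (map (\<lambda>i. if i \<le> r then i else i - 1) f, map (\<lambda>i. if i \<le> r then 0 else 1) f))"
    (is "sattach ?C ?D ?A ?B (\<lambda>k f. (map ?g f, map ?e f))")
  unfolding sattach_def
proof (intro conjI allI impI)
  show "ssub ?C ?D" "ssub ?A ?B" by (auto intro: ssub_prism ssub_horn)
next
  fix k z assume z: "z \<in> scells ?B k"
  have ge: "map ?g z \<in> opmaps k a" "map ?e z \<in> opmaps k 1"
    using z assms by (auto intro!: opmaps_map[of z k "Suc a"])
  have C: "(map ?g z, map ?e z) \<in> scells ?C k \<longleftrightarrow>
      (\<exists>i\<le>a. i \<notin> set (map ?g z)) \<or> (\<forall>i\<le>k. map ?e z ! i = 0 \<longrightarrow> map ?g z ! i < r)"
    using ge by simp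
  have nz: "i \<le> k \<Longrightarrow> i < length z" for i using z by (auto simp: opmaps_def)
  show "(map ?g z, map ?e z) \<in> scells ?D k"
    using ge nz by (auto simp: nth_map)
  show "(map ?g z, map ?e z) \<in> scells ?C k \<longleftrightarrow> z \<in> scells ?A k"
  proof
    assume "(map ?g z, map ?e z) \<in> scells ?C k"
    then consider i where "i \<le> a" "i \<notin> set (map ?g z)" |
       "\<forall>i\<le>k. map ?e z ! i = 0 \<longrightarrow> map ?g z ! i < r" by auto
    then show "z \<in> scells ?A k"
    proof cases
      case 1
      then have "i \<noteq> ?g v" if "v \<in> set z" for v using that by auto
      from this[of i] this[of "Suc i"] have *: "i \<le> r \<longrightarrow> i \<notin> set z" "r < i \<longrightarrow> Suc i \<notin> set z" by auto
      show ?thesis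
      proof (cases "i \<le> r")
        case True
        then show ?thesis using *(1) z assms by (auto intro!: exI[of _ i])
      next
        case False
        then show ?thesis using *(2) 1(1) z by (auto intro!: exI[of _ "Suc i"])
      qed
    next
      case 2
      have "r \<notin> set z"
      proof
        assume "r \<in> set z"
        then obtain i where "i \<le> k" "z ! i = r" using z in_set_opmaps by auto
        then show False using 2 nz[of i] by auto
      qed
      then show ?thesis using z assms by (auto intro!: exI[of _ r])
    qed
  next
    assume "z \<in> scells ?A k"
    then obtain i where i: "i \<le> Suc a" "i \<noteq> Suc r" "i \<notin> set z" by auto
    consider "i < r" | "i = r" | "i > Suc r" using i(2) by linarith
    then show "(map ?g z, map ?e z) \<in> scells ?C k"
    proof cases
      case 1
      then have "i \<notin> set (map ?g z)" using i by (auto split: if_splits)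
      moreover have "i \<le> a" using 1 assms by simp
      ultimately show ?thesis using C by blast
    next
      case 2
      have "map ?g z ! j < r" if "j \<le> k" "map ?e z ! j = 0" for j
        using that nz[of j] i(3) 2 by (auto split: if_splits) (metis le_neq_implies_less nth_mem)
      then show ?thesis using C by blast
    next
      case 3
      have "?g v \<noteq> i - 1" if "v \<in> set z" for v
      proof -
        have "v \<noteq> i" using that i by auto
        then show ?thesis using 3 by auto
      qed
      then have "i - 1 \<notin> set (map ?g z)" by fastforce
      moreover have "i - 1 \<le> a" using i by simp
      ultimately show ?thesis using C by blast
    qed
  qed
next
  fix k l f z assume "z \<in> scells ?B k" "f \<in> opmaps l k"
  then show "(map ?g (sact ?B k f z), map ?e (sact ?B k f z)) = sact ?D k f (map ?g z, map ?e z)"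
    by (simp add: sact_prism map_opcomp)
next
  fix k z z' assume z: "z \<in> scells ?B k" "z' \<in> scells ?B k"
    and e: "(map ?g z, map ?e z) = (map ?g z', map ?e z')"
  show "z = z'"
  proof (rule nth_equalityI)
    show l: "length z = length z'" using z by (auto simp: opmaps_def)
    fix i assume i: "i < length z"
    have "map ?g z ! i = map ?g z' ! i" "map ?e z ! i = map ?e z' ! i" using e by auto
    then have g: "?g (z ! i) = ?g (z' ! i)" and e': "?e (z ! i) = ?e (z' ! i)" using i l by simp_all
    have "z ! i \<le> r \<longleftrightarrow> z' ! i \<le> r" using e' by (metis zero_neq_one)
    then show "z ! i = z' ! i" using g by (cases "z ! i \<le> r") auto
  qed
next
  fix k d assume d: "d \<in> scells ?D k"
  obtain s t where [simp]: "d = (s, t)" by (cases d)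
  have s: "s \<in> opmaps k a" and t: "t \<in> opmaps k 1" using d by auto
  show "d \<in> scells ?C k \<or> d \<in> (\<lambda>f. (map ?g f, map ?e f)) ` scells ?B k"
  proof (cases "d \<in> scells ?C k")
    case False
    have le: "s ! j \<le> r" if "j \<le> k" "t ! j = 0" for j
      using d False s t that unfolding \<open>d = (s, t)\<close> scells_prism less_Suc_eq_le by blast
    obtain i where i: "i \<le> k" "t ! i = 0" "\<not> s ! i < r"
      using False s t unfolding \<open>d = (s, t)\<close> scells_prism by blast
    then have i: "i \<le> k" "t ! i = 0" "s ! i = r" using le[of i] by simp_all
    \<comment> \<open>A vertex over \<open>1\<close> comes after the vertex \<open>(r, 0)\<close> at position \<open>i\<close>.\<close>
    have ge: "r \<le> s ! j" if "j \<le> k" "t ! j \<noteq> 0" for j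
    proof -
      have "i \<le> j"
        using opmaps_nth(2)[OF t, of j i] i that by (metis le_zero_eq nat_le_linear)
      then show ?thesis using opmaps_nth(2)[OF s, of i j] that i by simp
    qed
    \<comment> \<open>In the shuffle, the vertex \<open>(v, e)\<close> has number \<open>v + e\<close>.\<close>
    define f where "f = map (\<lambda>j. s ! j + t ! j) [0..<Suc k]"
    have f: "f \<in> scells ?B k"
      unfolding scells_simplex
    proof (rule opmapsI)
      fix i j assume "i \<le> j" "j \<le> k"
      then show "f ! i \<le> f ! j" using opmaps_nth(2)[OF s, of i j] opmaps_nth(2)[OF t, of i j]
        by (auto simp: f_def nth_map simp del: upt_Suc)
    next
      fix i assume "i \<le> k"
      then show "f ! i \<le> Suc a" using opmaps_nth(1)[OF s, of i] opmaps_nth(1)[OF t, of i]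
        by (auto simp: f_def simp del: upt_Suc)
    qed (simp add: f_def)
    have "map ?g f = s"
    proof (rule nth_equalityI)
      show "length (map ?g f) = length s" using s by (simp add: f_def opmaps_def)
      fix j assume "j < length (map ?g f)"
      then have j: "j \<le> k" by (simp add: f_def)
      then show "map ?g f ! j = s ! j"
        using le[OF j] ge[OF j] opmaps_nth(1)[OF t j]
        by (cases "t ! j = 0") (auto simp: f_def simp del: upt_Suc)
    qed
    moreover have "map ?e f = t"
    proof (rule nth_equalityI)
      show "length (map ?e f) = length t" using t by (simp add: f_def opmaps_def)
      fix j assume "j < length (map ?e f)"
      then have j: "j \<le> k" by (simp add: f_def)
      then show "map ?e f ! j = t ! j"
        using le[OF j] ge[OF j] opmaps_nth(1)[OF t j]
        by (cases "t ! j = 0") (auto simp: f_def simp del: upt_Suc)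
    qed
    ultimately show ?thesis using f by force
  qed simp
qed

section \<open>Fibrations and cells of prisms\<close>

text \<open>Only the lifting property against the generating inclusions is needed of a fibration. Unlike
  \<open>fibration\<close>, it passes directly to fibers and to maps to the point.\<close>

definition bifib :: "'x biset \<Rightarrow> 'y biset \<Rightarrow> ('x, 'y) bfun \<Rightarrow> bool" where
  "bifib X Y p \<longleftrightarrow> bimap X Y p \<and> (\<forall>m n k l. 1 \<le> m \<longrightarrow> 1 \<le> n \<longrightarrow> k \<le> m \<longrightarrow> l \<le> n \<longrightarrow>
     has_rlp X Y p (boxbdry (\<Lambda> m k) (\<Delta> m) (\<Lambda> n l) (\<Delta> n)) (\<Delta> m \<boxtimes> \<Delta> n) bid)"

lemma bifibD:
  assumes "bifib X Y p"
  shows "bimap X Y p"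
    "1 \<le> m \<Longrightarrow> 1 \<le> n \<Longrightarrow> k \<le> m \<Longrightarrow> l \<le> n \<Longrightarrow>
     has_rlp X Y p (boxbdry (\<Lambda> m k) (\<Delta> m) (\<Lambda> n l) (\<Delta> n)) (\<Delta> m \<boxtimes> \<Delta> n) bid"
  using assms unfolding bifib_def by blast+

lemma fibration_bifib: "fibration X Y p \<Longrightarrow> bifib X Y p"
  unfolding bifib_def boxbdry_def
  using anodyne_horn_incl by (auto simp: fibration_def)

lemma has_rlp_boxbdry_same1:
  "ssub C D \<Longrightarrow> has_rlp X Y p (boxbdry A A C D) (A \<boxtimes> D) bid"
  by (rule has_rlp_same_cells) (auto simp: boxbdry_def ssub_def)

lemma has_rlp_boxbdry_same2:
  "ssub C D \<Longrightarrow> has_rlp X Y p (boxbdry C D A A) (D \<boxtimes> A) bid"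
  by (rule has_rlp_same_cells) (auto simp: boxbdry_def ssub_def box_def)

lemma has_rlp_prism_horn:
  assumes p: "bifib X Y p" and n: "1 \<le> n" "l \<le> n" and r: "r \<le> Suc a"
  shows "has_rlp X Y p (boxbdry (prism a 0) (prism a r) (\<Lambda> n l) (\<Delta> n)) (prism a r \<boxtimes> \<Delta> n) bid"
  using r
proof (induction r)
  case 0
  show ?case by (rule has_rlp_boxbdry_same1[OF ssub_horn])
next
  case (Suc r)
  have step: "has_rlp X Y p (boxbdry (prism a r) (prism a (Suc r)) (\<Lambda> n l) (\<Delta> n))
      (prism a (Suc r) \<boxtimes> \<Delta> n) bid"
    by (rule has_rlp_sattach1[OF sattach_prism ssub_horn bifibD(2)[OF p]])
       (use n Suc.prems in simp_all)
  show ?case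
    by (rule has_rlp_boxbdry_trans1[OF ssub_prism ssub_prism ssub_horn Suc.IH step])
       (use Suc.prems in simp_all)
qed

lemma has_rlp_prism_prism:
  assumes p: "bifib X Y p" and r: "r \<le> Suc b"
  shows "has_rlp X Y p (boxbdry (prism a 0) (prism a (Suc a)) (prism b 0) (prism b r))
    (prism a (Suc a) \<boxtimes> prism b r) bid"
  using r
proof (induction r)
  case 0
  show ?case by (rule has_rlp_boxbdry_same2[OF ssub_prism]) simp
next
  case (Suc r)
  have "has_rlp X Y p
      (boxbdry (prism a 0) (prism a (Suc a)) (\<Lambda> (Suc b) (Suc r)) (\<Delta> (Suc b)))
      (prism a (Suc a) \<boxtimes> \<Delta> (Suc b)) bid"
    by (rule has_rlp_prism_horn[OF p]) (use Suc.prems in simp_all)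
  from has_rlp_sattach2[OF sattach_prism ssub_prism this]
  have step: "has_rlp X Y p (boxbdry (prism a 0) (prism a (Suc a)) (prism b r) (prism b (Suc r)))
      (prism a (Suc a) \<boxtimes> prism b (Suc r)) bid"
    using Suc.prems by simp
  show ?case
    by (rule has_rlp_boxbdry_trans2[OF ssub_prism ssub_prism ssub_prism Suc.IH step])
       (use Suc.prems in simp_all)
qed

lemma all_not_zero_iff:
  assumes "t \<in> opmaps k 1"
  shows "(\<forall>i\<le>k. t ! i \<noteq> 0) \<longleftrightarrow> 0 \<notin> set t"
  using in_set_opmaps[OF assms, of 0] by auto

text \<open>Up to reordering the four factors, the inclusion is the pushout product of two prism
  inclusions.\<close>

lemma has_rlp_cell:
  assumes p: "bifib X Y p"
  shows "has_rlp X Y p (bbdry a b \<times>\<^sub>b bsimplex 1 1 \<union>\<^sub>b bsimplex a b \<times>\<^sub>b bhorn 1 1)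
    (bsimplex a b \<times>\<^sub>b bsimplex 1 1) bid"
proof (rule has_rlp_attach[where q = "\<lambda>m n ((s, t), (s', t')). ((s, s'), (t, t'))",
      OF _ _ _ _ _ _ has_rlp_prism_prism[OF p order_refl]])
  let ?A = "boxbdry (prism a 0) (prism a (Suc a)) (prism b 0) (prism b (Suc b))"
  show "subcomplex (bbdry a b \<times>\<^sub>b bsimplex 1 1 \<union>\<^sub>b bsimplex a b \<times>\<^sub>b bhorn 1 1)
      (bsimplex a b \<times>\<^sub>b bsimplex 1 1)"
    by (intro subcomplex_bcup subcomplex_bprod subcomplex_bbdry subcomplex_bhorn subcomplex_refl
        bisimplicial_set_bsimplex)
  show "subcomplex ?A (prism a (Suc a) \<boxtimes> prism b (Suc b))"
    by (intro subcomplex_boxbdry ssub_prism) auto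
  show "bimap (prism a (Suc a) \<boxtimes> prism b (Suc b)) (bsimplex a b \<times>\<^sub>b bsimplex 1 1)
      (\<lambda>m n ((s, t), (s', t')). ((s, s'), (t, t')))"
    by (rule bimapI)
       (auto simp: bisimplicial_set_box simplicial_set_prism bisimplicial_set_bprod
          bisimplicial_set_bsimplex sact_prism)
  have top: "(s, t) \<in> scells (prism c (Suc c)) k \<longleftrightarrow> s \<in> opmaps k c \<and> t \<in> opmaps k 1" for s t c k
    using opmaps_nth(1)[of s k c] by (auto simp: less_Suc_eq_le)
  have bot: "(s, t) \<in> scells (prism c 0) k \<longleftrightarrow>
      s \<in> opmaps k c \<and> t \<in> opmaps k 1 \<and> ((\<exists>i\<le>c. i \<notin> set s) \<or> 0 \<notin> set t)" for s t c k
    unfolding scells_prism not_less0 using all_not_zero_iff[of t k] by blast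
  show "d \<in> cells (bbdry a b \<times>\<^sub>b bsimplex 1 1 \<union>\<^sub>b bsimplex a b \<times>\<^sub>b bhorn 1 1) m n \<or>
      d \<in> (\<lambda>((s, t), (s', t')). ((s, s'), (t, t'))) ` cells (prism a (Suc a) \<boxtimes> prism b (Suc b)) m n"
    if "d \<in> cells (bsimplex a b \<times>\<^sub>b bsimplex 1 1) m n" for m n d
  proof -
    obtain s s' t t' where d: "d = ((s, s'), (t, t'))" by (metis prod.exhaust)
    have "d = (\<lambda>((s, t), (s', t')). ((s, s'), (t, t'))) ((s, t), (s', t'))" by (simp add: d)
    moreover have "((s, t), (s', t')) \<in> cells (prism a (Suc a) \<boxtimes> prism b (Suc b)) m n"
      using that by (auto simp: d top simp del: scells_prism)
    ultimately show ?thesis by blast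
  qed
  show "(\<lambda>((s, t), (s', t')). ((s, s'), (t, t'))) z
       \<in> cells (bbdry a b \<times>\<^sub>b bsimplex 1 1 \<union>\<^sub>b bsimplex a b \<times>\<^sub>b bhorn 1 1) m n \<longleftrightarrow> z \<in> cells ?A m n"
    if "z \<in> cells (prism a (Suc a) \<boxtimes> prism b (Suc b)) m n" for m n z
  proof -
    obtain s s' t t' where z: "z = ((s, t), (s', t'))" by (metis prod.exhaust)
    have st: "s \<in> opmaps m a" "t \<in> opmaps m 1" "s' \<in> opmaps n b" "t' \<in> opmaps n 1"
      using that by (auto simp: z top simp del: scells_prism)
    have "(s, t) \<in> scells (prism a 0) m \<longleftrightarrow> (\<exists>i\<le>a. i \<notin> set s) \<or> 0 \<notin> set t"
      "(s', t') \<in> scells (prism b 0) n \<longleftrightarrow> (\<exists>i\<le>b. i \<notin> set s') \<or> 0 \<notin> set t'"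
      "(s, t) \<in> scells (prism a (Suc a)) m" "(s', t') \<in> scells (prism b (Suc b)) n"
      using st bot top by blast+
    then show ?thesis using st by (simp add: z boxbdry_def del: scells_prism)
  qed
  show "z = z'" if "(\<lambda>((s, t), (s', t')). ((s, s'), (t, t'))) z = (\<lambda>((s, t), (s', t')). ((s, s'), (t, t'))) z'"
    for z z' :: "(nat list \<times> nat list) \<times> (nat list \<times> nat list)"
    using that by (cases z; cases z') auto
qed

section \<open>Lifting against products with the square\<close>

lemma opmaps_factor:
  assumes f: "f \<in> opmaps k a" and i: "i \<le> a" "i \<notin> set f"
  obtains a' d g where "a = Suc a'" "d \<in> opmaps a' a" "g \<in> opmaps k a'" "f = opcomp d g"
proof -
  have f0: "f ! 0 \<in> set f" "f ! 0 \<le> a" using f opmaps_nth(1)[OF f] in_set_opmaps[OF f] by auto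
  then have "a \<noteq> 0" using i by (metis le_zero_eq)
  then obtain a' where a: "a = Suc a'" by (cases a) auto
  define d where "d = map (\<lambda>v. if v < i then v else Suc v) [0..<Suc a']"
  define g where "g = map (\<lambda>v. if v < i then v else v - 1) f"
  have dn: "v \<le> a' \<Longrightarrow> d ! v = (if v < i then v else Suc v)" for v
    by (simp add: d_def del: upt_Suc)
  have "d \<in> opmaps a' a"
    by (rule opmapsI) (auto simp: dn a, simp add: d_def)
  moreover have g: "g \<in> opmaps k a'"
    unfolding g_def
  proof (rule opmapsI)
    show "length (map (\<lambda>v. if v < i then v else v - 1) f) = Suc k" using f by (simp add: opmaps_def)
    show "map (\<lambda>v. if v < i then v else v - 1) f ! j \<le> map (\<lambda>v. if v < i then v else v - 1) f ! j'"
      if "j \<le> j'" "j' \<le> k" for j j'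
      using opmaps_nth(2)[OF f that] that f by (auto simp: opmaps_def)
    show "map (\<lambda>v. if v < i then v else v - 1) f ! j \<le> a'" if "j \<le> k" for j
      using opmaps_nth(1)[OF f that] that f i a by (auto simp: opmaps_def)
  qed
  moreover have "f = opcomp d g"
  proof (rule nth_equalityI)
    show "length f = length (opcomp d g)" by (simp add: g_def)
    fix j assume j: "j < length f"
    then have jk: "j \<le> k" using f by (simp add: opmaps_def)
    have "f ! j \<noteq> i" using i j by auto
    then show "f ! j = opcomp d g ! j"
      using j opmaps_nth(1)[OF g jk] opmaps_nth(1)[OF f jk]
      by (auto simp: g_def dn a split: if_splits)
  qed
  ultimately show ?thesis using that a by blast
qed

lemma opmaps_section:
  assumes f: "f \<in> opmaps k a" and onto: "\<And>i. i \<le> a \<Longrightarrow> i \<in> set f"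
  obtains g where "g \<in> opmaps a k" "opcomp f g = opid a"
proof
  define g where "g = map (\<lambda>v. LEAST j. f ! j = v) [0..<Suc a]"
  have L: "f ! (LEAST j. f ! j = v) = v \<and> (LEAST j. f ! j = v) \<le> k" if "v \<le> a" for v
  proof -
    have "v \<in> set f" using onto that by simp
    then obtain j where "j \<le> k" "f ! j = v" using in_set_opmaps[OF f] by auto
    then show ?thesis by (metis (mono_tags, lifting) LeastI_ex Least_le le_trans)
  qed
  show "g \<in> opmaps a k"
  proof (rule opmapsI)
    fix v w assume vw: "v \<le> w" "w \<le> a"
    show "g ! v \<le> g ! w"
    proof (cases "v = w")
      case False
      have "\<not> (LEAST j. f ! j = w) \<le> (LEAST j. f ! j = v)"
        using opmaps_nth(2)[OF f, of "LEAST j. f ! j = w" "LEAST j. f ! j = v"] L[of v] L[of w] vw False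
        by auto
      then show ?thesis using vw by (simp add: g_def del: upt_Suc)
    qed simp
  qed (use L in \<open>auto simp: g_def simp del: upt_Suc\<close>)
  show "opcomp f g = opid a"
    by (rule nth_equalityI) (use L in \<open>auto simp: g_def opid_def simp del: upt_Suc\<close>)
qed

lemma opcomp_id_left: "g \<in> opmaps l b \<Longrightarrow> opcomp (opid b) g = g"
  using opmaps_nth(1)[of g l b]
  by (intro nth_equalityI) (auto simp: opid_def opmaps_length less_Suc_eq_le simp del: upt_Suc)

lemma act_act:
  "bisimplicial_set K \<Longrightarrow> x \<in> cells K m n \<Longrightarrow> f \<in> opmaps k m \<Longrightarrow> g \<in> opmaps l n \<Longrightarrow>
   f' \<in> opmaps k' k \<Longrightarrow> g' \<in> opmaps l' l \<Longrightarrow>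
   act K k l f' g' (act K m n f g x) = act K m n (opcomp f f') (opcomp g g') x"
  by (simp add: bisimplicial_set_def)

lemma act_id: "bisimplicial_set K \<Longrightarrow> x \<in> cells K m n \<Longrightarrow> act K m n (opid m) (opid n) x = x"
  by (simp add: bisimplicial_set_def)

text \<open>A cell is degenerate if it comes from a cell of smaller total degree by any operator; this is
  equivalent to the usual notion and makes \<open>nondeg_rep\<close> immediate.\<close>

definition nondeg :: "'a biset \<Rightarrow> nat \<Rightarrow> nat \<Rightarrow> 'a \<Rightarrow> bool" where
  "nondeg K a b x \<longleftrightarrow> x \<in> cells K a b \<and>
     \<not> (\<exists>a' b' f g y. a' + b' < a + b \<and> y \<in> cells K a' b' \<and> f \<in> opmaps a a' \<and> g \<in> opmaps b b' \<and>
         x = act K a' b' f g y)"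

lemma nondeg_rep:
  assumes K: "bisimplicial_set K" and x: "x \<in> cells K k l"
  shows "\<exists>a b y f g. nondeg K a b y \<and> a + b \<le> k + l \<and> f \<in> opmaps k a \<and> g \<in> opmaps l b \<and>
    x = act K a b f g y"
  using x
proof (induction "k + l" arbitrary: k l x rule: less_induct)
  case less
  show ?case
  proof (cases "nondeg K k l x")
    case True
    then show ?thesis using act_id[OF K less.prems] opid_opmaps by (metis order_refl)
  next
    case False
    then obtain a' b' f g y where 1: "a' + b' < k + l" "y \<in> cells K a' b'" "f \<in> opmaps k a'"
      "g \<in> opmaps l b'" "x = act K a' b' f g y"
      using less.prems unfolding nondeg_def by blast
    from less.hyps[OF 1(1,2)] obtain a b z f' g' where 2: "nondeg K a b z" "a + b \<le> a' + b'"
      "f' \<in> opmaps a' a" "g' \<in> opmaps b' b" "y = act K a b f' g' z" by blast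
    have z: "z \<in> cells K a b" using 2(1) by (simp add: nondeg_def)
    have "x = act K a b (opcomp f' f) (opcomp g' g) z"
      unfolding 1(5) 2(5) by (rule act_act[OF K z 2(3,4) 1(3,4)])
    then show ?thesis
      using 1 2 opcomp_opmaps[OF 2(3) 1(3)] opcomp_opmaps[OF 2(4) 1(4)]
      by (intro exI[of _ a] exI[of _ b] exI[of _ z] exI[of _ "opcomp f' f"] exI[of _ "opcomp g' g"]) auto
  qed
qed

text \<open>Finitely many nondegenerate cells, each with an injective characteristic map. Injectivity
  replaces the uniqueness part of the Eilenberg-Zilber lemma.\<close>

definition regular :: "'a biset \<Rightarrow> bool" where
  "regular K \<longleftrightarrow> bisimplicial_set K \<and> finite {(a, b, x). nondeg K a b x} \<and>
     (\<forall>a b x k l f g f' g'. nondeg K a b x \<longrightarrow> f \<in> opmaps k a \<longrightarrow> f' \<in> opmaps k a \<longrightarrow>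
        g \<in> opmaps l b \<longrightarrow> g' \<in> opmaps l b \<longrightarrow> act K a b f g x = act K a b f' g' x \<longrightarrow> f = f' \<and> g = g')"

text \<open>\<open>L'\<close> arises from \<open>L\<close> by attaching the cell \<open>x\<close>, whose boundary lies in \<open>L\<close>.\<close>

lemma has_rlp_attach_cell:
  assumes p: "bifib X Y p" and K: "regular K" and L: "subcomplex L K"
    and x: "nondeg K a b x" "x \<notin> cells L a b"
    and bd: "\<And>k l f g. (f, g) \<in> cells (bbdry a b) k l \<Longrightarrow> act K a b f g x \<in> cells L k l"
    and L': "cells L' = (\<lambda>k l. cells L k l \<union> {act K a b f g x |f g. f \<in> opmaps k a \<and> g \<in> opmaps l b})"
      "act L' = act K"
  shows "subcomplex L' K"
    and "has_rlp X Y p (L \<times>\<^sub>b bsimplex 1 1 \<union>\<^sub>b K \<times>\<^sub>b bhorn 1 1)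
      (L' \<times>\<^sub>b bsimplex 1 1 \<union>\<^sub>b K \<times>\<^sub>b bhorn 1 1) bid"
proof -
  have bK: "bisimplicial_set K" using K by (simp add: regular_def)
  have xK: "x \<in> cells K a b" using x(1) by (simp add: nondeg_def)
  have inj: "f = f' \<and> g = g'" if "f \<in> opmaps k a" "f' \<in> opmaps k a" "g \<in> opmaps l b" "g' \<in> opmaps l b"
    "act K a b f g x = act K a b f' g' x" for k l f g f' g'
    using K x(1) that unfolding regular_def by blast
  show sL': "subcomplex L' K"
  proof (rule subcomplexI[OF bK L'(2)])
    fix m n z assume "z \<in> cells L' m n"
    then show "z \<in> cells K m n"
      using L'(1) subcomplexD(4)[OF L] act_cells[OF bK xK] by auto
  next
    fix m n k l f g z assume z: "z \<in> cells L' m n" and fg: "f \<in> opmaps k m" "g \<in> opmaps l n"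
    then consider "z \<in> cells L m n" | f' g' where "f' \<in> opmaps m a" "g' \<in> opmaps n b"
      "z = act K a b f' g' x"
      using L'(1) by auto
    then show "act K m n f g z \<in> cells L' k l"
    proof cases
      case 1
      then show ?thesis using act_cells[OF subcomplexD(1)[OF L] 1 fg] subcomplexD(3)[OF L] L'(1) by auto
    next
      case 2
      then have "act K m n f g z = act K a b (opcomp f' f) (opcomp g' g) x"
        using act_act[OF bK xK] fg by simp
      moreover have "opcomp f' f \<in> opmaps k a" "opcomp g' g \<in> opmaps l b"
        using 2 fg opcomp_opmaps by blast+
      ultimately show ?thesis using L'(1) by auto
    qed
  qed
  have LL': "subcomplex L L'"
    using L sL' L'(1) by (auto simp: subcomplex_def)
  \<comment> \<open>Operators onto in both directions have sections, so they would carry \<open>x\<close> itself into \<open>L\<close>.\<close>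
  have in_L: "(f, g) \<in> cells (bbdry a b) k l"
    if h: "f \<in> opmaps k a" "g \<in> opmaps l b" "act K a b f g x \<in> cells L k l" for k l f g
  proof (rule ccontr)
    assume "(f, g) \<notin> cells (bbdry a b) k l"
    then have "\<not> ((\<exists>i\<le>a. i \<notin> set f) \<or> (\<exists>j\<le>b. j \<notin> set g))" using h(1,2) by simp
    then have onto: "\<And>i. i \<le> a \<Longrightarrow> i \<in> set f" "\<And>i. i \<le> b \<Longrightarrow> i \<in> set g" by blast+
    obtain f' where f': "f' \<in> opmaps a k" "opcomp f f' = opid a"
      by (rule opmaps_section[OF h(1) onto(1)])
    obtain g' where g': "g' \<in> opmaps b l" "opcomp g g' = opid b"
      by (rule opmaps_section[OF h(2) onto(2)])
    note fg = f' g'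
    have "act K k l f' g' (act K a b f g x) = x"
      using act_act[OF bK xK h(1,2) fg(1,3)] fg act_id[OF bK xK] by simp
    moreover have "act K k l f' g' (act K a b f g x) \<in> cells L a b"
      using act_cells[OF subcomplexD(1)[OF L] h(3) fg(1,3)] subcomplexD(3)[OF L] by simp
    ultimately show False using x(2) by simp
  qed
  let ?q = "\<lambda>m n ((f, g), w). (act K a b f g x, w)"
  let ?C = "L \<times>\<^sub>b bsimplex 1 1 \<union>\<^sub>b K \<times>\<^sub>b bhorn 1 1"
  let ?D = "L' \<times>\<^sub>b bsimplex 1 1 \<union>\<^sub>b K \<times>\<^sub>b bhorn 1 1"
  let ?A = "bbdry a b \<times>\<^sub>b bsimplex 1 1 \<union>\<^sub>b bsimplex a b \<times>\<^sub>b bhorn 1 1"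
  let ?B = "bsimplex a b \<times>\<^sub>b bsimplex 1 1"
  note ss = subcomplex_bcup subcomplex_bprod subcomplex_bbdry subcomplex_bhorn
    subcomplex_refl bisimplicial_set_bsimplex
  note del = cells_bhorn_iff cells_bbdry_iff cells_bsimplex
  have sD: "subcomplex ?D (K \<times>\<^sub>b bsimplex 1 1)" using sL' bK by (intro ss)
  have sC: "subcomplex ?C (K \<times>\<^sub>b bsimplex 1 1)" using L bK by (intro ss)
  have sC: "subcomplex ?C ?D"
    using sC sD subcomplexD(4)[OF LL'] unfolding subcomplex_def by (auto simp del: del)
  have sA: "subcomplex ?A ?B" by (intro ss)
  show "has_rlp X Y p ?C ?D bid"
  proof (rule has_rlp_attach[where q = ?q, OF sC sA _ _ _ _ has_rlp_cell[OF p]])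
    have "bimap ?B (K \<times>\<^sub>b bsimplex 1 1) ?q"
      by (rule bimapI)
        (auto simp: act_act[OF bK xK] act_cells[OF bK xK] bisimplicial_set_bprod bK
          bisimplicial_set_bsimplex opcomp_opmaps)
    then show "bimap ?B ?D ?q"
      using L'(1) sD unfolding bimap_def subcomplex_def by (auto simp del: del(1,2))
  next
    fix m n z assume z: "z \<in> cells ?B m n"
    obtain f g w where [simp]: "z = ((f, g), w)" by (metis prod.exhaust)
    have fg: "f \<in> opmaps m a" "g \<in> opmaps n b" "(f, g) \<in> cells (bsimplex a b) m n"
      and w: "w \<in> cells (bsimplex 1 1) m n" using z by auto
    show "?q m n z \<in> cells ?C m n \<longleftrightarrow> z \<in> cells ?A m n"
      using bd[of f g m n] in_L[OF fg(1,2)] fg(3) w act_cells[OF bK xK fg(1,2)]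
      by (auto simp del: del)
  next
    fix m n z z' assume z: "z \<in> cells ?B m n" "z' \<in> cells ?B m n" "?q m n z = ?q m n z'"
    obtain f g w f' g' w' where [simp]: "z = ((f, g), w)" "z' = ((f', g'), w')"
      by (metis prod.exhaust)
    show "z = z'" using inj[of f m f' g n g'] z by simp
  next
    fix m n d assume d: "d \<in> cells ?D m n"
    show "d \<in> cells ?C m n \<or> d \<in> ?q m n ` cells ?B m n"
    proof (cases "d \<in> cells ?C m n")
      case False
      obtain c w where [simp]: "d = (c, w)" by (cases d)
      obtain f g where "f \<in> opmaps m a" "g \<in> opmaps n b" "c = act K a b f g x" "w \<in> cells (bsimplex 1 1) m n"
        using False d L'(1) by (auto simp del: del)
      then have "((f, g), w) \<in> cells ?B m n" "d = ?q m n ((f, g), w)" by auto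
      then show ?thesis by blast
    qed simp
  qed
qed

theorem has_rlp_homotopy:
  assumes p: "bifib X Y p" and K: "regular K" and L: "subcomplex L K"
  shows "has_rlp X Y p (L \<times>\<^sub>b bsimplex 1 1 \<union>\<^sub>b K \<times>\<^sub>b bhorn 1 1) (K \<times>\<^sub>b bsimplex 1 1) bid"
  using L
proof (induction "card {(a, b, x). nondeg K a b x \<and> x \<notin> cells L a b}" arbitrary: L rule: less_induct)
  case less
  have bK: "bisimplicial_set K" using K by (simp add: regular_def)
  let ?N = "\<lambda>L. {(a, b, x). nondeg K a b x \<and> x \<notin> cells L a b}"
  have fin: "finite (?N L)"
    by (rule finite_subset[of _ "{(a, b, x). nondeg K a b x}"]) (use K in \<open>auto simp: regular_def\<close>)
  have clos: "act K m n f g z \<in> cells L k l"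
    if "z \<in> cells L m n" "f \<in> opmaps k m" "g \<in> opmaps l n" for m n k l f g z
    using act_cells[OF subcomplexD(1)[OF less.prems] that] subcomplexD(3)[OF less.prems] by simp
  show ?case
  proof (cases "?N L = {}")
    case True
    have "z \<in> cells L m n" if z: "z \<in> cells K m n" for m n z
    proof -
      obtain a b y f g where "nondeg K a b y" "f \<in> opmaps m a" "g \<in> opmaps n b" "z = act K a b f g y"
        using nondeg_rep[OF bK z] by blast
      then show ?thesis using clos True by auto
    qed
    then show ?thesis
      using subcomplexD(3,4)[OF less.prems] subcomplexD(4)[OF subcomplex_bhorn]
      by (intro has_rlp_same_cells) (auto simp: bprod_def simp del: cells_bhorn_iff cells_bsimplex)
  next
    case False
    then obtain t where t: "t \<in> ?N L"
      and tmin: "\<And>t'. t' \<in> ?N L \<Longrightarrow> (\<lambda>(a, b, x). a + b) t \<le> (\<lambda>(a, b, x). a + b) t'"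
      using ex_has_least_nat[of "\<lambda>t. t \<in> ?N L" _ "\<lambda>(a, b, x). a + b"] by blast
    obtain a b x where t_eq: "t = (a, b, x)" by (cases t)
    have x: "nondeg K a b x" "x \<notin> cells L a b" using t by (auto simp: t_eq)
    have xK: "x \<in> cells K a b" using x by (simp add: nondeg_def)
    \<comment> \<open>As \<open>x\<close> has minimal total degree among the missing nondegenerate cells, its boundary is in \<open>L\<close>.\<close>
    have low: "z \<in> cells L k l" if z: "z \<in> cells K k l" "k + l < a + b" for z k l
    proof -
      obtain a' b' y f g where y: "nondeg K a' b' y" "f \<in> opmaps k a'" "g \<in> opmaps l b'"
        "z = act K a' b' f g y" "a' + b' \<le> k + l"
        using nondeg_rep[OF bK z(1)] by blast
      then have "y \<in> cells L a' b'" using tmin[of "(a', b', y)"] z(2) by (auto simp: t_eq)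
      then show ?thesis using clos y by simp
    qed
    have bd: "act K a b f g x \<in> cells L k l" if fg: "(f, g) \<in> cells (bbdry a b) k l" for k l f g
    proof -
      have f: "f \<in> opmaps k a" "g \<in> opmaps l b" using fg by auto
      consider i where "i \<le> a" "i \<notin> set f" | i where "i \<le> b" "i \<notin> set g" using fg by auto
      then show ?thesis
      proof cases
        case 1
        from opmaps_factor[OF f(1) 1] obtain a' d h where h: "a = Suc a'" "d \<in> opmaps a' a"
          "h \<in> opmaps k a'" "f = opcomp d h" .
        have "act K a b f g x = act K a' b h g (act K a b d (opid b) x)"
          using act_act[OF bK xK h(2) opid_opmaps h(3) f(2)] h(4) opcomp_id_left[OF f(2)] by simp
        moreover have "act K a b d (opid b) x \<in> cells L a' b"
          using low act_cells[OF bK xK h(2) opid_opmaps] h(1) by simp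
        ultimately show ?thesis using clos h(3) f(2) by simp
      next
        case 2
        from opmaps_factor[OF f(2) 2] obtain b' d h where h: "b = Suc b'" "d \<in> opmaps b' b"
          "h \<in> opmaps l b'" "g = opcomp d h" .
        have "act K a b f g x = act K a b' f h (act K a b (opid a) d x)"
          using act_act[OF bK xK opid_opmaps h(2) f(1) h(3)] h(4) opcomp_id_left[OF f(1)] by simp
        moreover have "act K a b (opid a) d x \<in> cells L a b'"
          using low act_cells[OF bK xK opid_opmaps h(2)] h(1) by simp
        ultimately show ?thesis using clos h(3) f(1) by simp
      qed
    qed
    define L' where "L' = K\<lparr>cells :=
      \<lambda>k l. cells L k l \<union> {act K a b f g x |f g. f \<in> opmaps k a \<and> g \<in> opmaps l b}\<rparr>"
    have L': "cells L' = (\<lambda>k l. cells L k l \<union> {act K a b f g x |f g. f \<in> opmaps k a \<and> g \<in> opmaps l b})"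
      "act L' = act K" by (simp_all add: L'_def)
    note at = has_rlp_attach_cell[OF p K less.prems x bd L']
    have "x \<in> cells L' a b"
      using act_id[OF bK xK] opid_opmaps unfolding L'(1) by (metis (mono_tags, lifting) CollectI UnCI)
    then have "t \<notin> ?N L'" by (simp add: t_eq)
    moreover have "?N L' \<subseteq> ?N L" unfolding L'(1) by auto
    ultimately have "?N L' \<subset> ?N L" using t by blast
    then have "card (?N L') < card (?N L)" using fin by (rule psubset_card_mono[rotated])
    from less.hyps[OF this at(1)]
    have rest: "has_rlp X Y p (L' \<times>\<^sub>b bsimplex 1 1 \<union>\<^sub>b K \<times>\<^sub>b bhorn 1 1) (K \<times>\<^sub>b bsimplex 1 1) bid" .
    have sub: "subcomplex (M \<times>\<^sub>b bsimplex 1 1 \<union>\<^sub>b K \<times>\<^sub>b bhorn 1 1) (K \<times>\<^sub>b bsimplex 1 1)"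
      if "subcomplex M K" for M
      using that bK by (intro subcomplex_bcup subcomplex_bprod subcomplex_bhorn
          subcomplex_refl bisimplicial_set_bsimplex)
    have "subcomplex (L \<times>\<^sub>b bsimplex 1 1 \<union>\<^sub>b K \<times>\<^sub>b bhorn 1 1)
        (L' \<times>\<^sub>b bsimplex 1 1 \<union>\<^sub>b K \<times>\<^sub>b bhorn 1 1)"
      using sub[OF less.prems] sub[OF at(1)] L'(1)
      by (auto simp: subcomplex_def simp del: cells_bhorn_iff cells_bsimplex)
    from has_rlp_incl_trans[OF at(2) rest this sub[OF at(1)]] show ?thesis .
  qed
qed

section \<open>Regularity of products of simplices\<close>

text \<open>The composite \<open>opcomp d e\<close> is the coface omitting \<open>i + 1\<close> after the degeneracy identifying \<open>i\<close>
  and \<open>i + 1\<close>.\<close>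

lemma opmaps_collapse:
  assumes "i \<le> k"
  obtains d e where "d \<in> opmaps k (Suc k)" "e \<in> opmaps (Suc k) k"
    "\<And>j. j \<le> Suc k \<Longrightarrow> opcomp d e ! j = (if j = Suc i then i else j)"
proof
  let ?d = "map (\<lambda>v. if v \<le> i then v else Suc v) [0..<Suc k]"
  let ?e = "map (\<lambda>v. if v \<le> i then v else v - 1) [0..<Suc (Suc k)]"
  have n: "j \<le> k \<Longrightarrow> ?d ! j = (if j \<le> i then j else Suc j)"
    "j \<le> Suc k \<Longrightarrow> ?e ! j = (if j \<le> i then j else j - 1)" for j
    by (simp_all add: nth_map del: upt_Suc)
  show "?d \<in> opmaps k (Suc k)" "?e \<in> opmaps (Suc k) k"
    by (rule opmapsI; use assms in \<open>auto simp: n simp del: upt_Suc\<close>)+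
  show "opcomp ?d ?e ! j = (if j = Suc i then i else j)" if "j \<le> Suc k" for j
    using that assms by (auto simp: opcomp_def n simp del: upt_Suc)
qed

text \<open>A criterion for complexes like nerves of orders, whose cells are determined by their lists of
  vertices \<open>V1\<close> and \<open>V2\<close> in the two directions: equal vertices can be taken adjacent, and a cell with
  equal adjacent vertices is degenerate.\<close>

lemma regularI:
  fixes V1 :: "'a \<Rightarrow> 'v list" and V2 :: "'a \<Rightarrow> 'w list"
  assumes K: "bisimplicial_set K" and fin: "finite A" "finite B"
    and len: "\<And>k l z. z \<in> cells K k l \<Longrightarrow> length (V1 z) = Suc k \<and> length (V2 z) = Suc l"
    and sub: "\<And>k l z. z \<in> cells K k l \<Longrightarrow> set (V1 z) \<subseteq> A \<and> set (V2 z) \<subseteq> B"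
    and nat: "\<And>k l k' l' f g z. z \<in> cells K k l \<Longrightarrow> f \<in> opmaps k' k \<Longrightarrow> g \<in> opmaps l' l \<Longrightarrow>
      V1 (act K k l f g z) = map ((!) (V1 z)) f \<and> V2 (act K k l f g z) = map ((!) (V2 z)) g"
    and inj: "\<And>k l z z'. z \<in> cells K k l \<Longrightarrow> z' \<in> cells K k l \<Longrightarrow> V1 z = V1 z' \<Longrightarrow> V2 z = V2 z' \<Longrightarrow> z = z'"
    and adj1: "\<And>k l z. z \<in> cells K k l \<Longrightarrow> \<not> distinct (V1 z) \<Longrightarrow> \<exists>i<k. V1 z ! i = V1 z ! Suc i"
    and adj2: "\<And>k l z. z \<in> cells K k l \<Longrightarrow> \<not> distinct (V2 z) \<Longrightarrow> \<exists>i<l. V2 z ! i = V2 z ! Suc i"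
  shows "regular K"
proof -
  have col: "map ((!) v) (opcomp d e) = v"
    if "length v = Suc (Suc k)" "v ! i = v ! Suc i" "e \<in> opmaps (Suc k) k"
      "\<And>j. j \<le> Suc k \<Longrightarrow> opcomp d e ! j = (if j = Suc i then i else j)" for v :: "'c list" and d e i k
  proof (rule nth_equalityI)
    show "length (map ((!) v) (opcomp d e)) = length v" using that by (simp add: opmaps_length)
    fix j assume "j < length (map ((!) v) (opcomp d e))"
    then have "j < length (opcomp d e)" "j \<le> Suc k" using that(3) by (simp_all add: opmaps_length)
    then show "map ((!) v) (opcomp d e) ! j = v ! j"
      using that(2) that(4)[of j] by (simp del: opcomp_nth)
  qed
  have idm: "map ((!) v) (opid k) = v" if "length v = Suc k" for v :: "'c list" and k
    using that by (auto simp: opid_def intro!: nth_equalityI simp del: upt_Suc)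
  have dist: "distinct (V1 z)" "distinct (V2 z)" if nd: "nondeg K k l z" for k l z
  proof -
    have z: "z \<in> cells K k l" using nd by (simp add: nondeg_def)
    show "distinct (V1 z)"
    proof (rule ccontr)
      assume "\<not> distinct (V1 z)"
      then obtain i where i: "i < k" "V1 z ! i = V1 z ! Suc i" using adj1[OF z] by blast
      then obtain k' where k: "k = Suc k'" by (cases k) auto
      obtain d e where de: "d \<in> opmaps k' k" "e \<in> opmaps k k'"
        "\<And>j. j \<le> Suc k' \<Longrightarrow> opcomp d e ! j = (if j = Suc i then i else j)"
        using opmaps_collapse[of i k'] i(1) unfolding k by auto
      have y: "act K k l d (opid l) z \<in> cells K k' l" by (rule act_cells[OF K z de(1) opid_opmaps])
      have "act K k' l e (opid l) (act K k l d (opid l) z) = act K k l (opcomp d e) (opid l) z"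
        using act_act[OF K z de(1) opid_opmaps de(2) opid_opmaps] opcomp_id_left[OF opid_opmaps] by simp
      also have "\<dots> = z"
      proof (rule inj[OF act_cells[OF K z opcomp_opmaps[OF de(1,2)] opid_opmaps] z])
        show "V1 (act K k l (opcomp d e) (opid l) z) = V1 z"
          using nat[OF z opcomp_opmaps[OF de(1,2)] opid_opmaps] col[of "V1 z" k' i e d] len[OF z] i(2) de k
          by simp
        show "V2 (act K k l (opcomp d e) (opid l) z) = V2 z"
          using nat[OF z opcomp_opmaps[OF de(1,2)] opid_opmaps] idm[of "V2 z" l] len[OF z] by simp
      qed
      finally have "z = act K k' l e (opid l) (act K k l d (opid l) z)" ..
      moreover have "k' + l < k + l" by (simp add: k)
      ultimately show False using nd y de(2) opid_opmaps unfolding nondeg_def by blast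
    qed
    show "distinct (V2 z)"
    proof (rule ccontr)
      assume "\<not> distinct (V2 z)"
      then obtain i where i: "i < l" "V2 z ! i = V2 z ! Suc i" using adj2[OF z] by blast
      then obtain l' where l: "l = Suc l'" by (cases l) auto
      obtain d e where de: "d \<in> opmaps l' l" "e \<in> opmaps l l'"
        "\<And>j. j \<le> Suc l' \<Longrightarrow> opcomp d e ! j = (if j = Suc i then i else j)"
        using opmaps_collapse[of i l'] i(1) unfolding l by auto
      have y: "act K k l (opid k) d z \<in> cells K k l'" by (rule act_cells[OF K z opid_opmaps de(1)])
      have "act K k l' (opid k) e (act K k l (opid k) d z) = act K k l (opid k) (opcomp d e) z"
        using act_act[OF K z opid_opmaps de(1) opid_opmaps de(2)] opcomp_id_left[OF opid_opmaps] by simp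
      also have "\<dots> = z"
      proof (rule inj[OF act_cells[OF K z opid_opmaps opcomp_opmaps[OF de(1,2)]] z])
        show "V2 (act K k l (opid k) (opcomp d e) z) = V2 z"
          using nat[OF z opid_opmaps opcomp_opmaps[OF de(1,2)]] col[of "V2 z" l' i e d] len[OF z] i(2) de l
          by simp
        show "V1 (act K k l (opid k) (opcomp d e) z) = V1 z"
          using nat[OF z opid_opmaps opcomp_opmaps[OF de(1,2)]] idm[of "V1 z" k] len[OF z] by simp
      qed
      finally have "z = act K k l' (opid k) e (act K k l (opid k) d z)" ..
      moreover have "k + l' < k + l" by (simp add: l)
      ultimately show False using nd y de(2) opid_opmaps unfolding nondeg_def by blast
    qed
  qed
  have cell: "z \<in> cells K k l" if "nondeg K k l z" for k l z using that by (simp add: nondeg_def)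
  have "finite {(a, b, x). nondeg K a b x}"
  proof (rule inj_on_finite[where f = "\<lambda>(a, b, x). (V1 x, V2 x)"
        and B = "{v. set v \<subseteq> A \<and> distinct v} \<times> {v. set v \<subseteq> B \<and> distinct v}"])
    show "inj_on (\<lambda>(a, b, x). (V1 x, V2 x)) {(a, b, x). nondeg K a b x}"
    proof (rule inj_onI)
      fix t t' :: "nat \<times> nat \<times> 'a"
      assume t: "t \<in> {(a, b, x). nondeg K a b x}" "t' \<in> {(a, b, x). nondeg K a b x}"
        "(\<lambda>(a, b, x). (V1 x, V2 x)) t = (\<lambda>(a, b, x). (V1 x, V2 x)) t'"
      obtain a b x a' b' x' where tt: "t = (a, b, x)" "t' = (a', b', x')" by (metis prod.exhaust)
      have x: "nondeg K a b x" "nondeg K a' b' x'" "V1 x = V1 x'" "V2 x = V2 x'"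
        using t by (auto simp: tt)
      have "a = a'" "b = b'" using len[OF cell[OF x(1)]] len[OF cell[OF x(2)]] x(3,4) by simp_all
      then show "t = t'" unfolding tt using inj x cell by blast
    qed
    show "(\<lambda>(a, b, x). (V1 x, V2 x)) ` {(a, b, x). nondeg K a b x}
      \<subseteq> {v. set v \<subseteq> A \<and> distinct v} \<times> {v. set v \<subseteq> B \<and> distinct v}"
      using dist sub[OF cell] by (auto, blast+)
    show "finite ({v. set v \<subseteq> A \<and> distinct v} \<times> {v. set v \<subseteq> B \<and> distinct v})"
      by (intro finite_cartesian_product finite_subset_distinct fin)
  qed
  moreover have "f = f' \<and> g = g'"
    if x: "nondeg K a b x" and f: "f \<in> opmaps k a" "f' \<in> opmaps k a" "g \<in> opmaps l b" "g' \<in> opmaps l b"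
      and e: "act K a b f g x = act K a b f' g' x" for a b x k l f g f' g'
  proof -
    have uniq: "h = h'" if "distinct v" "length v = Suc c" "h \<in> opmaps j c" "h' \<in> opmaps j c"
      "map ((!) v) h = map ((!) v) h'" for v :: "'c list" and h h' c j
    proof (rule nth_equalityI)
      show "length h = length h'" using that by (simp add: opmaps_length)
      fix r assume r: "r < length h"
      then have "h ! r \<le> c" "h' ! r \<le> c" "v ! (h ! r) = v ! (h' ! r)"
        using that opmaps_nth(1)[of h j c r] opmaps_nth(1)[of h' j c r]
        by (auto simp: opmaps_length less_Suc_eq_le dest: map_eq_imp_length_eq)
          (metis length_map less_Suc_eq_le nth_map opmaps_length)
      then show "h ! r = h' ! r" using that(1,2) by (simp add: nth_eq_iff_index_eq)
    qed
    have "map ((!) (V1 x)) f = map ((!) (V1 x)) f'" "map ((!) (V2 x)) g = map ((!) (V2 x)) g'"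
      using nat[OF cell[OF x] f(1,3)] nat[OF cell[OF x] f(2,4)] e by simp_all
    then show ?thesis
      using uniq[of "V1 x" a f k f'] uniq[of "V2 x" b g l g'] dist[OF x] len[OF cell[OF x]] f by simp
  qed
  ultimately show ?thesis using K unfolding regular_def by blast
qed

lemma not_distinct_opmaps:
  assumes "s \<in> opmaps k m" "t \<in> opmaps k c" "\<not> distinct (zip s t)"
  shows "\<exists>i<k. zip s t ! i = zip s t ! Suc i"
proof -
  have l: "length s = Suc k" "length t = Suc k" using assms by (auto simp: opmaps_length)
  then obtain i j where ij: "i < j" "j \<le> k" "s ! i = s ! j" "t ! i = t ! j"
    using assms(3) by (auto simp: distinct_conv_nth) (metis less_Suc_eq_le nat_neq_iff)
  have "s ! Suc i = s ! i" "t ! Suc i = t ! i"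
    using ij opmaps_nth(2)[OF assms(1), of i "Suc i"] opmaps_nth(2)[OF assms(1), of "Suc i" j]
      opmaps_nth(2)[OF assms(2), of i "Suc i"] opmaps_nth(2)[OF assms(2), of "Suc i" j] by auto
  then show ?thesis using ij l by (intro exI[of _ i]) auto
qed

lemma zip_opcomp:
  assumes "s \<in> opmaps k m" "t \<in> opmaps k c" "f \<in> opmaps l k"
  shows "zip (opcomp s f) (opcomp t f) = map ((!) (zip s t)) f"
  using assms opmaps_nth(1)[OF assms(3)]
  by (intro nth_equalityI) (auto simp: opmaps_length less_Suc_eq_le)

lemma set_zip_opmaps: "s \<in> opmaps k m \<Longrightarrow> t \<in> opmaps k c \<Longrightarrow> set (zip s t) \<subseteq> {..m} \<times> {..c}"
  by (auto simp: opmaps_def dest: set_zip_leftD set_zip_rightD)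

lemma zip_eq_opmaps:
  assumes "s \<in> opmaps k m" "s' \<in> opmaps k m" "t \<in> opmaps k c" "t' \<in> opmaps k c" "zip s t = zip s' t'"
  shows "s = s' \<and> t = t'"
  using assms by (metis map_fst_zip map_snd_zip opmaps_length)

lemma regular_bsimplex_prod: "regular (bsimplex m n \<times>\<^sub>b bsimplex c d)"
proof (rule regularI[where A = "{..m} \<times> {..c}" and B = "{..n} \<times> {..d}"
      and ?V1.0 = "\<lambda>z. zip (fst (fst z)) (fst (snd z))" and ?V2.0 = "\<lambda>z. zip (snd (fst z)) (snd (snd z))"])
  let ?K = "bsimplex m n \<times>\<^sub>b bsimplex c d"
  let ?V1 = "\<lambda>z :: bisimp \<times> bisimp. zip (fst (fst z)) (fst (snd z))"
  let ?V2 = "\<lambda>z :: bisimp \<times> bisimp. zip (snd (fst z)) (snd (snd z))"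
  show "bisimplicial_set ?K" by (intro bisimplicial_set_bprod bisimplicial_set_bsimplex)
  have op: "fst (fst z) \<in> opmaps k m" "snd (fst z) \<in> opmaps l n" "fst (snd z) \<in> opmaps k c"
    "snd (snd z) \<in> opmaps l d" if "z \<in> cells ?K k l" for k l z
    using that by auto
  fix k l z assume z: "z \<in> cells ?K k l"
  note o = op[OF z]
  show "length (?V1 z) = Suc k \<and> length (?V2 z) = Suc l" using o by (simp add: opmaps_length)
  show "set (?V1 z) \<subseteq> {..m} \<times> {..c} \<and> set (?V2 z) \<subseteq> {..n} \<times> {..d}"
    using set_zip_opmaps[OF o(1,3)] set_zip_opmaps[OF o(2,4)] by blast
  show "?V1 (act ?K k l f g z) = map ((!) (?V1 z)) f \<and> ?V2 (act ?K k l f g z) = map ((!) (?V2 z)) g"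
    if "f \<in> opmaps k' k" "g \<in> opmaps l' l" for f g k' l'
    using zip_opcomp[OF o(1,3) that(1)] zip_opcomp[OF o(2,4) that(2)] by simp
  show "z = z'" if z': "z' \<in> cells ?K k l" and "?V1 z = ?V1 z'" "?V2 z = ?V2 z'" for z'
    using zip_eq_opmaps[OF o(1) op(1)[OF z'] o(3) op(3)[OF z']]
      zip_eq_opmaps[OF o(2) op(2)[OF z'] o(4) op(4)[OF z']] that by (simp add: prod_eq_iff)
  show "\<exists>i<k. ?V1 z ! i = ?V1 z ! Suc i" if "\<not> distinct (?V1 z)"
    using not_distinct_opmaps[OF o(1,3) that] .
  show "\<exists>i<l. ?V2 z ! i = ?V2 z ! Suc i" if "\<not> distinct (?V2 z)"
    using not_distinct_opmaps[OF o(2,4) that] .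
qed simp_all

lemma regular_bsimplex: "regular (bsimplex m n)"
proof (rule regularI[where A = "{..m} \<times> {..m}" and B = "{..n} \<times> {..n}"
      and ?V1.0 = "\<lambda>z. zip (fst z) (fst z)" and ?V2.0 = "\<lambda>z. zip (snd z) (snd z)"])
  \<comment> \<open>Doubling the vertices makes the facts about pairs of lists applicable.\<close>
  let ?K = "bsimplex m n"
  show "bisimplicial_set ?K" by (rule bisimplicial_set_bsimplex)
  have op: "fst z \<in> opmaps k m" "snd z \<in> opmaps l n" if "z \<in> cells ?K k l" for k l z
    using that by auto
  fix k l z assume z: "z \<in> cells ?K k l"
  note o = op[OF z]
  show "length (zip (fst z) (fst z)) = Suc k \<and> length (zip (snd z) (snd z)) = Suc l"
    using o by (simp add: opmaps_length)
  show "set (zip (fst z) (fst z)) \<subseteq> {..m} \<times> {..m} \<and> set (zip (snd z) (snd z)) \<subseteq> {..n} \<times> {..n}"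
    using set_zip_opmaps[OF o(1,1)] set_zip_opmaps[OF o(2,2)] by blast
  show "zip (fst (act ?K k l f g z)) (fst (act ?K k l f g z)) = map ((!) (zip (fst z) (fst z))) f \<and>
      zip (snd (act ?K k l f g z)) (snd (act ?K k l f g z)) = map ((!) (zip (snd z) (snd z))) g"
    if "f \<in> opmaps k' k" "g \<in> opmaps l' l" for f g k' l'
    using zip_opcomp[OF o(1,1) that(1)] zip_opcomp[OF o(2,2) that(2)] by simp
  show "z = z'" if z': "z' \<in> cells ?K k l" and "zip (fst z) (fst z) = zip (fst z') (fst z')"
    "zip (snd z) (snd z) = zip (snd z') (snd z')" for z'
    using zip_eq_opmaps[OF o(1) op(1)[OF z'] o(1) op(1)[OF z']]
      zip_eq_opmaps[OF o(2) op(2)[OF z'] o(2) op(2)[OF z']] that by (simp add: prod_eq_iff)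
  show "\<exists>i<k. zip (fst z) (fst z) ! i = zip (fst z) (fst z) ! Suc i"
    if "\<not> distinct (zip (fst z) (fst z))"
    using not_distinct_opmaps[OF o(1,1) that] .
  show "\<exists>i<l. zip (snd z) (snd z) ! i = zip (snd z) (snd z) ! Suc i"
    if "\<not> distinct (zip (snd z) (snd z))"
    using not_distinct_opmaps[OF o(2,2) that] .
qed simp_all

section \<open>Homotopy lifting extension\<close>

lemma homotopy_lifting:
  assumes p: "bifib X Y p" and K: "regular K" and L: "subcomplex L K"
    and f: "bimap K X f" and g: "bimap (L \<times>\<^sub>b bsimplex 1 1) X g"
    and v: "bimap (K \<times>\<^sub>b bsimplex 1 1) Y v"
    and gf: "\<And>a b z w. z \<in> cells L a b \<Longrightarrow> w \<in> cells (bhorn 1 1) a b \<Longrightarrow> g a b (z, w) = f a b z"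
    and pg: "\<And>a b z w. z \<in> cells L a b \<Longrightarrow> w \<in> cells (bsimplex 1 1) a b \<Longrightarrow>
      p a b (g a b (z, w)) = v a b (z, w)"
    and pf: "\<And>a b z w. z \<in> cells K a b \<Longrightarrow> w \<in> cells (bhorn 1 1) a b \<Longrightarrow>
      p a b (f a b z) = v a b (z, w)"
  obtains h where "bimap (K \<times>\<^sub>b bsimplex 1 1) X h"
    "\<And>a b z w. z \<in> cells L a b \<Longrightarrow> w \<in> cells (bsimplex 1 1) a b \<Longrightarrow> h a b (z, w) = g a b (z, w)"
    "\<And>a b z w. z \<in> cells K a b \<Longrightarrow> w \<in> cells (bhorn 1 1) a b \<Longrightarrow> h a b (z, w) = f a b z"
    "\<And>a b z w. z \<in> cells K a b \<Longrightarrow> w \<in> cells (bsimplex 1 1) a b \<Longrightarrow>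
      p a b (h a b (z, w)) = v a b (z, w)"
proof -
  let ?S = "L \<times>\<^sub>b bsimplex 1 1 \<union>\<^sub>b K \<times>\<^sub>b bhorn 1 1"
  note del = One_nat_def cells_bhorn_iff cells_bsimplex
  have bK: "bisimplicial_set K" using K by (simp add: regular_def)
  have bh: "w \<in> cells (bsimplex 1 1) a b" if "w \<in> cells (bhorn 1 1) a b" for w a b
    using subcomplexD(4)[OF subcomplex_bhorn that] .
  have sub: "subcomplex (L \<times>\<^sub>b bsimplex 1 1) (K \<times>\<^sub>b bsimplex 1 1)"
    "subcomplex (K \<times>\<^sub>b bhorn 1 1) (K \<times>\<^sub>b bsimplex 1 1)"
    by (intro subcomplex_bprod subcomplex_bhorn subcomplex_refl bisimplicial_set_bsimplex L bK)+
  define u where "u = (\<lambda>a b (z, w). if z \<in> cells L a b then g a b (z, w) else f a b z)"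
  have u1: "bimap (L \<times>\<^sub>b bsimplex 1 1) X u"
    by (rule bimap_cong[OF g]) (auto simp: u_def)
  have "bimap (K \<times>\<^sub>b bhorn 1 1) X (\<lambda>a b (z, w). f a b z)"
    using f sub(2) unfolding bimap_def subcomplex_def by (auto simp del: del)
  then have u2: "bimap (K \<times>\<^sub>b bhorn 1 1) X u"
    by (rule bimap_cong) (auto simp: u_def gf simp del: del)
  have u: "bimap ?S X u"
    by (rule bimap_bcup[OF u1 u2]) (use sub in \<open>simp add: subcomplex_def\<close>)
  have pu: "p a b (u a b z) = v a b z" if "z \<in> cells ?S a b" for a b z
    using that pg pf subcomplexD(4)[OF L] by (auto simp: u_def bh simp del: del)
  from has_rlp_inclE[OF has_rlp_homotopy[OF p K L] u v pu] obtain h where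
    h: "bimap (K \<times>\<^sub>b bsimplex 1 1) X h" "\<And>a b z. z \<in> cells ?S a b \<Longrightarrow> h a b z = u a b z"
      "\<And>a b z. z \<in> cells (K \<times>\<^sub>b bsimplex 1 1) a b \<Longrightarrow> p a b (h a b z) = v a b z" by blast
  show ?thesis
    by (rule that[OF h(1)]) (use h(2,3) gf in \<open>auto simp: u_def simp del: del\<close>)
qed

section \<open>Comparison of homotopies\<close>

text \<open>The degeneracy in bidegree \<open>(a, b)\<close> of the vertex \<open>(0, 0)\<close>, at which homotopies end; also the
  only cell of \<open>bsimplex 0 0\<close> in this bidegree.\<close>

definition origin :: "nat \<Rightarrow> nat \<Rightarrow> bisimp" where
  "origin a b = (replicate (Suc a) 0, replicate (Suc b) 0)"

lemma opmaps_replicate: "v \<le> m \<Longrightarrow> replicate (Suc a) v \<in> opmaps a m"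
  by (rule opmapsI) (auto simp del: replicate_Suc)

lemma opcomp_replicate: "f \<in> opmaps l k \<Longrightarrow> opcomp (replicate (Suc k) v) f = replicate (Suc l) v"
  using opmaps_nth(1)[of f l k]
  by (intro nth_equalityI) (auto simp: opmaps_length less_Suc_eq_le simp del: replicate_Suc)

lemma origin_cells: "origin a b \<in> cells (bsimplex m n) a b"
  by (auto simp: origin_def opmaps_replicate simp del: replicate_Suc)

lemma act_origin:
  "f \<in> opmaps k a \<Longrightarrow> g \<in> opmaps l b \<Longrightarrow> act (bsimplex m n) a b f g (origin a b) = origin k l"
  by (simp add: origin_def opcomp_replicate del: replicate_Suc)

lemma origin_not_bhorn: "origin a b \<notin> cells (bhorn 1 1) a b"
  by (auto simp: origin_def)

lemma bimap_cover:
  assumes "bisimplicial_set S" "bisimplicial_set X"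
    and "\<And>a b z. z \<in> cells S a b \<Longrightarrow> \<exists>T. act T = act S \<and> z \<in> cells T a b \<and> bimap T X g"
  shows "bimap S X g"
proof (rule bimapI[OF assms(1,2)])
  show "g a b z \<in> cells X a b" if "z \<in> cells S a b" for a b z
    using assms(3)[OF that] by (auto intro: bimap_cells)
  show "g k l (act S a b f h z) = act X a b f h (g a b z)"
    if z: "z \<in> cells S a b" and fh: "f \<in> opmaps k a" "h \<in> opmaps l b" for a b k l f h z
    using assms(3)[OF z] bimap_act[OF _ _ fh] by metis
qed

lemma bimap_slice:
  assumes "bimap (K \<times>\<^sub>b bsimplex c d) X h"
  and "bisimplicial_set K"
  shows "bimap K X (\<lambda>a b z. h a b (z, origin a b))"
proof (rule bimapI)
  show "bisimplicial_set X" using assms by (simp add: bimap_def)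
  fix m n z assume z: "z \<in> cells K m n"
  then have zo: "(z, origin m n) \<in> cells (K \<times>\<^sub>b bsimplex c d) m n"
    using origin_cells by (simp del: cells_bsimplex)
  then show "h m n (z, origin m n) \<in> cells X m n" by (rule bimap_cells[OF assms(1)])
  fix k l f g assume "f \<in> opmaps k m" "g \<in> opmaps l n"
  then show "h k l (act K m n f g z, origin k l) = act X m n f g (h m n (z, origin m n))"
    using bimap_act[OF assms(1) zo, of f k g l] by (simp add: act_origin del: act_bsimplex)
qed (rule assms(2))

lemma bimap_proj:
  assumes "bisimplicial_set M" "bisimplicial_set N" "bisimplicial_set D"
  shows "bimap ((M \<times>\<^sub>b N) \<times>\<^sub>b D) (M \<times>\<^sub>b D) (\<lambda>a b ((z, w), t). (z, t))"
  by (rule bimapI) (auto intro!: bisimplicial_set_bprod assms)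

text \<open>The homotopy \<open>h\<close> between the ends of \<open>h1\<close> and \<open>h2\<close> is found by extending over
  \<open>(\<Delta>\<^bsup>m,n\<^esup> \<times> \<Delta>\<^bsup>1,1\<^esup>) \<times> \<Delta>\<^bsup>1,1\<^esup>\<close>, where the last factor is the direction of \<open>h1\<close> and \<open>h2\<close>, and the
  middle factor is the direction of \<open>h\<close>. The extension is prescribed to be \<open>h1\<close> over the horn of the
  middle factor and over \<open>L\<close>, and \<open>h2\<close> over the vertex \<open>(0, 0)\<close>; \<open>h\<close> is its end.\<close>

theorem homotopy_compare:
  assumes p: "bifib X Y p" and L: "subcomplex L (bsimplex m n)"
    and h1: "bimap (bsimplex m n \<times>\<^sub>b bsimplex 1 1) X h1"
    and h2: "bimap (bsimplex m n \<times>\<^sub>b bsimplex 1 1) X h2"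
    and f: "bimap (bsimplex m n) X f"
    and start: "\<And>a b z w. z \<in> cells (bsimplex m n) a b \<Longrightarrow> w \<in> cells (bhorn 1 1) a b \<Longrightarrow>
      h1 a b (z, w) = f a b z \<and> h2 a b (z, w) = f a b z"
    and rel: "\<And>a b z w. z \<in> cells L a b \<Longrightarrow> w \<in> cells (bsimplex 1 1) a b \<Longrightarrow>
      h1 a b (z, w) = h2 a b (z, w)"
    and over: "\<And>a b z w. z \<in> cells (bsimplex m n) a b \<Longrightarrow> w \<in> cells (bsimplex 1 1) a b \<Longrightarrow>
      p a b (h1 a b (z, w)) = p a b (h2 a b (z, w))"
  obtains h where "bimap (bsimplex m n \<times>\<^sub>b bsimplex 1 1) X h"
    "\<And>a b z w. z \<in> cells (bsimplex m n) a b \<Longrightarrow> w \<in> cells (bhorn 1 1) a b \<Longrightarrow>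
      h a b (z, w) = h1 a b (z, origin a b)"
    "\<And>a b z. z \<in> cells (bsimplex m n) a b \<Longrightarrow> h a b (z, origin a b) = h2 a b (z, origin a b)"
    "\<And>a b z w. z \<in> cells L a b \<Longrightarrow> w \<in> cells (bsimplex 1 1) a b \<Longrightarrow>
      h a b (z, w) = h1 a b (z, origin a b)"
    "\<And>a b z w. z \<in> cells (bsimplex m n) a b \<Longrightarrow> w \<in> cells (bsimplex 1 1) a b \<Longrightarrow>
      p a b (h a b (z, w)) = p a b (h1 a b (z, origin a b))"
proof -
  let ?K = "bsimplex m n" and ?D = "bsimplex 1 1"
  note del = One_nat_def cells_bhorn_iff cells_bsimplex act_bsimplex
  note bs = bisimplicial_set_bsimplex
  define V where "V = ?D\<lparr>cells := \<lambda>a b. {origin a b}\<rparr>"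
  have V: "subcomplex V ?D"
    by (rule subcomplexI) (auto simp: V_def bs act_origin intro: origin_cells simp del: del)
  have cV: "cells V a b = {origin a b}" for a b by (simp add: V_def)
  have bh: "w \<in> cells ?D a b" if "w \<in> cells (bhorn 1 1) a b" for w a b
    using subcomplexD(4)[OF subcomplex_bhorn that] .
  have LK: "z \<in> cells ?K a b" if "z \<in> cells L a b" for z a b by (rule subcomplexD(4)[OF L that])
  let ?L = "L \<times>\<^sub>b ?D \<union>\<^sub>b ?K \<times>\<^sub>b (bhorn 1 1 \<union>\<^sub>b V)"
  have subL: "subcomplex ?L (?K \<times>\<^sub>b ?D)"
    by (intro subcomplex_bcup subcomplex_bprod L V subcomplex_bhorn subcomplex_refl bs)
  let ?g = "\<lambda>a b ((z, w), t). if w = origin a b then h2 a b (z, t) else h1 a b (z, t)"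
  have proj: "bimap ((M \<times>\<^sub>b N) \<times>\<^sub>b ?D) X (\<lambda>a b ((z, w), t). h a b (z, t))"
    if "bimap (?K \<times>\<^sub>b ?D) X h" "subcomplex M ?K" "subcomplex N ?D" for M N h
  proof -
    have "bimap (M \<times>\<^sub>b ?D) X h"
      by (rule bimap_subcomplex[OF that(1)]) (intro subcomplex_bprod that subcomplex_refl bs)
    from bimap_comp[OF bimap_proj[OF subcomplexD(1)[OF that(2)] subcomplexD(1)[OF that(3)] bs] this]
    show ?thesis by (rule bimap_cong) (auto simp: bcomp_def)
  qed
  have g: "bimap (?L \<times>\<^sub>b ?D) X ?g"
  proof (rule bimap_cover)
    show "bisimplicial_set (?L \<times>\<^sub>b ?D)"
      using subL bs by (intro bisimplicial_set_bprod) (auto simp: subcomplex_def)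
    show "bisimplicial_set X" using f by (simp add: bimap_def)
    fix a b c assume c: "c \<in> cells (?L \<times>\<^sub>b ?D) a b"
    obtain z w t where [simp]: "c = ((z, w), t)" by (metis prod.exhaust)
    have a: "act ((M \<times>\<^sub>b N) \<times>\<^sub>b ?D) = act (?L \<times>\<^sub>b ?D)" if "subcomplex M ?K" "subcomplex N ?D" for M N
      using that subL by (simp add: subcomplex_def bprod_def bcup_def)
    have 1: "bimap ((L \<times>\<^sub>b ?D) \<times>\<^sub>b ?D) X ?g"
      by (rule bimap_cong[OF proj[OF h1 L subcomplex_refl[OF bs]]]) (auto simp: rel simp del: del)
    have 2: "bimap ((?K \<times>\<^sub>b bhorn 1 1) \<times>\<^sub>b ?D) X ?g"
      by (rule bimap_cong[OF proj[OF h1 subcomplex_refl[OF bs] subcomplex_bhorn]])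
         (use origin_not_bhorn in \<open>auto simp del: del\<close>)
    have 3: "bimap ((?K \<times>\<^sub>b V) \<times>\<^sub>b ?D) X ?g"
      by (rule bimap_cong[OF proj[OF h2 subcomplex_refl[OF bs] V]]) (auto simp: cV simp del: del)
    consider "z \<in> cells L a b" "w \<in> cells ?D a b" | "z \<in> cells ?K a b" "w \<in> cells (bhorn 1 1) a b"
      | "z \<in> cells ?K a b" "w \<in> cells V a b"
      using c by (auto simp del: del)
    then show "\<exists>T. act T = act (?L \<times>\<^sub>b ?D) \<and> c \<in> cells T a b \<and> bimap T X ?g"
    proof cases
      case 1 then show ?thesis using \<open>bimap ((L \<times>\<^sub>b ?D) \<times>\<^sub>b ?D) X ?g\<close> c
        by (intro exI[of _ "(L \<times>\<^sub>b ?D) \<times>\<^sub>b ?D"] conjI a L subcomplex_refl bs) (auto simp del: del)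
    next
      case 2 then show ?thesis using \<open>bimap ((?K \<times>\<^sub>b bhorn 1 1) \<times>\<^sub>b ?D) X ?g\<close> c
        by (intro exI[of _ "(?K \<times>\<^sub>b bhorn 1 1) \<times>\<^sub>b ?D"] conjI a subcomplex_bhorn subcomplex_refl bs)
          (auto simp del: del)
    next
      case 3 then show ?thesis using \<open>bimap ((?K \<times>\<^sub>b V) \<times>\<^sub>b ?D) X ?g\<close> c
        by (intro exI[of _ "(?K \<times>\<^sub>b V) \<times>\<^sub>b ?D"] conjI a V subcomplex_refl bs) (auto simp del: del)
    qed
  qed
  have f': "bimap (?K \<times>\<^sub>b ?D) X (\<lambda>a b (z, w). f a b z)"
    using f bisimplicial_set_bprod[OF bs bs] unfolding bimap_def by (auto simp del: del)
  have v: "bimap ((?K \<times>\<^sub>b ?D) \<times>\<^sub>b ?D) Y (p \<circ>\<^sub>b (\<lambda>a b ((z, w), t). h1 a b (z, t)))"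
    by (rule bimap_comp[OF proj bifibD(1)[OF p]]) (rule h1 subcomplex_refl bs)+
  obtain H where H: "bimap ((?K \<times>\<^sub>b ?D) \<times>\<^sub>b ?D) X H"
    "\<And>a b z w. z \<in> cells ?L a b \<Longrightarrow> w \<in> cells ?D a b \<Longrightarrow> H a b (z, w) = ?g a b (z, w)"
    "\<And>a b z w. z \<in> cells (?K \<times>\<^sub>b ?D) a b \<Longrightarrow> w \<in> cells ?D a b \<Longrightarrow>
      p a b (H a b (z, w)) = (p \<circ>\<^sub>b (\<lambda>a b ((z, w), t). h1 a b (z, t))) a b (z, w)"
  proof (rule homotopy_lifting[OF p regular_bsimplex_prod subL f' g v])
    show "?g a b (z, t) = (\<lambda>(z, w). f a b z) z"
      if zt: "z \<in> cells ?L a b" "t \<in> cells (bhorn 1 1) a b" for a b z t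
    proof -
      obtain y w where z: "z = (y, w)" by (cases z)
      have "y \<in> cells ?K a b" using zt(1) LK[of y a b] by (auto simp: z simp del: del)
      from start[OF this zt(2)] show ?thesis by (simp add: z)
    qed
    show "p a b (?g a b (z, t)) = (p \<circ>\<^sub>b (\<lambda>a b ((z, w), t). h1 a b (z, t))) a b (z, t)"
      if zt: "z \<in> cells ?L a b" "t \<in> cells ?D a b" for a b z t
    proof -
      obtain y w where z: "z = (y, w)" by (cases z)
      have "y \<in> cells ?K a b" using zt(1) LK[of y a b] by (auto simp: z simp del: del)
      from over[OF this zt(2)] show ?thesis by (simp add: z bcomp_def)
    qed
    show "p a b ((\<lambda>(z, w). f a b z) z) = (p \<circ>\<^sub>b (\<lambda>a b ((z, w), t). h1 a b (z, t))) a b (z, t)"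
      if zt: "z \<in> cells (?K \<times>\<^sub>b ?D) a b" "t \<in> cells (bhorn 1 1) a b" for a b z t
    proof -
      obtain y w where z: "z = (y, w)" by (cases z)
      have "y \<in> cells ?K a b" using zt(1) by (auto simp: z simp del: del)
      from start[OF this zt(2)] show ?thesis by (simp add: z bcomp_def)
    qed
  qed blast
  have o: "origin a b \<in> cells ?D a b" for a b by (rule origin_cells)
  show ?thesis
  proof (rule that)
    show "bimap (?K \<times>\<^sub>b ?D) X (\<lambda>a b z. H a b (z, origin a b))"
      by (rule bimap_slice[OF H(1) bisimplicial_set_bprod[OF bs bs]])
  next
    fix a b z w assume "z \<in> cells ?K a b" "w \<in> cells (bhorn 1 1) a b"
    then show "H a b ((z, w), origin a b) = h1 a b (z, origin a b)"
      using H(2)[of "(z, w)" a b, OF _ o] origin_not_bhorn by (auto simp del: del)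
  next
    fix a b z assume "z \<in> cells ?K a b"
    then show "H a b ((z, origin a b), origin a b) = h2 a b (z, origin a b)"
      using H(2)[of "(z, origin a b)" a b, OF _ o] by (simp add: cV del: del)
  next
    fix a b z w assume "z \<in> cells L a b" "w \<in> cells ?D a b"
    then show "H a b ((z, w), origin a b) = h1 a b (z, origin a b)"
      using H(2)[of "(z, w)" a b, OF _ o] rel[OF _ o] by (auto simp del: del split: if_splits)
  next
    fix a b z w assume "z \<in> cells ?K a b" "w \<in> cells ?D a b"
    then show "p a b (H a b ((z, w), origin a b)) = p a b (h1 a b (z, origin a b))"
      using H(3)[of "(z, w)" a b, OF _ o] by (simp add: bcomp_def del: del)
  qed
qed

section \<open>Homotopy is an equivalence relation\<close>

lemma opmaps_0: "s \<in> opmaps a 0 \<longleftrightarrow> s = replicate (Suc a) 0"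
proof
  assume s: "s \<in> opmaps a 0"
  then show "s = replicate (Suc a) 0"
    by (intro nth_equalityI) (use opmaps_nth(1)[OF s] in \<open>auto simp: opmaps_length simp del: replicate_Suc\<close>)
qed (simp add: opmaps_replicate del: replicate_Suc)

lemma opmaps_1_no_0: "s \<in> opmaps a 1 \<Longrightarrow> 0 \<notin> set s \<longleftrightarrow> s = replicate (Suc a) 1"
proof
  assume s: "s \<in> opmaps a 1" "0 \<notin> set s"
  show "s = replicate (Suc a) 1"
  proof (rule nth_equalityI)
    show "length s = length (replicate (Suc a) (1::nat))" using s by (simp add: opmaps_length)
    fix i assume "i < length s"
    then have "s ! i \<le> 1" "s ! i \<noteq> 0" "i < Suc a"
      using s opmaps_nth(1)[OF s(1), of i] by (auto simp: opmaps_length less_Suc_eq_le in_set_opmaps)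
    then show "s ! i = replicate (Suc a) 1 ! i" by (simp del: replicate_Suc)
  qed
qed auto

lemma cells_bhorn_1:
  "w \<in> cells (bhorn 1 1) a b \<longleftrightarrow> w \<in> cells (bsimplex 1 1) a b \<and>
     (fst w = replicate (Suc a) 1 \<or> snd w = replicate (Suc b) 1)"
  using opmaps_1_no_0[of "fst w" a] opmaps_1_no_0[of "snd w" b]
  by (cases w) (auto simp del: replicate_Suc)

lemma coface_1: "coface (Suc 0) 0 = [Suc 0]" "coface (Suc 0) (Suc 0) = [0]"
  by (simp_all add: coface_def upt_rec)

lemma opcomp_coface_1:
  "opcomp (coface 1 0) (replicate (Suc a) 0) = replicate (Suc a) 1"
  "opcomp (coface 1 1) (replicate (Suc a) 0) = replicate (Suc a) 0"
  by (simp_all add: coface_1 opcomp_def del: replicate_Suc)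

text \<open>The conditions on the faces opposite to the vertex \<open>0\<close> together say that \<open>h\<close> is \<open>\<alpha>\<close> on the
  horn.\<close>

lemma homotopy_iff:
  "homotopy K X \<alpha> \<beta> h \<longleftrightarrow> bimap (K \<times>\<^sub>b bsimplex 1 1) X h \<and>
     (\<forall>a b. \<forall>z \<in> cells K a b. \<forall>w \<in> cells (bhorn 1 1) a b. h a b (z, w) = \<alpha> a b z) \<and>
     (\<forall>a b. \<forall>z \<in> cells K a b. h a b (z, origin a b) = \<beta> a b z)"
proof -
  have 1: "beq (K \<times>\<^sub>b bsimplex 0 1) (hface1 1 0 h) (via_proj \<alpha>) \<longleftrightarrow>
     (\<forall>a b. \<forall>z \<in> cells K a b. \<forall>t \<in> opmaps b 1. h a b (z, replicate (Suc a) 1, t) = \<alpha> a b z)"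
    by (auto simp: beq_def hface1_def via_proj_def opmaps_0 opcomp_coface_1[unfolded One_nat_def]
        simp del: replicate_Suc)
  have 2: "beq (K \<times>\<^sub>b bsimplex 1 0) (hface2 1 0 h) (via_proj \<alpha>) \<longleftrightarrow>
     (\<forall>a b. \<forall>z \<in> cells K a b. \<forall>s \<in> opmaps a 1. h a b (z, s, replicate (Suc b) 1) = \<alpha> a b z)"
    by (auto simp: beq_def hface2_def via_proj_def opmaps_0 opcomp_coface_1[unfolded One_nat_def]
        simp del: replicate_Suc)
  have 3: "beq (K \<times>\<^sub>b bsimplex 0 0) (hface1 1 1 (hface2 1 1 h)) (via_proj \<beta>) \<longleftrightarrow>
     (\<forall>a b. \<forall>z \<in> cells K a b. h a b (z, origin a b) = \<beta> a b z)"
    by (auto simp: beq_def hface1_def hface2_def via_proj_def opmaps_0 origin_def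
        opcomp_coface_1[unfolded One_nat_def] simp del: replicate_Suc)
  have 4: "(\<forall>a b. \<forall>z \<in> cells K a b. \<forall>w \<in> cells (bhorn 1 1) a b. h a b (z, w) = \<alpha> a b z) \<longleftrightarrow>
     (\<forall>a b. \<forall>z \<in> cells K a b. \<forall>t \<in> opmaps b 1. h a b (z, replicate (Suc a) 1, t) = \<alpha> a b z) \<and>
     (\<forall>a b. \<forall>z \<in> cells K a b. \<forall>s \<in> opmaps a 1. h a b (z, s, replicate (Suc b) 1) = \<alpha> a b z)"
    unfolding Ball_def cells_bhorn_1
    using opmaps_replicate[of 1 1] by (auto simp del: replicate_Suc cells_bhorn_iff)
  show ?thesis unfolding homotopy_def 1 2 3 4 by blast
qed

lemma hrel_iff:
  "(\<alpha>, \<beta>) \<in> hrel K L X x \<longleftrightarrow> \<alpha> \<in> rel_maps K L X x \<and> \<beta> \<in> rel_maps K L X x \<and>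
     (\<exists>h. bimap (K \<times>\<^sub>b bsimplex 1 1) X h \<and>
       (\<forall>a b. \<forall>z \<in> cells K a b. \<forall>w \<in> cells (bhorn 1 1) a b. h a b (z, w) = \<alpha> a b z) \<and>
       (\<forall>a b. \<forall>z \<in> cells K a b. h a b (z, origin a b) = \<beta> a b z) \<and>
       (\<forall>a b. \<forall>z \<in> cells L a b. \<forall>w \<in> cells (bsimplex 1 1) a b. h a b (z, w) = basecell X x a b))"
  unfolding hrel_def homotopy_iff by (auto simp: beq_def bconst_def simp del: cells_bsimplex cells_bhorn_iff)

lemma hrelI:
  assumes "\<alpha> \<in> rel_maps K L X x" "\<beta> \<in> rel_maps K L X x" "bimap (K \<times>\<^sub>b bsimplex 1 1) X h"
    and "\<And>a b z w. z \<in> cells K a b \<Longrightarrow> w \<in> cells (bhorn 1 1) a b \<Longrightarrow> h a b (z, w) = \<alpha> a b z"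
    and "\<And>a b z. z \<in> cells K a b \<Longrightarrow> h a b (z, origin a b) = \<beta> a b z"
    and "\<And>a b z w. z \<in> cells L a b \<Longrightarrow> w \<in> cells (bsimplex 1 1) a b \<Longrightarrow> h a b (z, w) = basecell X x a b"
  shows "(\<alpha>, \<beta>) \<in> hrel K L X x"
  unfolding hrel_iff using assms by blast

lemma hrelE:
  assumes "(\<alpha>, \<beta>) \<in> hrel K L X x"
  obtains h where "\<alpha> \<in> rel_maps K L X x" "\<beta> \<in> rel_maps K L X x" "bimap (K \<times>\<^sub>b bsimplex 1 1) X h"
    "\<And>a b z w. z \<in> cells K a b \<Longrightarrow> w \<in> cells (bhorn 1 1) a b \<Longrightarrow> h a b (z, w) = \<alpha> a b z"
    "\<And>a b z. z \<in> cells K a b \<Longrightarrow> h a b (z, origin a b) = \<beta> a b z"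
    "\<And>a b z w. z \<in> cells L a b \<Longrightarrow> w \<in> cells (bsimplex 1 1) a b \<Longrightarrow> h a b (z, w) = basecell X x a b"
proof -
  from assms have r: "\<alpha> \<in> rel_maps K L X x" "\<beta> \<in> rel_maps K L X x" by (simp_all add: hrel_iff)
  from assms obtain h where h: "bimap (K \<times>\<^sub>b bsimplex 1 1) X h \<and>
       (\<forall>a b. \<forall>z \<in> cells K a b. \<forall>w \<in> cells (bhorn 1 1) a b. h a b (z, w) = \<alpha> a b z) \<and>
       (\<forall>a b. \<forall>z \<in> cells K a b. h a b (z, origin a b) = \<beta> a b z) \<and>
       (\<forall>a b. \<forall>z \<in> cells L a b. \<forall>w \<in> cells (bsimplex 1 1) a b. h a b (z, w) = basecell X x a b)"
    unfolding hrel_iff by (elim conjE exE) (rule that, intro conjI)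
  show ?thesis by (rule that[OF r, of h]) (use h in \<open>simp_all del: cells_bsimplex cells_bhorn_iff One_nat_def\<close>)
qed

lemma rel_maps_iff:
  "f \<in> rel_maps K L X x \<longleftrightarrow> bimap K X f \<and> (\<forall>a b. \<forall>z \<in> cells L a b. f a b z = basecell X x a b)"
  by (simp add: rel_maps_def beq_def bconst_def)

lemma hrel_of_beq:
  assumes \<alpha>: "\<alpha> \<in> rel_maps K L X x" and \<beta>: "bimap K X \<beta>" and e: "beq K \<alpha> \<beta>" and L: "subcomplex L K"
  shows "(\<alpha>, \<beta>) \<in> hrel K L X x"
proof (rule hrelI[where h = "\<lambda>a b (z, w). \<alpha> a b z"])
  note LK = subcomplexD(4)[OF L]
  show "\<beta> \<in> rel_maps K L X x"
    using \<alpha> \<beta> e LK by (auto simp: rel_maps_iff beq_def)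
  show "bimap (K \<times>\<^sub>b bsimplex 1 1) X (\<lambda>a b (z, w). \<alpha> a b z)"
    using \<alpha> bisimplicial_set_bprod[OF _ bisimplicial_set_bsimplex]
    by (auto simp: rel_maps_iff bimap_def)
qed (use \<alpha> e in \<open>auto simp: rel_maps_iff beq_def\<close>)

text \<open>Fibrancy, in terms of the generating inclusions only.\<close>

definition kan :: "'x biset \<Rightarrow> bool" where
  "kan X \<longleftrightarrow> bifib X (bsimplex 0 0) (\<lambda>m n _. origin m n)"

lemma fibrant_kan: "fibrant X \<Longrightarrow> kan X"
  unfolding fibrant_def kan_def origin_def by (rule fibration_bifib)

lemma bimap_origin: "bisimplicial_set X \<Longrightarrow> bimap X (bsimplex 0 0) (\<lambda>m n _. origin m n)"
  by (rule bimapI) (auto simp: bisimplicial_set_bsimplex act_origin origin_cells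
      simp del: act_bsimplex cells_bsimplex)

lemma bsimplex_0_unique: "z \<in> cells (bsimplex 0 0) a b \<Longrightarrow> z = origin a b"
  by (cases z) (simp add: opmaps_0 origin_def)

lemma has_rlp_point_ext:
  assumes rlp: "has_rlp X (bsimplex 0 0) p A B bid" and u: "bimap A X u" and v: "bimap B (bsimplex 0 0) v"
    and AB: "subcomplex A B" and p: "bimap X (bsimplex 0 0) p"
  shows "\<exists>h. bimap B X h \<and> (\<forall>a b. \<forall>z \<in> cells A a b. h a b z = u a b z)"
proof -
  have "beq A (p \<circ>\<^sub>b u) (v \<circ>\<^sub>b bid)"
    unfolding beq_def bcomp_def bid_def
    using bsimplex_0_unique bimap_cells[OF v subcomplexD(4)[OF AB]] bimap_cells[OF p bimap_cells[OF u]]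
    by metis
  then show ?thesis using rlp u v unfolding has_rlp_def beq_def bcomp_def bid_def by metis
qed

lemma bifib_kan:
  assumes p: "bifib X Y p" and Y: "kan Y"
  shows "kan X"
  unfolding kan_def bifib_def
proof (intro conjI allI impI)
  have pm: "bimap X Y p" using p by (rule bifibD)
  then show "bimap X (bsimplex 0 0) (\<lambda>m n _. origin m n)" by (intro bimap_origin) (simp add: bimap_def)
  fix m n k l :: nat assume mn: "1 \<le> m" "1 \<le> n" "k \<le> m" "l \<le> n"
  let ?A = "boxbdry (\<Lambda> m k) (\<Delta> m) (\<Lambda> n l) (\<Delta> n)" and ?B = "\<Delta> m \<boxtimes> \<Delta> n"
  note pX = bifibD(2)[OF p mn] and pY = bifibD(2)[OF Y[unfolded kan_def] mn]
  show "has_rlp X (bsimplex 0 0) (\<lambda>m n _. origin m n) ?A ?B bid"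
  proof (rule has_rlp_inclI)
    fix u v assume u: "bimap ?A X u" and v: "bimap ?B (bsimplex 0 0) v"
    have ov: "origin a b = v a b z" if "z \<in> cells ?B a b" for a b z
      using bsimplex_0_unique[OF bimap_cells[OF v that]] by simp
    have AB: "subcomplex ?A ?B" by (rule subcomplex_boxbdry[OF ssub_horn ssub_horn])
    have om: "bimap Y (bsimplex 0 0) (\<lambda>m n _. origin m n)" using pm by (intro bimap_origin) (simp add: bimap_def)
    obtain w where w: "bimap ?B Y w" "\<forall>a b. \<forall>z \<in> cells ?A a b. w a b z = (p \<circ>\<^sub>b u) a b z"
      using has_rlp_point_ext[OF pY bimap_comp[OF u pm] v AB om] by (elim exE conjE)
    have pu: "\<forall>a b. \<forall>z \<in> cells ?A a b. p a b (u a b z) = w a b z"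
      using w(2) by (simp add: bcomp_def)
    obtain h where "bimap ?B X h" "\<forall>a b. \<forall>z \<in> cells ?A a b. h a b z = u a b z"
      using has_rlp_inclD[OF pX u w(1) pu] by (elim exE conjE)
    then show "\<exists>h. bimap ?B X h \<and> (\<forall>m n. \<forall>z \<in> cells ?A m n. h m n z = u m n z) \<and>
        (\<forall>m n. \<forall>z \<in> cells ?B m n. origin m n = v m n z)"
      using ov by blast
  qed
qed

lemma basecell_cells:
  "bisimplicial_set X \<Longrightarrow> x \<in> cells X 0 0 \<Longrightarrow> basecell X x a b \<in> cells X a b"
  unfolding basecell_def by (rule act_cells) (auto simp: opmaps_0)

lemma act_basecell:
  assumes "bisimplicial_set X" "x \<in> cells X 0 0" "f \<in> opmaps k a" "g \<in> opmaps l b"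
  shows "act X a b f g (basecell X x a b) = basecell X x k l"
  unfolding basecell_def
  using act_act[OF assms(1,2) _ _ assms(3,4)] opcomp_replicate[OF assms(3)] opcomp_replicate[OF assms(4)]
  by (simp add: opmaps_0 del: replicate_Suc)

lemma bimap_bconst:
  "bisimplicial_set A \<Longrightarrow> bisimplicial_set X \<Longrightarrow> x \<in> cells X 0 0 \<Longrightarrow> bimap A X (bconst X x)"
  by (rule bimapI) (auto simp: bconst_def basecell_cells act_basecell)

lemma bimap_basecell:
  assumes "bimap X Y p" "x \<in> cells X 0 0"
  shows "p a b (basecell X x a b) = basecell Y (p 0 0 x) a b"
  unfolding basecell_def by (rule bimap_act[OF assms]) (auto simp: opmaps_0)

lemma bisimplicial_set_fiber:
  assumes p: "bimap X Y p" and y: "y \<in> cells Y 0 0"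
  shows "bisimplicial_set (fiber X p Y y)"
proof -
  have X: "bisimplicial_set X" "bisimplicial_set Y" using p by (auto simp: bimap_def)
  have "subcomplex (fiber X p Y y) X"
    by (rule subcomplexI[OF X(1)])
       (auto simp: fiber_def act_cells[OF X(1)] bimap_act[OF p] act_basecell[OF X(2) y])
  then show ?thesis by (simp add: subcomplex_def)
qed

lemma kan_fiber:
  assumes p: "bifib X Y p" and y: "y \<in> cells Y 0 0"
  shows "kan (fiber X p Y y)"
  unfolding kan_def bifib_def
proof (intro conjI allI impI)
  let ?F = "fiber X p Y y"
  have pm: "bimap X Y p" using p by (rule bifibD)
  have Y: "bisimplicial_set Y" and X: "bisimplicial_set X" using pm by (auto simp: bimap_def)
  note F = bisimplicial_set_fiber[OF pm y]
  show "bimap ?F (bsimplex 0 0) (\<lambda>m n _. origin m n)" by (rule bimap_origin[OF F])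
  fix m n k l :: nat assume mn: "1 \<le> m" "1 \<le> n" "k \<le> m" "l \<le> n"
  let ?A = "boxbdry (\<Lambda> m k) (\<Delta> m) (\<Lambda> n l) (\<Delta> n)" and ?B = "\<Delta> m \<boxtimes> \<Delta> n"
  note pX = bifibD(2)[OF p mn]
  show "has_rlp ?F (bsimplex 0 0) (\<lambda>m n _. origin m n) ?A ?B bid"
  proof (rule has_rlp_inclI)
    fix u v assume u: "bimap ?A ?F u" and v: "bimap ?B (bsimplex 0 0) v"
    have uX: "bimap ?A X u" using u X unfolding bimap_def by (simp add: fiber_def)
    have "bimap ?B Y (bconst Y y)" using v Y y by (intro bimap_bconst) (auto simp: bimap_def)
    note Yy = this
    have pu: "\<forall>a b. \<forall>z \<in> cells ?A a b. p a b (u a b z) = bconst Y y a b z"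
      using bimap_cells[OF u] by (simp add: fiber_def bconst_def)
    obtain h where h: "bimap ?B X h" "\<forall>a b. \<forall>z \<in> cells ?A a b. h a b z = u a b z"
      "\<forall>a b. \<forall>z \<in> cells ?B a b. p a b (h a b z) = bconst Y y a b z"
      using has_rlp_inclD[OF pX uX Yy pu] by (elim exE conjE)
    have "bimap ?B ?F h"
      using h(1,3) F unfolding bimap_def by (simp add: fiber_def bconst_def)
    moreover have "origin a b = v a b z" if "z \<in> cells ?B a b" for a b z
      using bsimplex_0_unique[OF bimap_cells[OF v that]] by simp
    ultimately show "\<exists>h. bimap ?B ?F h \<and> (\<forall>m n. \<forall>z \<in> cells ?A m n. h m n z = u m n z) \<and>
        (\<forall>m n. \<forall>z \<in> cells ?B m n. origin m n = v m n z)"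
      using h(2) by blast
  qed
qed

text \<open>Homotopy is reflexive, and \<open>homotopy_compare\<close> over the point gives that \<open>\<alpha> \<sim> \<beta>\<close> and \<open>\<alpha> \<sim> \<gamma>\<close>
  imply \<open>\<beta> \<sim> \<gamma>\<close>.\<close>

lemma equiv_hrel:
  assumes X: "kan X" and L: "subcomplex L (bsimplex m n)"
  shows "equiv (rel_maps (bsimplex m n) L X x) (hrel (bsimplex m n) L X x)"
proof -
  let ?K = "bsimplex m n" and ?R = "rel_maps (bsimplex m n) L X x" and ?H = "hrel (bsimplex m n) L X x"
  have refl: "(\<alpha>, \<alpha>) \<in> ?H" if "\<alpha> \<in> ?R" for \<alpha>
    by (rule hrel_of_beq[OF that _ _ L]) (use that in \<open>auto simp: rel_maps_iff beq_def\<close>)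
  have euclid: "(\<beta>, \<gamma>) \<in> ?H" if h: "(\<alpha>, \<beta>) \<in> ?H" "(\<alpha>, \<gamma>) \<in> ?H" for \<alpha> \<beta> \<gamma>
  proof -
    obtain h1 where a: "\<alpha> \<in> ?R" "\<beta> \<in> ?R" and h1: "bimap (?K \<times>\<^sub>b bsimplex 1 1) X h1"
      "\<And>a b z w. z \<in> cells ?K a b \<Longrightarrow> w \<in> cells (bhorn 1 1) a b \<Longrightarrow> h1 a b (z, w) = \<alpha> a b z"
      "\<And>a b z. z \<in> cells ?K a b \<Longrightarrow> h1 a b (z, origin a b) = \<beta> a b z"
      "\<And>a b z w. z \<in> cells L a b \<Longrightarrow> w \<in> cells (bsimplex 1 1) a b \<Longrightarrow> h1 a b (z, w) = basecell X x a b"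
      by (rule hrelE[OF h(1)]) blast
    obtain h2 where c: "\<gamma> \<in> ?R" and h2: "bimap (?K \<times>\<^sub>b bsimplex 1 1) X h2"
      "\<And>a b z w. z \<in> cells ?K a b \<Longrightarrow> w \<in> cells (bhorn 1 1) a b \<Longrightarrow> h2 a b (z, w) = \<alpha> a b z"
      "\<And>a b z. z \<in> cells ?K a b \<Longrightarrow> h2 a b (z, origin a b) = \<gamma> a b z"
      "\<And>a b z w. z \<in> cells L a b \<Longrightarrow> w \<in> cells (bsimplex 1 1) a b \<Longrightarrow> h2 a b (z, w) = basecell X x a b"
      by (rule hrelE[OF h(2)]) blast
    have am: "bimap ?K X \<alpha>" using a by (simp add: rel_maps_iff)
    obtain g where g: "bimap (?K \<times>\<^sub>b bsimplex 1 1) X g"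
      "\<And>a b z w. z \<in> cells ?K a b \<Longrightarrow> w \<in> cells (bhorn 1 1) a b \<Longrightarrow> g a b (z, w) = h1 a b (z, origin a b)"
      "\<And>a b z. z \<in> cells ?K a b \<Longrightarrow> g a b (z, origin a b) = h2 a b (z, origin a b)"
      "\<And>a b z w. z \<in> cells L a b \<Longrightarrow> w \<in> cells (bsimplex 1 1) a b \<Longrightarrow> g a b (z, w) = h1 a b (z, origin a b)"
    proof (rule homotopy_compare[OF X[unfolded kan_def] L h1(1) h2(1) am])
      show "h1 a b (z, w) = \<alpha> a b z \<and> h2 a b (z, w) = \<alpha> a b z"
        if "z \<in> cells ?K a b" "w \<in> cells (bhorn 1 1) a b" for a b z w
        using h1(2) h2(2) that by blast
      show "h1 a b (z, w) = h2 a b (z, w)"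
        if "z \<in> cells L a b" "w \<in> cells (bsimplex 1 1) a b" for a b z w
        using h1(4)[OF that] h2(4)[OF that] by simp
    qed blast+
    show ?thesis
    proof (rule hrelI[OF a(2) c g(1)])
      show "g a b (z, w) = basecell X x a b" if "z \<in> cells L a b" "w \<in> cells (bsimplex 1 1) a b" for a b z w
        using g(4)[OF that] h1(4)[OF that(1) origin_cells] by simp
      show "g a b (z, w) = \<beta> a b z" if "z \<in> cells ?K a b" "w \<in> cells (bhorn 1 1) a b" for a b z w
        using g(2)[OF that] h1(3)[OF that(1)] by simp
      show "g a b (z, origin a b) = \<gamma> a b z" if "z \<in> cells ?K a b" for a b z
        using g(3)[OF that] h2(3)[OF that] by simp
    qed
  qed
  have sub: "?H \<subseteq> ?R \<times> ?R" by (auto simp: hrel_def)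
  have "sym ?H" using refl euclid sub by (intro symI) blast
  moreover from this have "trans ?H" using euclid by (intro transI) (metis symD)
  ultimately show ?thesis using refl sub by (auto simp: equiv_def refl_on_def)
qed

lemma equiv_symD: "equiv S r \<Longrightarrow> (a, b) \<in> r \<Longrightarrow> (b, a) \<in> r"
  by (auto elim: equivE dest: symD)

lemma equiv_transD: "equiv S r \<Longrightarrow> (a, b) \<in> r \<Longrightarrow> (b, c) \<in> r \<Longrightarrow> (a, c) \<in> r"
  by (auto elim: equivE dest: transD)

lemma equiv_reflD: "equiv S r \<Longrightarrow> a \<in> S \<Longrightarrow> (a, a) \<in> r"
  by (auto elim: equivE dest: refl_onD)

section \<open>Faces and cones\<close>

text \<open>From here on, the cells of the standard complexes are treated through membership facts.\<close>

declare One_nat_def [simp del] cells_bsimplex [simp del] act_bsimplex [simp del] cells_bhorn_iff [simp del]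
  cells_bbdry_iff [simp del] cells_bbdryA_iff [simp del]

lemma opmaps_Suc: "s \<in> opmaps a m \<longleftrightarrow> s \<in> opmaps a (Suc m) \<and> Suc m \<notin> set s"
  by (auto simp: opmaps_def) (metis atMost_iff le_Suc_eq subsetD)

text \<open>As simplices are lists of vertices, the last face of \<open>\<Delta>\<^bsup>m+1\<^esup>\<close> is literally \<open>\<Delta>\<^sup>m\<close>, and taking the
  last face of a map amounts to restricting it (\<open>face_last\<close>).\<close>

lemma subcomplex_bsimplex_Suc: "subcomplex (bsimplex m n) (bsimplex (Suc m) (Suc n))"
proof (rule subcomplexI[OF bisimplicial_set_bsimplex])
  show "act (bsimplex m n) = act (bsimplex (Suc m) (Suc n))"
    by (simp add: bsimplex_def box_def simplex_def)
  show "z \<in> cells (bsimplex (Suc m) (Suc n)) a b" if "z \<in> cells (bsimplex m n) a b" for a b z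
    using that by (auto simp: cells_bsimplex opmaps_Suc[of _ _ m] opmaps_Suc[of _ _ n])
qed (auto simp: cells_bsimplex act_bsimplex opcomp_opmaps)

lemma bhorn_Suc_bsimplex:
  "z \<in> cells (bsimplex m n) a b \<Longrightarrow>
   z \<in> cells (bhorn (Suc m) (Suc n)) a b \<longleftrightarrow> z \<in> cells (bbdry m n) a b"
  using subcomplexD(4)[OF subcomplex_bsimplex_Suc]
  by (auto simp: cells_bhorn_iff cells_bbdry_iff less_Suc_eq_le)

lemma bbdryA_Suc:
  "z \<in> cells (bbdryA (Suc m) (Suc n)) a b \<longleftrightarrow>
     z \<in> cells (bhorn (Suc m) (Suc n)) a b \<or> z \<in> cells (bsimplex m n) a b"
  by (cases z) (auto simp: cells_bbdryA_iff cells_bhorn_iff cells_bsimplex opmaps_Suc[of _ _ m]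
      opmaps_Suc[of _ _ n] le_Suc_eq less_Suc_eq_le)

lemma coface_last: "coface (Suc m) (Suc m) = opid m"
  by (auto simp: coface_def opid_def intro!: filter_True)

lemma face_last:
  assumes "z \<in> cells (bsimplex m n) a b"
  shows "face1 (Suc m) (Suc m) (face2 (Suc n) (Suc n) \<gamma>) a b z = \<gamma> a b z"
proof -
  obtain s t where z: "z = (s, t)" "s \<in> opmaps a m" "t \<in> opmaps b n"
    using assms by (cases z) (auto simp: cells_bsimplex)
  then show ?thesis
    using opcomp_id_left[OF z(2)] opcomp_id_left[OF z(3)] by (simp add: face1_def face2_def coface_last)
qed

text \<open>The contraction \<open>\<Delta>\<^sup>m \<times> \<Delta>\<^sup>1 \<rightarrow> \<Delta>\<^sup>m\<close> to the last vertex, sending \<open>(v, 0)\<close> to \<open>v\<close> and \<open>(v, 1)\<close> to \<open>m\<close>.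
  It preserves the faces containing \<open>m\<close>, hence the horn \<open>\<Lambda> m m\<close>.\<close>

definition cone :: "nat \<Rightarrow> nat list \<Rightarrow> nat list \<Rightarrow> nat list" where
  "cone m s t = map2 (\<lambda>v e. if e = 0 then v else m) s t"

lemma cone_nth: "s \<in> opmaps a m \<Longrightarrow> t \<in> opmaps a 1 \<Longrightarrow> i \<le> a \<Longrightarrow>
    cone m s t ! i = (if t ! i = 0 then s ! i else m)"
  by (simp add: cone_def opmaps_length)

lemma cone_opmaps:
  assumes "s \<in> opmaps a m" "t \<in> opmaps a 1"
  shows "cone m s t \<in> opmaps a m"
proof (rule opmapsI)
  show "length (cone m s t) = Suc a" using assms by (simp add: cone_def opmaps_length)
  show "cone m s t ! i \<le> cone m s t ! j" if "i \<le> j" "j \<le> a" for i j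
    using that opmaps_nth[OF assms(1)] opmaps_nth(2)[OF assms(2) that] by (auto simp: cone_nth[OF assms])
  show "cone m s t ! i \<le> m" if "i \<le> a" for i
    using that opmaps_nth(1)[OF assms(1)] by (auto simp: cone_nth[OF assms])
qed

lemma cone_opcomp:
  assumes "s \<in> opmaps a m" "t \<in> opmaps a 1" "f \<in> opmaps k a"
  shows "cone m (opcomp s f) (opcomp t f) = opcomp (cone m s t) f"
  using opmaps_nth(1)[OF assms(3)] assms
  by (intro nth_equalityI) (auto simp: cone_def opmaps_length less_Suc_eq_le)

lemma cone_zero: "s \<in> opmaps a m \<Longrightarrow> cone m s (replicate (Suc a) 0) = s"
  by (intro nth_equalityI) (auto simp: cone_def opmaps_length simp del: replicate_Suc)

lemma cone_one: "s \<in> opmaps a m \<Longrightarrow> cone m s (replicate (Suc a) 1) = replicate (Suc a) m"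
  by (intro nth_equalityI) (auto simp: cone_def opmaps_length simp del: replicate_Suc)

lemma set_cone: "set (cone m s t) \<subseteq> insert m (set s)"
  by (auto simp: cone_def split: if_splits dest: set_zip_leftD)

text \<open>The contraction in both directions at once.\<close>

definition bicone :: "nat \<Rightarrow> nat \<Rightarrow> (bisimp \<times> bisimp, bisimp) bfun" where
  "bicone m n = (\<lambda>a b (z, w). (cone m (fst z) (fst w), cone n (snd z) (snd w)))"

lemma bimap_bicone: "bimap (bsimplex m n \<times>\<^sub>b bsimplex 1 1) (bsimplex m n) (bicone m n)"
  by (rule bimapI)
     (auto simp: bicone_def bisimplicial_set_bprod bisimplicial_set_bsimplex cells_bsimplex act_bsimplex
        cone_opmaps cone_opcomp)

lemma bicone_bhorn1:
  assumes "z \<in> cells (bhorn m n) a b" "w \<in> cells (bsimplex 1 1) a b"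
  shows "bicone m n a b (z, w) \<in> cells (bhorn m n) a b"
  using assms set_cone[of m "fst z" "fst w"] set_cone[of n "snd z" "snd w"]
  by (cases z; cases w) (fastforce simp: bicone_def cells_bhorn_iff cells_bsimplex cone_opmaps)

lemma bicone_bhorn2:
  assumes "z \<in> cells (bsimplex m n) a b" "w \<in> cells (bhorn 1 1) a b" "1 \<le> m" "1 \<le> n"
  shows "bicone m n a b (z, w) \<in> cells (bhorn m n) a b"
proof -
  have z: "fst z \<in> opmaps a m" "snd z \<in> opmaps b n" using assms by (auto simp: cells_bsimplex)
  have w: "fst w \<in> opmaps a 1" "snd w \<in> opmaps b 1" "fst w = replicate (Suc a) 1 \<or> snd w = replicate (Suc b) 1"
    using assms by (auto simp: cells_bhorn_1 cells_bsimplex)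
  have "0 \<notin> set (cone m (fst z) (fst w)) \<or> 0 \<notin> set (cone n (snd z) (snd w))"
    using w(3) cone_one[OF z(1)] cone_one[OF z(2)] assms(3,4) by auto
  then show ?thesis
    using assms(3,4) z w by (auto simp: bicone_def cells_bhorn_iff cells_bsimplex cone_opmaps)
qed

lemma bicone_origin: "z \<in> cells (bsimplex m n) a b \<Longrightarrow> bicone m n a b (z, origin a b) = z"
  by (cases z) (simp add: bicone_def origin_def cells_bsimplex cone_zero del: replicate_Suc)

section \<open>Fiber sequences\<close>

lemma bimap_fiber_iff:
  assumes p: "bimap X Y p" and y: "y \<in> cells Y 0 0"
  shows "bimap A (fiber X p Y y) f \<longleftrightarrow>
    bimap A X f \<and> (\<forall>a b. \<forall>z \<in> cells A a b. p a b (f a b z) = basecell Y y a b)"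
  using bisimplicial_set_fiber[OF p y] p by (auto simp: bimap_def fiber_def)

lemma basecell_fiber [simp]: "basecell (fiber X p Y y) x = basecell X x"
  by (simp add: basecell_def fiber_def fun_eq_iff)

lemma rel_maps_fiber_iff:
  assumes p: "bimap X Y p" and y: "y \<in> cells Y 0 0"
  shows "f \<in> rel_maps K L (fiber X p Y y) x \<longleftrightarrow>
    f \<in> rel_maps K L X x \<and> (\<forall>a b. \<forall>z \<in> cells K a b. p a b (f a b z) = basecell Y y a b)"
  by (auto simp: rel_maps_iff bimap_fiber_iff[OF p y])

lemma rel_maps_comp:
  assumes "bimap X Y p" "x \<in> cells X 0 0" "p 0 0 x = y" "f \<in> rel_maps K L X x"
  shows "p \<circ>\<^sub>b f \<in> rel_maps K L Y y"
  using assms bimap_comp[OF _ assms(1)] bimap_basecell[OF assms(1,2)]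
  by (auto simp: rel_maps_iff) (simp add: bcomp_def)

lemma hrel_comp:
  assumes p: "bimap X Y p" "x \<in> cells X 0 0" "p 0 0 x = y" and h: "(f, g) \<in> hrel K L X x"
  shows "(p \<circ>\<^sub>b f, p \<circ>\<^sub>b g) \<in> hrel K L Y y"
proof -
  obtain h where fg: "f \<in> rel_maps K L X x" "g \<in> rel_maps K L X x" and
    h: "bimap (K \<times>\<^sub>b bsimplex 1 1) X h"
    "\<And>a b z w. z \<in> cells K a b \<Longrightarrow> w \<in> cells (bhorn 1 1) a b \<Longrightarrow> h a b (z, w) = f a b z"
    "\<And>a b z. z \<in> cells K a b \<Longrightarrow> h a b (z, origin a b) = g a b z"
    "\<And>a b z w. z \<in> cells L a b \<Longrightarrow> w \<in> cells (bsimplex 1 1) a b \<Longrightarrow> h a b (z, w) = basecell X x a b"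
    by (rule hrelE[OF h]) blast
  show ?thesis
    by (rule hrelI[OF rel_maps_comp[OF p fg(1)] rel_maps_comp[OF p fg(2)] bimap_comp[OF h(1) p(1)]])
       (use h(2-4) bimap_basecell[OF p(1,2)] p(3) in \<open>auto simp: bcomp_def\<close>)
qed

lemma bconst_rel_maps:
  "bisimplicial_set K \<Longrightarrow> bisimplicial_set X \<Longrightarrow> x \<in> cells X 0 0 \<Longrightarrow> bconst X x \<in> rel_maps K L X x"
  by (simp add: rel_maps_def bimap_bconst beq_def)

text \<open>In the following context, \<open>F\<close> is the fiber; its inclusion into \<open>X\<close> is \<open>bid\<close>.\<close>

context
  fixes X :: "'x biset" and Y :: "'y biset" and p x y
  assumes p: "bifib X Y p" and kX: "kan X" and kY: "kan Y" and x: "x \<in> cells X 0 0"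
    and y: "y \<in> cells Y 0 0" and pxy: "p 0 0 x = y"
begin

private abbreviation "F \<equiv> fiber X p Y y"

lemma fiber_sequence_facts:
  shows "bimap X Y p" and "bisimplicial_set X" and "bisimplicial_set Y"
    and "bisimplicial_set F" and "kan F" and "x \<in> cells F 0 0" and "bimap F X bid"
proof -
  show 1: "bimap X Y p" by (rule bifibD(1)[OF p])
  then show X: "bisimplicial_set X" and Y: "bisimplicial_set Y" by (auto simp: bimap_def)
  show F: "bisimplicial_set F" by (rule bisimplicial_set_fiber[OF 1 y])
  show "kan F" by (rule kan_fiber[OF p y])
  have "basecell Y y 0 0 = y" using act_id[OF Y y] by (simp add: basecell_def opid_def)
  then show "x \<in> cells F 0 0" using x pxy by (simp add: fiber_def)
  have "bimap F F bid" using F by (simp add: bimap_def bid_def)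
  then show "bimap F X bid" unfolding bimap_fiber_iff[OF 1 y] by blast
qed

private lemmas pm = fiber_sequence_facts(1)
private lemmas bX = fiber_sequence_facts(2)
private lemmas bY = fiber_sequence_facts(3)
private lemmas bF = fiber_sequence_facts(4)
private lemmas kF = fiber_sequence_facts(5)
private lemmas xF = fiber_sequence_facts(6)
private lemmas iF = fiber_sequence_facts(7)

lemma p_basecell: "p a b (basecell X x a b) = basecell Y y a b"
  using bimap_basecell[OF pm x] pxy by simp

text \<open>Exactness at the homotopy sets of \<open>X\<close>, for an arbitrary \<open>L\<close>. From left to right, a homotopy from
  \<open>p \<beta>\<close> to \<open>*\<close> is lifted with start \<open>\<beta>\<close>, relative to \<open>L\<close>; its end lies in the fiber.\<close>

lemma exact_at_total:
  assumes L: "subcomplex L (bsimplex m n)" and \<beta>: "\<beta> \<in> rel_maps (bsimplex m n) L X x"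
  shows "(p \<circ>\<^sub>b \<beta>, bconst Y y) \<in> hrel (bsimplex m n) L Y y \<longleftrightarrow>
    (\<exists>\<alpha> \<in> rel_maps (bsimplex m n) L F x. (bid \<circ>\<^sub>b \<alpha>, \<beta>) \<in> hrel (bsimplex m n) L X x)"
    (is "?l \<longleftrightarrow> ?r")
proof
  let ?K = "bsimplex m n"
  note eX = equiv_hrel[OF kX L, of x] and eY = equiv_hrel[OF kY L, of y]
  note bs = bisimplicial_set_bsimplex
  {
    assume ?l
    obtain h where r: "bconst Y y \<in> rel_maps ?K L Y y" and h: "bimap (?K \<times>\<^sub>b bsimplex 1 1) Y h"
    "\<And>a b z w. z \<in> cells ?K a b \<Longrightarrow> w \<in> cells (bhorn 1 1) a b \<Longrightarrow> h a b (z, w) = (p \<circ>\<^sub>b \<beta>) a b z"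
    "\<And>a b z. z \<in> cells ?K a b \<Longrightarrow> h a b (z, origin a b) = bconst Y y a b z"
    "\<And>a b z w. z \<in> cells L a b \<Longrightarrow> w \<in> cells (bsimplex 1 1) a b \<Longrightarrow> h a b (z, w) = basecell Y y a b"
      by (rule hrelE[OF \<open>?l\<close>]) blast
    have \<beta>': "bimap ?K X \<beta>" "\<And>a b z. z \<in> cells L a b \<Longrightarrow> \<beta> a b z = basecell X x a b"
      using \<beta> by (auto simp: rel_maps_iff)
    have Lc: "bimap (L \<times>\<^sub>b bsimplex 1 1) X (bconst X x)"
      by (intro bimap_bconst bisimplicial_set_bprod subcomplexD(1)[OF L] bs bX x)
    obtain H where H: "bimap (?K \<times>\<^sub>b bsimplex 1 1) X H"
      "\<And>a b z w. z \<in> cells L a b \<Longrightarrow> w \<in> cells (bsimplex 1 1) a b \<Longrightarrow> H a b (z, w) = bconst X x a b (z, w)"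
      "\<And>a b z w. z \<in> cells ?K a b \<Longrightarrow> w \<in> cells (bhorn 1 1) a b \<Longrightarrow> H a b (z, w) = \<beta> a b z"
      "\<And>a b z w. z \<in> cells ?K a b \<Longrightarrow> w \<in> cells (bsimplex 1 1) a b \<Longrightarrow> p a b (H a b (z, w)) = h a b (z, w)"
    proof (rule homotopy_lifting[OF p regular_bsimplex L \<beta>'(1) Lc h(1)])
      show "bconst X x a b (z, w) = \<beta> a b z" if "z \<in> cells L a b" "w \<in> cells (bhorn 1 1) a b" for a b z w
        using \<beta>'(2)[OF that(1)] by (simp add: bconst_def)
      show "p a b (bconst X x a b (z, w)) = h a b (z, w)"
        if "z \<in> cells L a b" "w \<in> cells (bsimplex 1 1) a b" for a b z w
        using h(4)[OF that] p_basecell by (simp add: bconst_def)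
      show "p a b (\<beta> a b z) = h a b (z, w)" if "z \<in> cells ?K a b" "w \<in> cells (bhorn 1 1) a b" for a b z w
        using h(2)[OF that] by (simp add: bcomp_def)
    qed blast
    let ?\<alpha> = "\<lambda>a b z. H a b (z, origin a b)"
    have \<alpha>X: "?\<alpha> \<in> rel_maps ?K L X x"
      using bimap_slice[OF H(1) bs] H(2)[OF _ origin_cells] by (auto simp: rel_maps_iff bconst_def)
    have "?\<alpha> \<in> rel_maps ?K L F x"
      using \<alpha>X H(4)[OF _ origin_cells] h(3) by (simp add: rel_maps_fiber_iff[OF pm y] bconst_def)
    moreover have "(\<beta>, ?\<alpha>) \<in> hrel ?K L X x"
      by (rule hrelI[OF \<beta> \<alpha>X H(1)]) (use H(2,3) in \<open>auto simp: bconst_def\<close>)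
    then have "(bid \<circ>\<^sub>b ?\<alpha>, \<beta>) \<in> hrel ?K L X x"
      using equiv_symD[OF eX] by (simp add: bcomp_def bid_def)
    ultimately show ?r by blast
  next
    assume ?r
    then obtain \<alpha> where \<alpha>: "\<alpha> \<in> rel_maps ?K L F x" "(bid \<circ>\<^sub>b \<alpha>, \<beta>) \<in> hrel ?K L X x" by blast
    have 1: "(p \<circ>\<^sub>b (bid \<circ>\<^sub>b \<alpha>), p \<circ>\<^sub>b \<beta>) \<in> hrel ?K L Y y" by (rule hrel_comp[OF pm x pxy \<alpha>(2)])
    have "(bconst Y y, p \<circ>\<^sub>b (bid \<circ>\<^sub>b \<alpha>)) \<in> hrel ?K L Y y"
    proof (rule hrel_of_beq[OF bconst_rel_maps[OF bs bY y] _ _ L])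
      show "bimap ?K Y (p \<circ>\<^sub>b (bid \<circ>\<^sub>b \<alpha>))"
        using \<alpha>(1) by (intro bimap_comp[OF bimap_comp[OF _ iF] pm]) (simp add: rel_maps_iff)
      show "beq ?K (bconst Y y) (p \<circ>\<^sub>b (bid \<circ>\<^sub>b \<alpha>))"
        using \<alpha>(1) by (simp add: rel_maps_fiber_iff[OF pm y] beq_def bcomp_def bid_def bconst_def)
    qed
    then show ?l using 1 by (rule equiv_symD[OF eY equiv_transD[OF eY]])
  }
qed

subsection \<open>The connecting map\<close>

text \<open>The maps \<open>\<alpha>\<close> to \<open>Y\<close> live on \<open>K = \<Delta>\<^bsup>m+1,n+1\<^esup>\<close>, relative to \<open>A\<close>, and their lifts are \<open>*\<close> on the horn
  \<open>H\<close>. The face of \<open>K\<close> to which the lifts are restricted is \<open>J\<close>, with boundary \<open>B\<close>; thus \<open>A = H \<union> J\<close>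
  and \<open>B = H \<inter> J\<close>.\<close>

context
  fixes m n :: nat
begin

private abbreviation "K \<equiv> bsimplex (Suc m) (Suc n)"
private abbreviation "J \<equiv> bsimplex m n"
private abbreviation "H \<equiv> bhorn (Suc m) (Suc n)"
private abbreviation "A \<equiv> bbdryA (Suc m) (Suc n)"
private abbreviation "B \<equiv> bbdry m n"
private abbreviation "lifts \<equiv> horn_lifts (Suc m) (Suc n) X x p"

lemma lifts_iff:
  "\<gamma> \<in> lifts \<alpha> \<longleftrightarrow> bimap K X \<gamma> \<and> (\<forall>a b. \<forall>z \<in> cells K a b. p a b (\<gamma> a b z) = \<alpha> a b z) \<and>
     (\<forall>a b. \<forall>z \<in> cells H a b. \<gamma> a b z = basecell X x a b)"
  by (simp add: horn_lifts_def beq_def bcomp_def bconst_def)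

lemma lifts_exist:
  assumes "\<alpha> \<in> rel_maps K A Y y"
  shows "\<exists>\<gamma>. \<gamma> \<in> lifts \<alpha>"
proof -
  have a: "bimap K Y \<alpha>" "\<And>a b z. z \<in> cells H a b \<Longrightarrow> \<alpha> a b z = basecell Y y a b"
    using assms by (auto simp: rel_maps_iff bbdryA_Suc)
  have "has_rlp X Y p H K bid"
    using bifibD(2)[OF p, of "Suc m" "Suc n" "Suc m" "Suc n"]
    by (simp add: bhorn_def bsimplex_def boxbdry_def)
  moreover have "bimap H X (bconst X x)"
    by (rule bimap_bconst[OF subcomplexD(1)[OF subcomplex_bhorn] bX x])
  moreover have "\<forall>a b. \<forall>z \<in> cells H a b. p a b (bconst X x a b z) = \<alpha> a b z"
    using a(2) p_basecell by (simp add: bconst_def)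
  ultimately show ?thesis using has_rlp_inclD[OF _ _ a(1)] unfolding lifts_iff bconst_def by blast
qed

lemma lifts_fiber:
  assumes "\<alpha> \<in> rel_maps K A Y y" "\<gamma> \<in> lifts \<alpha>"
  shows "\<gamma> \<in> rel_maps J B F x"
proof -
  have JK: "z \<in> cells K a b" if "z \<in> cells J a b" for z a b
    by (rule subcomplexD(4)[OF subcomplex_bsimplex_Suc that])
  have "\<gamma> \<in> rel_maps J B X x"
    using assms(2) bimap_subcomplex[OF _ subcomplex_bsimplex_Suc] bhorn_Suc_bsimplex
      subcomplexD(4)[OF subcomplex_bbdry] by (auto simp: rel_maps_iff lifts_iff)
  moreover have "p a b (\<gamma> a b z) = basecell Y y a b" if "z \<in> cells J a b" for a b z
    using assms JK[OF that] that by (simp add: lifts_iff rel_maps_iff bbdryA_Suc)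
  ultimately show ?thesis by (simp add: rel_maps_fiber_iff[OF pm y])
qed

text \<open>With the contraction \<open>c\<close> to the last vertex, \<open>\<gamma> \<circ> c\<close> and \<open>\<gamma>' \<circ> c\<close> are homotopies from \<open>*\<close> to
  \<open>\<gamma>\<close> and \<open>\<gamma>'\<close>, which agree on \<open>H\<close> and have the same image \<open>\<alpha> \<circ> c\<close> in \<open>Y\<close>.\<close>

lemma lifts_unique:
  assumes \<alpha>: "\<alpha> \<in> rel_maps K A Y y" and g: "\<gamma> \<in> lifts \<alpha>" "\<gamma>' \<in> lifts \<alpha>"
  shows "(\<gamma>, \<gamma>') \<in> hrel J B F x"
proof -
  let ?c = "bicone (Suc m) (Suc n)"
  have c: "bimap (K \<times>\<^sub>b bsimplex 1 1) X (\<delta> \<circ>\<^sub>b ?c)" if "\<delta> \<in> lifts \<alpha>" for \<delta>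
    by (rule bimap_comp[OF bimap_bicone]) (use that in \<open>simp add: lifts_iff\<close>)
  have JK: "z \<in> cells K a b" if "z \<in> cells J a b" for z a b
    by (rule subcomplexD(4)[OF subcomplex_bsimplex_Suc that])
  have ck: "?c a b (z, w) \<in> cells K a b" if "z \<in> cells K a b" "w \<in> cells (bsimplex 1 1) a b" for a b z w
    using bimap_cells[OF bimap_bicone, of "(z, w)"] that by simp
  obtain h where h: "bimap (K \<times>\<^sub>b bsimplex 1 1) X h"
    "\<And>a b z w. z \<in> cells K a b \<Longrightarrow> w \<in> cells (bhorn 1 1) a b \<Longrightarrow> h a b (z, w) = (\<gamma> \<circ>\<^sub>b ?c) a b (z, origin a b)"
    "\<And>a b z. z \<in> cells K a b \<Longrightarrow> h a b (z, origin a b) = (\<gamma>' \<circ>\<^sub>b ?c) a b (z, origin a b)"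
    "\<And>a b z w. z \<in> cells H a b \<Longrightarrow> w \<in> cells (bsimplex 1 1) a b \<Longrightarrow> h a b (z, w) = (\<gamma> \<circ>\<^sub>b ?c) a b (z, origin a b)"
    "\<And>a b z w. z \<in> cells K a b \<Longrightarrow> w \<in> cells (bsimplex 1 1) a b \<Longrightarrow>
      p a b (h a b (z, w)) = p a b ((\<gamma> \<circ>\<^sub>b ?c) a b (z, origin a b))"
  proof (rule homotopy_compare[OF p subcomplex_bhorn c[OF g(1)] c[OF g(2)] bimap_bconst[OF bisimplicial_set_bsimplex bX x]])
    show "(\<gamma> \<circ>\<^sub>b ?c) a b (z, w) = bconst X x a b z \<and> (\<gamma>' \<circ>\<^sub>b ?c) a b (z, w) = bconst X x a b z"
      if "z \<in> cells K a b" "w \<in> cells (bhorn 1 1) a b" for a b z w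
      using bicone_bhorn2[OF that] g by (simp add: bcomp_def bconst_def lifts_iff)
    show "(\<gamma> \<circ>\<^sub>b ?c) a b (z, w) = (\<gamma>' \<circ>\<^sub>b ?c) a b (z, w)"
      if "z \<in> cells H a b" "w \<in> cells (bsimplex 1 1) a b" for a b z w
      using bicone_bhorn1[OF that] g by (simp add: bcomp_def lifts_iff)
    show "p a b ((\<gamma> \<circ>\<^sub>b ?c) a b (z, w)) = p a b ((\<gamma>' \<circ>\<^sub>b ?c) a b (z, w))"
      if "z \<in> cells K a b" "w \<in> cells (bsimplex 1 1) a b" for a b z w
      using ck[OF that] g by (simp add: bcomp_def lifts_iff)
  qed blast
  have hJ: "bimap (J \<times>\<^sub>b bsimplex 1 1) X h"
    by (rule bimap_subcomplex[OF h(1)])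
       (intro subcomplex_bprod subcomplex_bsimplex_Suc subcomplex_refl bisimplicial_set_bsimplex)
  show ?thesis
  proof (rule hrelI[OF lifts_fiber[OF \<alpha> g(1)] lifts_fiber[OF \<alpha> g(2)]])
    show "bimap (J \<times>\<^sub>b bsimplex 1 1) F h"
      unfolding bimap_fiber_iff[OF pm y]
    proof (intro conjI allI ballI hJ)
      fix a b zw assume "zw \<in> cells (J \<times>\<^sub>b bsimplex 1 1) a b"
      then obtain z w where zw: "zw = (z, w)" "z \<in> cells J a b" "w \<in> cells (bsimplex 1 1) a b" by auto
      note zK = JK[OF zw(2)]
      have "p a b (h a b zw) = \<alpha> a b z"
        using h(5)[OF zK zw(3)] bicone_origin[OF zK] g(1) zK by (simp add: zw(1) bcomp_def lifts_iff)
      then show "p a b (h a b zw) = basecell Y y a b"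
        using \<alpha> zw(2) by (simp add: rel_maps_iff bbdryA_Suc)
    qed
    show "h a b (z, w) = \<gamma> a b z" if "z \<in> cells J a b" "w \<in> cells (bhorn 1 1) a b" for a b z w
      using h(2)[OF JK[OF that(1)] that(2)] bicone_origin[OF JK[OF that(1)]] by (simp add: bcomp_def)
    show "h a b (z, origin a b) = \<gamma>' a b z" if "z \<in> cells J a b" for a b z
      using h(3)[OF JK[OF that]] bicone_origin[OF JK[OF that]] by (simp add: bcomp_def)
    show "h a b (z, w) = basecell F x a b" if "z \<in> cells B a b" "w \<in> cells (bsimplex 1 1) a b" for a b z w
    proof -
      have z: "z \<in> cells J a b" "z \<in> cells H a b"
        using subcomplexD(4)[OF subcomplex_bbdry that(1)] bhorn_Suc_bsimplex that(1) by auto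
      show ?thesis using h(4)[OF z(2) that(2)] bicone_origin[OF JK[OF z(1)]] g(1) z(2)
        by (simp add: bcomp_def lifts_iff)
    qed
  qed
qed

text \<open>The connecting map is well defined on classes: a homotopy from \<open>\<alpha>\<close> to \<open>\<alpha>'\<close> lifts to one from \<open>\<gamma>\<close>
  to some lift of \<open>\<alpha>'\<close>, relative to \<open>H\<close>, and on \<open>J\<close> it stays in the fiber.\<close>

lemma lifts_hrel:
  assumes h: "(\<alpha>, \<alpha>') \<in> hrel K A Y y" and g: "\<gamma> \<in> lifts \<alpha>" "\<gamma>' \<in> lifts \<alpha>'"
  shows "(\<gamma>, \<gamma>') \<in> hrel J B F x"
proof -
  have JK: "z \<in> cells K a b" if "z \<in> cells J a b" for z a b
    by (rule subcomplexD(4)[OF subcomplex_bsimplex_Suc that])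
  have HK: "z \<in> cells K a b" if "z \<in> cells H a b" for z a b
    by (rule subcomplexD(4)[OF subcomplex_bhorn that])
  obtain k where \<alpha>: "\<alpha> \<in> rel_maps K A Y y" "\<alpha>' \<in> rel_maps K A Y y"
    and k: "bimap (K \<times>\<^sub>b bsimplex 1 1) Y k"
    "\<And>a b z w. z \<in> cells K a b \<Longrightarrow> w \<in> cells (bhorn 1 1) a b \<Longrightarrow> k a b (z, w) = \<alpha> a b z"
    "\<And>a b z. z \<in> cells K a b \<Longrightarrow> k a b (z, origin a b) = \<alpha>' a b z"
    "\<And>a b z w. z \<in> cells A a b \<Longrightarrow> w \<in> cells (bsimplex 1 1) a b \<Longrightarrow> k a b (z, w) = basecell Y y a b"
    by (rule hrelE[OF h]) blast
  have \<gamma>: "bimap K X \<gamma>" "\<And>a b z. z \<in> cells K a b \<Longrightarrow> p a b (\<gamma> a b z) = \<alpha> a b z"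
    "\<And>a b z. z \<in> cells H a b \<Longrightarrow> \<gamma> a b z = basecell X x a b"
    using g(1) by (auto simp: lifts_iff)
  have Hc: "bimap (H \<times>\<^sub>b bsimplex 1 1) X (bconst X x)"
    by (intro bimap_bconst bisimplicial_set_bprod subcomplexD(1)[OF subcomplex_bhorn]
        bisimplicial_set_bsimplex bX x)
  obtain G where G: "bimap (K \<times>\<^sub>b bsimplex 1 1) X G"
    "\<And>a b z w. z \<in> cells H a b \<Longrightarrow> w \<in> cells (bsimplex 1 1) a b \<Longrightarrow> G a b (z, w) = bconst X x a b (z, w)"
    "\<And>a b z w. z \<in> cells K a b \<Longrightarrow> w \<in> cells (bhorn 1 1) a b \<Longrightarrow> G a b (z, w) = \<gamma> a b z"
    "\<And>a b z w. z \<in> cells K a b \<Longrightarrow> w \<in> cells (bsimplex 1 1) a b \<Longrightarrow> p a b (G a b (z, w)) = k a b (z, w)"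
  proof (rule homotopy_lifting[OF p regular_bsimplex subcomplex_bhorn \<gamma>(1) Hc k(1)])
    show "bconst X x a b (z, w) = \<gamma> a b z" if "z \<in> cells H a b" "w \<in> cells (bhorn 1 1) a b" for a b z w
      using \<gamma>(3)[OF that(1)] by (simp add: bconst_def)
    show "p a b (bconst X x a b (z, w)) = k a b (z, w)"
      if "z \<in> cells H a b" "w \<in> cells (bsimplex 1 1) a b" for a b z w
      using k(4)[OF _ that(2), of z] that p_basecell by (simp add: bconst_def bbdryA_Suc)
    show "p a b (\<gamma> a b z) = k a b (z, w)" if "z \<in> cells K a b" "w \<in> cells (bhorn 1 1) a b" for a b z w
      using k(2)[OF that] \<gamma>(2)[OF that(1)] by simp
  qed blast
  let ?d = "\<lambda>a b z. G a b (z, origin a b)"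
  have d: "?d \<in> lifts \<alpha>'"
    unfolding lifts_iff
  proof (intro conjI allI ballI)
    show "bimap K X ?d" by (rule bimap_slice[OF G(1) bisimplicial_set_bsimplex])
    show "p a b (G a b (z, origin a b)) = \<alpha>' a b z" if "z \<in> cells K a b" for a b z
      using G(4)[OF that origin_cells] k(3)[OF that] by simp
    show "G a b (z, origin a b) = basecell X x a b" if "z \<in> cells H a b" for a b z
      using G(2)[OF that origin_cells] by (simp add: bconst_def)
  qed
  have GJ: "bimap (J \<times>\<^sub>b bsimplex 1 1) X G"
    by (rule bimap_subcomplex[OF G(1)])
       (intro subcomplex_bprod subcomplex_bsimplex_Suc subcomplex_refl bisimplicial_set_bsimplex)
  have "(\<gamma>, ?d) \<in> hrel J B F x"
  proof (rule hrelI[OF lifts_fiber[OF \<alpha>(1) g(1)] lifts_fiber[OF \<alpha>(2) d]])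
    show "bimap (J \<times>\<^sub>b bsimplex 1 1) F G"
      unfolding bimap_fiber_iff[OF pm y]
    proof (intro conjI allI ballI GJ)
      fix a b zw assume "zw \<in> cells (J \<times>\<^sub>b bsimplex 1 1) a b"
      then obtain z w where zw: "zw = (z, w)" "z \<in> cells J a b" "w \<in> cells (bsimplex 1 1) a b" by auto
      show "p a b (G a b zw) = basecell Y y a b"
        using G(4)[OF JK[OF zw(2)] zw(3)] k(4)[OF _ zw(3), of z] zw(2) by (simp add: zw(1) bbdryA_Suc)
    qed
    show "G a b (z, w) = \<gamma> a b z" if "z \<in> cells J a b" "w \<in> cells (bhorn 1 1) a b" for a b z w
      by (rule G(3)[OF JK[OF that(1)] that(2)])
    show "G a b (z, w) = basecell F x a b" if "z \<in> cells B a b" "w \<in> cells (bsimplex 1 1) a b" for a b z w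
      using G(2)[OF _ that(2), of z] subcomplexD(4)[OF subcomplex_bbdry that(1)] bhorn_Suc_bsimplex that(1)
      by (simp add: bconst_def)
  qed simp
  moreover have "(?d, \<gamma>') \<in> hrel J B F x" by (rule lifts_unique[OF \<alpha>(2) d g(2)])
  ultimately show ?thesis
    by (rule equiv_transD[OF equiv_hrel[OF kF subcomplex_bbdry]])
qed

text \<open>A homotopy on the face \<open>J\<close> is extended by \<open>*\<close> to \<open>A = H \<union> J\<close> and then, over a given homotopy \<open>v\<close>
  and with given start \<open>\<gamma>\<close>, to all of \<open>K\<close>; \<open>\<delta>\<close> is the end of the extension. This is used for
  \<open>q = p\<close> and for the map \<open>q\<close> from \<open>X\<close> to the point.\<close>

lemma extend_face_homotopy:
  assumes q: "bifib X Z q" and g: "bimap K X \<gamma>"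
    "\<And>a b z. z \<in> cells H a b \<Longrightarrow> \<gamma> a b z = basecell X x a b"
    and h: "bimap (J \<times>\<^sub>b bsimplex 1 1) X h"
    "\<And>a b z w. z \<in> cells J a b \<Longrightarrow> w \<in> cells (bhorn 1 1) a b \<Longrightarrow> h a b (z, w) = \<gamma> a b z"
    "\<And>a b z w. z \<in> cells B a b \<Longrightarrow> w \<in> cells (bsimplex 1 1) a b \<Longrightarrow> h a b (z, w) = basecell X x a b"
    and v: "bimap (K \<times>\<^sub>b bsimplex 1 1) Z v"
    "\<And>a b z w. z \<in> cells J a b \<Longrightarrow> w \<in> cells (bsimplex 1 1) a b \<Longrightarrow> q a b (h a b (z, w)) = v a b (z, w)"
    "\<And>a b z w. z \<in> cells H a b \<Longrightarrow> w \<in> cells (bsimplex 1 1) a b \<Longrightarrow> q a b (basecell X x a b) = v a b (z, w)"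
    "\<And>a b z w. z \<in> cells K a b \<Longrightarrow> w \<in> cells (bhorn 1 1) a b \<Longrightarrow> q a b (\<gamma> a b z) = v a b (z, w)"
  obtains \<delta> where "bimap K X \<delta>"
    "\<And>a b z. z \<in> cells H a b \<Longrightarrow> \<delta> a b z = basecell X x a b"
    "\<And>a b z. z \<in> cells J a b \<Longrightarrow> \<delta> a b z = h a b (z, origin a b)"
    "\<And>a b z. z \<in> cells K a b \<Longrightarrow> q a b (\<delta> a b z) = v a b (z, origin a b)"
proof -
  note bs = bisimplicial_set_bsimplex
  let ?D = "bsimplex 1 1"
  let ?g = "\<lambda>a b (z, w). if z \<in> cells J a b then h a b (z, w) else basecell X x a b"
  have HB: "z \<in> cells B a b" if "z \<in> cells H a b" "z \<in> cells J a b" for z a b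
    using bhorn_Suc_bsimplex that by blast
  have gH: "?g a b (z, w) = basecell X x a b" if "z \<in> cells H a b" "w \<in> cells ?D a b" for a b z w
    using that h(3)[OF HB] by auto
  have g1: "bimap (J \<times>\<^sub>b ?D) X ?g" by (rule bimap_cong[OF h(1)]) auto
  have "bimap (H \<times>\<^sub>b ?D) X (bconst X x)"
    by (intro bimap_bconst bisimplicial_set_bprod subcomplexD(1)[OF subcomplex_bhorn] bs bX x)
  then have g2: "bimap (H \<times>\<^sub>b ?D) X ?g"
    by (rule bimap_cong) (use gH in \<open>auto simp: bconst_def\<close>)
  have sub: "subcomplex (A \<times>\<^sub>b ?D) (K \<times>\<^sub>b ?D)" "subcomplex (J \<times>\<^sub>b ?D) (K \<times>\<^sub>b ?D)"
    "subcomplex (H \<times>\<^sub>b ?D) (K \<times>\<^sub>b ?D)"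
    by (intro subcomplex_bprod subcomplex_bbdryA subcomplex_bhorn subcomplex_bsimplex_Suc subcomplex_refl bs)+
  have gA: "bimap (A \<times>\<^sub>b ?D) X ?g"
  proof (rule bimap_cover[OF subcomplexD(1)[OF sub(1)] bX])
    fix a b z assume "z \<in> cells (A \<times>\<^sub>b ?D) a b"
    then have "z \<in> cells (J \<times>\<^sub>b ?D) a b \<or> z \<in> cells (H \<times>\<^sub>b ?D) a b" by (auto simp: bbdryA_Suc)
    moreover have "act (J \<times>\<^sub>b ?D) = act (A \<times>\<^sub>b ?D)" "act (H \<times>\<^sub>b ?D) = act (A \<times>\<^sub>b ?D)"
      unfolding subcomplexD(3)[OF sub(1)] subcomplexD(3)[OF sub(2)] subcomplexD(3)[OF sub(3)] by (rule refl)+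
    ultimately show "\<exists>T. act T = act (A \<times>\<^sub>b ?D) \<and> z \<in> cells T a b \<and> bimap T X ?g"
      using g1 g2 by blast
  qed
  obtain G where G: "bimap (K \<times>\<^sub>b ?D) X G"
    "\<And>a b z w. z \<in> cells A a b \<Longrightarrow> w \<in> cells ?D a b \<Longrightarrow> G a b (z, w) = ?g a b (z, w)"
    "\<And>a b z w. z \<in> cells K a b \<Longrightarrow> w \<in> cells ?D a b \<Longrightarrow> q a b (G a b (z, w)) = v a b (z, w)"
  proof (rule homotopy_lifting[OF q regular_bsimplex subcomplex_bbdryA g(1) gA v(1)])
    show "?g a b (z, w) = \<gamma> a b z" if "z \<in> cells A a b" "w \<in> cells (bhorn 1 1) a b" for a b z w
      using that h(2)[of z a b w] g(2)[of z a b] by (auto simp: bbdryA_Suc)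
    show "q a b (?g a b (z, w)) = v a b (z, w)" if "z \<in> cells A a b" "w \<in> cells ?D a b" for a b z w
      using that v(2)[of z a b w] v(3)[of z a b w] by (auto simp: bbdryA_Suc)
    show "q a b (\<gamma> a b z) = v a b (z, w)" if "z \<in> cells K a b" "w \<in> cells (bhorn 1 1) a b" for a b z w
      by (rule v(4)[OF that])
  qed blast
  show ?thesis
  proof (rule that)
    show "bimap K X (\<lambda>a b z. G a b (z, origin a b))" by (rule bimap_slice[OF G(1) bs])
    show "G a b (z, origin a b) = basecell X x a b" if "z \<in> cells H a b" for a b z
      using G(2)[OF _ origin_cells, of z] gH[OF that origin_cells] that by (simp add: bbdryA_Suc)
    show "G a b (z, origin a b) = h a b (z, origin a b)" if "z \<in> cells J a b" for a b z
      using G(2)[OF _ origin_cells, of z] that by (simp add: bbdryA_Suc)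
    show "q a b (G a b (z, origin a b)) = v a b (z, origin a b)" if "z \<in> cells K a b" for a b z
      by (rule G(3)[OF that origin_cells])
  qed
qed

text \<open>A chosen lift; its restriction to \<open>J\<close> represents the image under the connecting map.\<close>

definition horn_lift :: "(bisimp, 'y) bfun \<Rightarrow> (bisimp, 'x) bfun" where
  "horn_lift \<alpha> = (SOME \<gamma>. \<gamma> \<in> lifts \<alpha>)"

lemma horn_lift: "\<alpha> \<in> rel_maps K A Y y \<Longrightarrow> horn_lift \<alpha> \<in> lifts \<alpha>"
  unfolding horn_lift_def by (rule someI_ex[OF lifts_exist])

text \<open>From left to right, a homotopy in the fiber from the face of a lift of \<open>\<alpha>\<close> to \<open>*\<close> is extended to
  one that starts at the lift and lies over the constant homotopy of \<open>\<alpha>\<close>; its end \<open>\<xi>\<close> is \<open>*\<close> on all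
  of \<open>A\<close> and is mapped to \<open>\<alpha>\<close>. Conversely, \<open>\<xi>\<close> is itself a lift of \<open>p \<xi>\<close>.\<close>

lemma exact_at_piA_of_base:
  assumes \<alpha>: "\<alpha> \<in> rel_maps K A Y y"
  shows "(horn_lift \<alpha>, bconst F x) \<in> hrel J B F x \<longleftrightarrow>
    (\<exists>\<xi> \<in> rel_maps K A X x. (p \<circ>\<^sub>b \<xi>, \<alpha>) \<in> hrel K A Y y)" (is "?l \<longleftrightarrow> ?r")
proof
  note bs = bisimplicial_set_bsimplex
  have JK: "z \<in> cells K a b" if "z \<in> cells J a b" for z a b
    by (rule subcomplexD(4)[OF subcomplex_bsimplex_Suc that])
  {
    assume ?l
    have HK: "z \<in> cells K a b" if "z \<in> cells H a b" for z a b
      by (rule subcomplexD(4)[OF subcomplex_bhorn that])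
    have BW: "w \<in> cells (bsimplex 1 1) a b" if "w \<in> cells (bhorn 1 1) a b" for w a b
      by (rule subcomplexD(4)[OF subcomplex_bhorn that])
    obtain h where h: "bimap (J \<times>\<^sub>b bsimplex 1 1) F h"
      "\<And>a b z w. z \<in> cells J a b \<Longrightarrow> w \<in> cells (bhorn 1 1) a b \<Longrightarrow> h a b (z, w) = horn_lift \<alpha> a b z"
      "\<And>a b z. z \<in> cells J a b \<Longrightarrow> h a b (z, origin a b) = bconst F x a b z"
      "\<And>a b z w. z \<in> cells B a b \<Longrightarrow> w \<in> cells (bsimplex 1 1) a b \<Longrightarrow> h a b (z, w) = basecell F x a b"
      by (rule hrelE[OF \<open>?l\<close>]) blast
    have hX: "bimap (J \<times>\<^sub>b bsimplex 1 1) X h"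
      "\<And>a b z w. z \<in> cells J a b \<Longrightarrow> w \<in> cells (bsimplex 1 1) a b \<Longrightarrow> p a b (h a b (z, w)) = basecell Y y a b"
      using h(1) unfolding bimap_fiber_iff[OF pm y] by auto
    have l: "bimap K X (horn_lift \<alpha>)" "\<And>a b z. z \<in> cells K a b \<Longrightarrow> p a b (horn_lift \<alpha> a b z) = \<alpha> a b z"
      "\<And>a b z. z \<in> cells H a b \<Longrightarrow> horn_lift \<alpha> a b z = basecell X x a b"
      using horn_lift[OF \<alpha>] by (auto simp: lifts_iff)
    have a: "bimap K Y \<alpha>" "\<And>a b z. z \<in> cells A a b \<Longrightarrow> \<alpha> a b z = basecell Y y a b"
      using \<alpha> by (auto simp: rel_maps_iff)
    have v: "bimap (K \<times>\<^sub>b bsimplex 1 1) Y (\<lambda>a b (z, w). \<alpha> a b z)"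
      using a(1) bisimplicial_set_bprod[OF bs bs] by (auto simp: bimap_def)
    obtain \<xi> where \<xi>: "bimap K X \<xi>" "\<And>a b z. z \<in> cells H a b \<Longrightarrow> \<xi> a b z = basecell X x a b"
      "\<And>a b z. z \<in> cells J a b \<Longrightarrow> \<xi> a b z = h a b (z, origin a b)"
      "\<And>a b z. z \<in> cells K a b \<Longrightarrow> p a b (\<xi> a b z) = (\<lambda>(z, w). \<alpha> a b z) (z, origin a b)"
      by (rule extend_face_homotopy[OF p l(1,3) hX(1) h(2) h(4)[unfolded basecell_fiber] v])
         (simp_all add: hX(2) a(2) l(2) p_basecell bbdryA_Suc JK HK BW)
    have "\<xi> \<in> rel_maps K A X x"
      using \<xi>(1-3) h(3) by (auto simp: rel_maps_iff bbdryA_Suc bconst_def)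
    moreover have "(p \<circ>\<^sub>b \<xi>, \<alpha>) \<in> hrel K A Y y"
      by (rule hrel_of_beq[OF rel_maps_comp[OF pm x pxy calculation] a(1) _ subcomplex_bbdryA])
         (use \<xi>(4) in \<open>auto simp: beq_def bcomp_def\<close>)
    ultimately show ?r by blast
  next
    assume ?r
    then obtain \<xi> where \<xi>: "\<xi> \<in> rel_maps K A X x" "(p \<circ>\<^sub>b \<xi>, \<alpha>) \<in> hrel K A Y y" by blast
    have \<xi>l: "\<xi> \<in> lifts (p \<circ>\<^sub>b \<xi>)"
      using \<xi>(1) by (auto simp: lifts_iff rel_maps_iff bcomp_def bbdryA_Suc)
    have "(\<xi>, horn_lift \<alpha>) \<in> hrel J B F x" by (rule lifts_hrel[OF \<xi>(2) \<xi>l horn_lift[OF \<alpha>]])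
    moreover have "(\<xi>, bconst F x) \<in> hrel J B F x"
    proof (rule hrel_of_beq[OF _ bimap_bconst[OF bs bF xF] _ subcomplex_bbdry])
      show "\<xi> \<in> rel_maps J B F x"
        by (rule lifts_fiber[OF rel_maps_comp[OF pm x pxy \<xi>(1)] \<xi>l])
      show "beq J \<xi> (bconst F x)"
        using \<xi>(1) by (auto simp: beq_def rel_maps_iff bbdryA_Suc bconst_def)
    qed
    ultimately show ?l
      by (rule equiv_transD[OF equiv_hrel[OF kF subcomplex_bbdry] equiv_symD[OF equiv_hrel[OF kF subcomplex_bbdry]]])
  }
qed

text \<open>From left to right, a homotopy in \<open>X\<close> from \<open>*\<close> to \<open>\<beta>\<close> on \<open>J\<close> is extended to a homotopy on \<open>K\<close>
  starting at \<open>*\<close>; its end \<open>\<delta>\<close> restricts to \<open>\<beta>\<close>, so \<open>p \<delta>\<close> has \<open>[\<beta>]\<close> as its image. Conversely, the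
  contraction to the last vertex, restricted to \<open>J\<close>, gives a homotopy in \<open>X\<close> from \<open>*\<close> to the face of
  a lift.\<close>

lemma exact_at_piBC_of_fiber:
  assumes \<beta>: "\<beta> \<in> rel_maps J B F x"
  shows "(bid \<circ>\<^sub>b \<beta>, bconst X x) \<in> hrel J B X x \<longleftrightarrow>
    (\<exists>\<alpha> \<in> rel_maps K A Y y. (horn_lift \<alpha>, \<beta>) \<in> hrel J B F x)" (is "?l \<longleftrightarrow> ?r")
proof
  note bs = bisimplicial_set_bsimplex
  note eX = equiv_hrel[OF kX subcomplex_bbdry, of m n x]
  have JK: "z \<in> cells K a b" if "z \<in> cells J a b" for z a b
    by (rule subcomplexD(4)[OF subcomplex_bsimplex_Suc that])
  {
    assume ?l
    then have "(bconst X x, bid \<circ>\<^sub>b \<beta>) \<in> hrel J B X x" by (rule equiv_symD[OF eX])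
    then obtain h where h: "bimap (J \<times>\<^sub>b bsimplex 1 1) X h"
      "\<And>a b z w. z \<in> cells J a b \<Longrightarrow> w \<in> cells (bhorn 1 1) a b \<Longrightarrow> h a b (z, w) = bconst X x a b z"
      "\<And>a b z. z \<in> cells J a b \<Longrightarrow> h a b (z, origin a b) = (bid \<circ>\<^sub>b \<beta>) a b z"
      "\<And>a b z w. z \<in> cells B a b \<Longrightarrow> w \<in> cells (bsimplex 1 1) a b \<Longrightarrow> h a b (z, w) = basecell X x a b"
      by (rule hrelE) blast
    have v: "bimap (K \<times>\<^sub>b bsimplex 1 1) (bsimplex 0 0) (\<lambda>a b _. origin a b)"
      by (rule bimap_origin[OF bisimplicial_set_bprod[OF bs bs]])
    have c: "bconst X x a b z = basecell X x a b" for a b z by (simp add: bconst_def)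
    obtain \<delta> where \<delta>: "bimap K X \<delta>" "\<And>a b z. z \<in> cells H a b \<Longrightarrow> \<delta> a b z = basecell X x a b"
      "\<And>a b z. z \<in> cells J a b \<Longrightarrow> \<delta> a b z = h a b (z, origin a b)"
      by (rule extend_face_homotopy[OF kX[unfolded kan_def] bimap_bconst[OF bs bX x] c h(1,2,4) v]) blast+
    have \<beta>': "bimap J X \<beta>" "\<And>a b z. z \<in> cells J a b \<Longrightarrow> p a b (\<beta> a b z) = basecell Y y a b"
      using \<beta> by (auto simp: rel_maps_iff bimap_fiber_iff[OF pm y])
    have \<delta>\<beta>: "\<delta> a b z = \<beta> a b z" if "z \<in> cells J a b" for a b z
      using \<delta>(3)[OF that] h(3)[OF that] by (simp add: bcomp_def bid_def)
    have \<alpha>: "p \<circ>\<^sub>b \<delta> \<in> rel_maps K A Y y"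
      using bimap_comp[OF \<delta>(1) pm] \<delta>(2) \<delta>\<beta> \<beta>'(2) p_basecell
      by (auto simp: rel_maps_iff bbdryA_Suc) (simp_all add: bcomp_def)
    have \<delta>l: "\<delta> \<in> lifts (p \<circ>\<^sub>b \<delta>)" using \<delta>(1,2) by (simp add: lifts_iff bcomp_def)
    have "(horn_lift (p \<circ>\<^sub>b \<delta>), \<delta>) \<in> hrel J B F x" by (rule lifts_unique[OF \<alpha> horn_lift[OF \<alpha>] \<delta>l])
    moreover have "(\<delta>, \<beta>) \<in> hrel J B F x"
      by (rule hrel_of_beq[OF lifts_fiber[OF \<alpha> \<delta>l] _ _ subcomplex_bbdry])
         (use \<beta> \<delta>\<beta> in \<open>auto simp: rel_maps_iff beq_def\<close>)
    ultimately have "(horn_lift (p \<circ>\<^sub>b \<delta>), \<beta>) \<in> hrel J B F x"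
      by (rule equiv_transD[OF equiv_hrel[OF kF subcomplex_bbdry]])
    then show ?r using \<alpha> by blast
  next
    assume ?r
    then obtain \<alpha> where \<alpha>: "\<alpha> \<in> rel_maps K A Y y" "(horn_lift \<alpha>, \<beta>) \<in> hrel J B F x" by blast
    let ?l = "horn_lift \<alpha>"
    have l: "bimap K X ?l" "\<And>a b z. z \<in> cells H a b \<Longrightarrow> ?l a b z = basecell X x a b"
      using horn_lift[OF \<alpha>(1)] by (auto simp: lifts_iff)
    have lJ: "?l \<in> rel_maps J B X x"
      using lifts_fiber[OF \<alpha>(1) horn_lift[OF \<alpha>(1)]] by (simp add: rel_maps_fiber_iff[OF pm y])
    have 1: "(bid \<circ>\<^sub>b ?l, bid \<circ>\<^sub>b \<beta>) \<in> hrel J B X x"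
      by (rule hrel_comp[OF iF xF _ \<alpha>(2)]) (simp add: bid_def)
    have 2: "(bconst X x, ?l) \<in> hrel J B X x"
    proof (rule hrelI[OF bconst_rel_maps[OF bs bX x] lJ])
      let ?h = "?l \<circ>\<^sub>b bicone (Suc m) (Suc n)"
      show "bimap (J \<times>\<^sub>b bsimplex 1 1) X ?h"
        by (rule bimap_subcomplex[OF bimap_comp[OF bimap_bicone l(1)]])
           (intro subcomplex_bprod subcomplex_bsimplex_Suc subcomplex_refl bs)
      show "?h a b (z, w) = bconst X x a b z" if "z \<in> cells J a b" "w \<in> cells (bhorn 1 1) a b" for a b z w
        using bicone_bhorn2[OF JK[OF that(1)] that(2)] l(2) by (simp add: bcomp_def bconst_def)
      show "?h a b (z, origin a b) = ?l a b z" if "z \<in> cells J a b" for a b z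
        using bicone_origin[OF JK[OF that]] by (simp add: bcomp_def)
      show "?h a b (z, w) = basecell X x a b"
        if "z \<in> cells B a b" "w \<in> cells (bsimplex 1 1) a b" for a b z w
      proof -
        have "z \<in> cells H a b"
          using subcomplexD(4)[OF subcomplex_bbdry that(1)] bhorn_Suc_bsimplex that(1) by blast
        from l(2)[OF bicone_bhorn1[OF this that(2)]] show ?thesis by (simp add: bcomp_def)
      qed
    qed
    have "bid \<circ>\<^sub>b ?l = ?l" by (simp add: bcomp_def bid_def)
    then show "(bid \<circ>\<^sub>b \<beta>, bconst X x) \<in> hrel J B X x" using 1 equiv_symD[OF eX equiv_transD[OF eX 2]] by simp
  }
qed

lemma connecting_hclass:
  assumes \<alpha>: "\<alpha> \<in> rel_maps K A Y y"
  shows "connecting m n F X x p (hclass K A Y y \<alpha>) = hclass J B F x (horn_lift \<alpha>)"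
proof -
  note eF = equiv_hrel[OF kF subcomplex_bbdry, of m n x] and eY = equiv_hrel[OF kY subcomplex_bbdryA, of "Suc m" "Suc n" y]
  let ?f = "\<lambda>\<gamma>. face1 (Suc m) (Suc m) (face2 (Suc n) (Suc n) \<gamma>)"
  have *: "hclass J B F x (?f \<gamma>) = hclass J B F x (horn_lift \<alpha>)" if "(\<alpha>, \<alpha>') \<in> hrel K A Y y" "\<gamma> \<in> lifts \<alpha>'" for \<alpha>' \<gamma>
  proof -
    have \<alpha>': "\<alpha>' \<in> rel_maps K A Y y" using that(1) by (simp add: hrel_def)
    have "(horn_lift \<alpha>, \<gamma>) \<in> hrel J B F x" by (rule lifts_hrel[OF that(1) horn_lift[OF \<alpha>] that(2)])
    moreover have g: "\<gamma> \<in> rel_maps J B F x" by (rule lifts_fiber[OF \<alpha>' that(2)])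
    have "(\<gamma>, ?f \<gamma>) \<in> hrel J B F x"
      by (rule hrel_of_beq[OF g bimap_cong[where f = \<gamma>] _ subcomplex_bbdry])
         (use g in \<open>auto simp: face_last rel_maps_iff beq_def\<close>)
    ultimately have "(horn_lift \<alpha>, ?f \<gamma>) \<in> hrel J B F x" by (rule equiv_transD[OF eF])
    then show ?thesis unfolding hclass_def by (rule equiv_class_eq[OF eF, symmetric])
  qed
  have "\<alpha> \<in> hclass K A Y y \<alpha>"
    unfolding hclass_def by (rule equiv_class_self[OF eY \<alpha>])
  then show ?thesis
    unfolding connecting_def using * horn_lift[OF \<alpha>] by (auto simp: hclass_def[of K A Y y])
qed

end
end

section \<open>Exactness of the sequence\<close>

lemma induced_hclass:
  assumes eX: "equiv (rel_maps K L X x) (hrel K L X x)" and eY: "equiv (rel_maps K L Y y) (hrel K L Y y)"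
    and p: "bimap X Y p" "x \<in> cells X 0 0" "p 0 0 x = y" and \<alpha>: "\<alpha> \<in> rel_maps K L X x"
  shows "induced K L Y y p (hclass K L X x \<alpha>) = hclass K L Y y (p \<circ>\<^sub>b \<alpha>)"
proof -
  have "hclass K L Y y (p \<circ>\<^sub>b \<beta>) = hclass K L Y y (p \<circ>\<^sub>b \<alpha>)" if "(\<alpha>, \<beta>) \<in> hrel K L X x" for \<beta>
    unfolding hclass_def by (rule equiv_class_eq[OF eY hrel_comp[OF p that], symmetric])
  moreover have "(\<alpha>, \<alpha>) \<in> hrel K L X x" by (rule equiv_reflD[OF eX \<alpha>])
  ultimately show ?thesis unfolding induced_def hclass_def[of K L X x] by blast
qed

text \<open>Maps between quotients that are given by \<open>fr\<close> and \<open>gr\<close> on representatives.\<close>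

lemma exact_at_quotient:
  assumes E: "equiv R1 H1" "equiv R2 H2" "equiv R3 H3"
    and f: "\<And>\<alpha>. \<alpha> \<in> R1 \<Longrightarrow> fr \<alpha> \<in> R2 \<and> f (H1 `` {\<alpha>}) = H2 `` {fr \<alpha>}"
    and g: "\<And>\<beta>. \<beta> \<in> R2 \<Longrightarrow> gr \<beta> \<in> R3 \<and> g (H2 `` {\<beta>}) = H3 `` {gr \<beta>}"
    and c: "c \<in> R3"
    and ex: "\<And>\<beta>. \<beta> \<in> R2 \<Longrightarrow> (gr \<beta>, c) \<in> H3 \<longleftrightarrow> (\<exists>\<alpha> \<in> R1. (fr \<alpha>, \<beta>) \<in> H2)"
  shows "exact_at (R1 // H1) f (R2 // H2) g (H3 `` {c})"
  unfolding exact_at_def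
proof (intro equalityI subsetI)
  fix b assume "b \<in> {b \<in> R2 // H2. g b = H3 `` {c}}"
  then obtain \<beta> where \<beta>: "\<beta> \<in> R2" "b = H2 `` {\<beta>}" "g b = H3 `` {c}" by (auto elim: quotientE)
  then have "(gr \<beta>, c) \<in> H3" using g eq_equiv_class_iff[OF E(3), of "gr \<beta>" c] c by metis
  then obtain \<alpha> where "\<alpha> \<in> R1" "(fr \<alpha>, \<beta>) \<in> H2" using ex \<beta>(1) by blast
  then show "b \<in> f ` (R1 // H1)"
    using f equiv_class_eq[OF E(2)] \<beta>(2) by (metis image_eqI quotientI)
next
  fix b assume "b \<in> f ` (R1 // H1)"
  then obtain \<alpha> where \<alpha>: "\<alpha> \<in> R1" "b = f (H1 `` {\<alpha>})" by (auto elim: quotientE)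
  then have b: "b = H2 `` {fr \<alpha>}" "fr \<alpha> \<in> R2" using f by auto
  have "(fr \<alpha>, fr \<alpha>) \<in> H2" by (rule equiv_reflD[OF E(2) b(2)])
  then have "(gr (fr \<alpha>), c) \<in> H3" using ex[OF b(2)] \<alpha>(1) by blast
  then have "g b = H3 `` {c}" using g[OF b(2)] b(1) equiv_class_eq[OF E(3)] by metis
  then show "b \<in> {b \<in> R2 // H2. g b = H3 `` {c}}" using b by (auto intro: quotientI)
qed

lemma pointed_map_quotient:
  assumes E: "equiv R2 H2"
    and f: "\<And>\<alpha>. \<alpha> \<in> R1 \<Longrightarrow> fr \<alpha> \<in> R2 \<and> f (H1 `` {\<alpha>}) = H2 `` {fr \<alpha>}"
    and c: "c1 \<in> R1" "(fr c1, c2) \<in> H2"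
  shows "pointed_map (R1 // H1) (H1 `` {c1}) (R2 // H2) (H2 `` {c2}) f"
proof -
  have "c2 \<in> R2" using c(2) equiv_type[OF E] by blast
  moreover have "f (H1 `` {c1}) = H2 `` {c2}" using f[OF c(1)] equiv_class_eq[OF E c(2)] by simp
  ultimately show ?thesis
    unfolding pointed_map_def using f c(1) by (auto intro!: quotientI elim!: quotientE)
qed

theorem corollary3p33:
  fixes F X :: "'x biset" and Y :: "'y biset" and x :: 'x and y :: 'y
    and i :: "('x, 'x) bfun" and p :: "('x, 'y) bfun" and m n :: nat
  assumes "fiber_sequence F i X x p Y y"
  shows
    "pointed_map (piA (m+1) (n+1) F x) (ptA (m+1) (n+1) F x)
       (piA (m+1) (n+1) X x) (ptA (m+1) (n+1) X x) (inducedA (m+1) (n+1) X x i) \<and>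
     pointed_map (piA (m+1) (n+1) X x) (ptA (m+1) (n+1) X x)
       (piA (m+1) (n+1) Y y) (ptA (m+1) (n+1) Y y) (inducedA (m+1) (n+1) Y y p) \<and>
     pointed_map (piA (m+1) (n+1) Y y) (ptA (m+1) (n+1) Y y)
       (piBC m n F x) (ptBC m n F x) (connecting m n F X x p) \<and>
     pointed_map (piBC m n F x) (ptBC m n F x)
       (piBC m n X x) (ptBC m n X x) (inducedBC m n X x i) \<and>
     pointed_map (piBC m n X x) (ptBC m n X x)
       (piBC m n Y y) (ptBC m n Y y) (inducedBC m n Y y p) \<and>
     exact_at (piA (m+1) (n+1) F x) (inducedA (m+1) (n+1) X x i)
       (piA (m+1) (n+1) X x) (inducedA (m+1) (n+1) Y y p) (ptA (m+1) (n+1) Y y) \<and>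
     exact_at (piA (m+1) (n+1) X x) (inducedA (m+1) (n+1) Y y p)
       (piA (m+1) (n+1) Y y) (connecting m n F X x p) (ptBC m n F x) \<and>
     exact_at (piA (m+1) (n+1) Y y) (connecting m n F X x p)
       (piBC m n F x) (inducedBC m n X x i) (ptBC m n X x) \<and>
     exact_at (piBC m n F x) (inducedBC m n X x i)
       (piBC m n X x) (inducedBC m n Y y p) (ptBC m n Y y)"
proof -
  have x: "x \<in> cells X 0 0" and y: "y \<in> cells Y 0 0" and pxy: "p 0 0 x = y" and p: "bifib X Y p"
    and kY: "kan Y" and F: "F = fiber X p Y y" and i: "i = bid"
    using assms by (auto simp: fiber_sequence_def fibration_bifib fibrant_kan)
  have kX: "kan X" by (rule bifib_kan[OF p kY])
  note hyp = p kX kY x y pxy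
  note maps = fiber_sequence_facts[OF hyp, folded F]
  note pm = maps(1) and bX = maps(2) and bY = maps(3) and bF = maps(4) and kF = maps(5)
    and xF = maps(6) and iF = maps(7)
  note bs = bisimplicial_set_bsimplex
  have ix: "bid 0 0 x = x" by (simp add: bid_def)
  note ind = induced_hclass[OF equiv_hrel equiv_hrel]
  have I: "bid \<circ>\<^sub>b \<alpha> \<in> rel_maps (bsimplex k l) L X x \<and>
      induced (bsimplex k l) L X x bid (hrel (bsimplex k l) L F x `` {\<alpha>}) = hrel (bsimplex k l) L X x `` {bid \<circ>\<^sub>b \<alpha>}"
    if "subcomplex L (bsimplex k l)" "\<alpha> \<in> rel_maps (bsimplex k l) L F x" for k l L \<alpha>
    using ind[OF kF that(1) kX that(1) iF xF ix that(2)] rel_maps_comp[OF iF xF ix that(2)]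
    by (simp add: hclass_def)
  have P: "p \<circ>\<^sub>b \<alpha> \<in> rel_maps (bsimplex k l) L Y y \<and>
      induced (bsimplex k l) L Y y p (hrel (bsimplex k l) L X x `` {\<alpha>}) = hrel (bsimplex k l) L Y y `` {p \<circ>\<^sub>b \<alpha>}"
    if "subcomplex L (bsimplex k l)" "\<alpha> \<in> rel_maps (bsimplex k l) L X x" for k l L \<alpha>
    using ind[OF kX that(1) kY that(1) pm x pxy that(2)] rel_maps_comp[OF pm x pxy that(2)]
    by (simp add: hclass_def)
  let ?l = "horn_lift X p x m n"
  let ?K = "bsimplex (Suc m) (Suc n)" and ?A = "bbdryA (Suc m) (Suc n)" and ?J = "bsimplex m n" and ?B = "bbdry m n"
  have C: "?l \<alpha> \<in> rel_maps ?J ?B F x \<and>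
      connecting m n F X x p (hrel ?K ?A Y y `` {\<alpha>}) = hrel ?J ?B F x `` {?l \<alpha>}"
    if "\<alpha> \<in> rel_maps ?K ?A Y y" for \<alpha>
    using connecting_hclass[OF hyp that, folded F] lifts_fiber[OF hyp that horn_lift[OF hyp that], folded F]
    by (simp add: hclass_def)
  have Ic: "(bid \<circ>\<^sub>b bconst F x, bconst X x) \<in> hrel (bsimplex k l) L X x"
    if "subcomplex L (bsimplex k l)" for k l L
    by (rule hrel_of_beq[OF rel_maps_comp[OF iF xF ix bconst_rel_maps[OF bs bF xF]] bimap_bconst[OF bs bX x] _ that])
       (simp add: beq_def bcomp_def bid_def bconst_def F)
  have Pc: "(p \<circ>\<^sub>b bconst X x, bconst Y y) \<in> hrel (bsimplex k l) L Y y"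
    if "subcomplex L (bsimplex k l)" for k l L
    by (rule hrel_of_beq[OF rel_maps_comp[OF pm x pxy bconst_rel_maps[OF bs bX x]] bimap_bconst[OF bs bY y] _ that])
       (simp add: beq_def bcomp_def bconst_def p_basecell[OF hyp])
  have Cc: "(?l (bconst Y y), bconst F x) \<in> hrel ?J ?B F x"
    using exact_at_piA_of_base[OF hyp bconst_rel_maps[OF bs bY y], folded F] Pc[OF subcomplex_bbdryA]
      bconst_rel_maps[OF bs bX x] by blast
  note cF = bconst_rel_maps[OF bs bF xF] and cX = bconst_rel_maps[OF bs bX x]
    and cY = bconst_rel_maps[OF bs bY y]
  note eA = equiv_hrel[OF _ subcomplex_bbdryA] and eB = equiv_hrel[OF _ subcomplex_bbdry]
  show ?thesis
    unfolding i hclasses_def hclass_def Suc_eq_plus1[symmetric]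
  proof (intro conjI, goal_cases)
    case 1
    show ?case
      by (rule pointed_map_quotient[where fr = "(\<circ>\<^sub>b) bid", OF eA[OF kX] _ cF Ic[OF subcomplex_bbdryA]]) (rule I[OF subcomplex_bbdryA])
  next
    case 2
    show ?case
      by (rule pointed_map_quotient[where fr = "(\<circ>\<^sub>b) p", OF eA[OF kY] _ cX Pc[OF subcomplex_bbdryA]]) (rule P[OF subcomplex_bbdryA])
  next
    case 3
    show ?case
      by (rule pointed_map_quotient[where fr = ?l, OF eB[OF kF] _ cY Cc]) (rule C)
  next
    case 4
    show ?case
      by (rule pointed_map_quotient[where fr = "(\<circ>\<^sub>b) bid", OF eB[OF kX] _ cF Ic[OF subcomplex_bbdry]]) (rule I[OF subcomplex_bbdry])
  next
    case 5
    show ?case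
      by (rule pointed_map_quotient[where fr = "(\<circ>\<^sub>b) p", OF eB[OF kY] _ cX Pc[OF subcomplex_bbdry]]) (rule P[OF subcomplex_bbdry])
  next
    case 6
    show ?case
      by (rule exact_at_quotient[where fr = "(\<circ>\<^sub>b) bid" and gr = "(\<circ>\<^sub>b) p", OF eA[OF kF] eA[OF kX] eA[OF kY] _ _ cY])
        (rule I[OF subcomplex_bbdryA], assumption, rule P[OF subcomplex_bbdryA], assumption, rule exact_at_total[OF hyp subcomplex_bbdryA, folded F], assumption)
  next
    case 7
    show ?case
      by (rule exact_at_quotient[where fr = "(\<circ>\<^sub>b) p" and gr = ?l, OF eA[OF kX] eA[OF kY] eB[OF kF] _ _ cF])
        (rule P[OF subcomplex_bbdryA], assumption, rule C, assumption, rule exact_at_piA_of_base[OF hyp, folded F], assumption)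
  next
    case 8
    show ?case
      by (rule exact_at_quotient[where fr = ?l and gr = "(\<circ>\<^sub>b) bid", OF eA[OF kY] eB[OF kF] eB[OF kX] _ _ cX])
        (rule C, assumption, rule I[OF subcomplex_bbdry], assumption, rule exact_at_piBC_of_fiber[OF hyp, folded F], assumption)
  next
    case 9
    show ?case
      by (rule exact_at_quotient[where fr = "(\<circ>\<^sub>b) bid" and gr = "(\<circ>\<^sub>b) p", OF eB[OF kF] eB[OF kX] eB[OF kY] _ _ cY])
        (rule I[OF subcomplex_bbdry], assumption, rule P[OF subcomplex_bbdry], assumption, rule exact_at_total[OF hyp subcomplex_bbdry, folded F], assumption)
  qed
qed

end
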